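(* Let $\mathbf A\in\mathbb R^{n\times n}$ be symmetric with $\|\mathbf A\|_\infty\le 1$ and eigenvalues $\lambda_1(\mathbf A)\ge\dots\ge\lambda_n(\mathbf A)$, and let $\epsilon,\delta\in(0,1)$. Let $S\subseteq[n]$ be a random set formed by including each index $i\in[n]$ independently with probability $s/n$ (where $0<s\le n$). Let $\mathbf A_S$ be the corresponding principal submatrix of $\mathbf A$, with eigenvalues $\lambda_1(\mathbf A_S)\ge\dots\ge\lambda_{|S|}(\mathbf A_S)$. For all $i\in[|S|]$ with $\lambda_i(\mathbf A_S)\ge 0$, let $\tilde\lambda_i(\mathbf A)=\frac ns\cdot\lambda_i(\mathbf A_S)$. For all $i\in[|S|]$ with $\lambda_i(\mathbf A_S)<0$, let $\tilde\lambda_{n-(|S|-i)}(\mathbf A)=\frac ns\cdot\lambda_i(\mathbf A_S)$. For all other $i\in[n]$, let $\tilde\lambda_i(\mathbf A)=0$. If $$s\ge\frac{c\,\log(1/(\epsilon\delta))\cdot\log^3 n}{\epsilon^3\delta}$$ for a large enough (absolute) constant $c$, then with probability at least $1-\delta$, for all $i\in[n]$, $$\lambda_i(\mathbf A)-\epsilon n\le\tilde\lambda_i(\mathbf A)\le\lambda_i(\mathbf A)+\epsilon n.$$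
   Context: $[n]=\{1,\dots,n\}$. $\|\mathbf A\|_\infty$ is the largest magnitude of an entry of $\mathbf A$. $\mathbf A_S$ is the principal submatrix of $\mathbf A$ with rows and columns indexed by $S$. $\log^3 n=(\log n)^3$.
   Formalization: Both logarithms in the lower bound on s are read as max(1, ln x); with the bare logarithm the claim fails for every c (e.g. n=1, A=(1), s=ε=δ=1/10, or ε,δ close to 1 with the all-ones matrix). *)

theory Defs
  imports
    "HOL-Probability.Probability"
    "HOL-Probability.Product_PMF"
    "Jordan_Normal_Form.Char_Poly"
    "Jordan_Normal_Form.DL_Submatrix"
begin

(* Index conventions: eigenvalues are numbered from 1, while rows and columns of a mat are
   numbered from 0, so the set [n] of row/column indices is {..<n}. *)

(* The roots of the characteristic polynomial with algebraic multiplicity. Over the reals this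
   is a list of dim_row A numbers whenever A is symmetric, the only case it is used for. *)
definition eigenvalues_desc :: "real mat \<Rightarrow> real list" where
  "eigenvalues_desc A = rev (sorted_list_of_multiset (proots (char_poly A)))"

definition eigval :: "real mat \<Rightarrow> nat \<Rightarrow> real" where
  "eigval A i = eigenvalues_desc A ! (i - 1)"

(* Only meaningful for matrices with at least one entry. *)
definition max_entry_norm :: "real mat \<Rightarrow> real" where
  "max_entry_norm A = Max (abs ` elements_mat A)"

definition principal_submatrix :: "real mat \<Rightarrow> nat set \<Rightarrow> real mat" where
  "principal_submatrix A S = submatrix A S S"

definition random_index_set :: "nat \<Rightarrow> real \<Rightarrow> nat set pmf" where
  "random_index_set n p =
     map_pmf (\<lambda>b. {i \<in> {..<n}. b i}) (Pi_pmf {..<n} False (\<lambda>_. bernoulli_pmf p))"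

(* The second case is the assignment to position j = n - (|S| - i), solved for i; by S \<subseteq> [n]
   the subtractions do not truncate. The nonnegative eigenvalues of the submatrix come first in
   decreasing order, so the first two cases never compete for the same j. *)
definition approx_eigval :: "nat \<Rightarrow> real \<Rightarrow> real mat \<Rightarrow> nat set \<Rightarrow> nat \<Rightarrow> real" where
  "approx_eigval n s A S j =
     (let k = card S; B = principal_submatrix A S in
      if j \<in> {1..k} \<and> eigval B j \<ge> 0 then real n / s * eigval B j
      else if j \<in> {n - k + 1..n} \<and> eigval B (j - (n - k)) < 0
        then real n / s * eigval B (j - (n - k))
      else 0)"

(* The logarithm as it is meant in a sample-size bound up to an absolute constant: never below 1.
   With the bare logarithm the bound on s degenerates to a vacuous condition as its argument tends
   to 1, and the approximation guarantee fails: for n = 1 every s in (0,1] would be admitted, and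
   for eps, delta close to 1 so would arbitrarily small s. *)
definition log_ge1 :: "real \<Rightarrow> real" where
  "log_ge1 x = max 1 (ln x)"

end

theory Submission
  imports Defs
begin

text \<open>Write \<open>p = s/n\<close>, \<open>e = \<epsilon>n/4\<close> and split the spectral decomposition
  \<open>A = \<Sum>\<^sub>k \<lambda>\<^sub>k v\<^sub>k v\<^sub>k\<^sup>T\<close> into outliers \<open>\<bar>\<lambda>\<^sub>k\<bar> \<ge> \<tau> = e/56\<close> and a small part. Entries bounded by \<open>1\<close> force
  the outlying eigenvectors to be incoherent, so the Gram matrix \<open>V\<^sub>S\<^sup>T V\<^sub>S\<close> of their sampled rows is within
  \<open>p\<Phi>\<^sup>-\<^sup>1\<close> of \<open>p\<cdot>1\<close>, where \<open>\<Phi> = diag(2 + \<bar>\<lambda>\<^sub>k\<bar>/e)\<close>; this weighting gives the rate \<open>1/\<epsilon>\<^sup>3\<close>. The small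
  part restricted to \<open>S\<close> has norm at most \<open>pe\<close>, by decoupling followed by repeated one-sided sampling
  bounds. Given these two events, test subspaces compare the numbers of eigenvalues of \<open>A\<close> and
  of \<open>A\<^sub>S/p\<close> above each threshold up to \<open>2e\<close>. All matrix concentration rests on the inequality
  \<open>w\<^sup>T(X + w w\<^sup>T)\<^sup>m w \<le> w\<^sup>T(X + \<bar>w\<bar>\<^sup>2)\<^sup>m w\<close> for positive semidefinite \<open>X\<close>, which bounds trace moments of
  sampled sums of rank-one matrices without any trace inequality for exponentials; the resulting tails
  are exponential, so \<open>s \<ge> c log(n/\<delta>)/\<epsilon>\<^sup>3\<close> already suffices.\<close>

section \<open>Spectral decompositions over finite index sets\<close>

text \<open>A uniform relative error \<epsilon> on the sampled outlier directions would cost s of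
  order 1/\<epsilon>^4: their rows have squared length about 1/(\<epsilon>^2 n) and the mean is p.
  But an outlier of size |lam| tolerates relative error e/|lam|, so only the largest eigenvalues
  need precision \<epsilon>. Rescaling by square roots of \<Phi> makes the tolerance uniformly p.
  The rows keep squared length of order 1/(\<epsilon>^2 n), because the row norms of A bound the
  sums of lam_k^2 v_k(i)^2 by n; only the mean grows, to about p/\<epsilon>. The exponent
  tolerance^2/(mean * length) becomes s \<epsilon>^3. The quarter in e pays for two losses of 2e,
  one in the threshold counts and one where an eigenvalue near 0 and its estimate differ in sign.
  The 56 has to keep 256 (\<tau>/e)^2, the direct contribution of \<tau> to the moment ratio of the
  small part for every n and s, well below 1/3. Vectors and matrices are functions read on a finite
  index set: passing to A_S changes only the summation set, and Gram matrices are indexed by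
  eigenvalue labels without renumbering.\<close>

definition inner_on :: "'a set \<Rightarrow> ('a \<Rightarrow> real) \<Rightarrow> ('a \<Rightarrow> real) \<Rightarrow> real" where
  "inner_on I x y = (\<Sum>i\<in>I. x i * y i)"

definition apply_on :: "'a set \<Rightarrow> ('a \<Rightarrow> 'a \<Rightarrow> real) \<Rightarrow> ('a \<Rightarrow> real) \<Rightarrow> 'a \<Rightarrow> real" where
  "apply_on I X x i = (\<Sum>j\<in>I. X i j * x j)"

text \<open>Both relations of an orthogonal matrix are recorded: orthonormality of the
  \<open>u k\<close>, and completeness, from which Parseval follows by pure summation. The labels in
  \<open>K\<close> need not be indices in \<open>I\<close>, and nothing is said about values outside
  \<open>I\<close>.\<close>

definition spectral ::
  "'a set \<Rightarrow> ('a \<Rightarrow> 'a \<Rightarrow> real) \<Rightarrow> 'b set \<Rightarrow> ('b \<Rightarrow> real) \<Rightarrow> ('b \<Rightarrow> 'a \<Rightarrow> real) \<Rightarrow> bool" where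
  "spectral I X K z u \<longleftrightarrow> finite I \<and> finite K \<and>
     (\<forall>k\<in>K. \<forall>l\<in>K. inner_on I (u k) (u l) = (if k = l then 1 else 0)) \<and>
     (\<forall>i\<in>I. \<forall>j\<in>I. (\<Sum>k\<in>K. u k i * u k j) = (if i = j then 1 else 0)) \<and>
     (\<forall>i\<in>I. \<forall>j\<in>I. X i j = (\<Sum>k\<in>K. z k * u k i * u k j))"

section \<open>Algebra of inner products and quadratic forms\<close>

lemma inner_on_commute: "inner_on I x y = inner_on I y x"
  by (simp add: inner_on_def mult.commute)

lemma inner_on_add_right: "inner_on I x (\<lambda>i. y i + z i) = inner_on I x y + inner_on I x z"
  by (simp add: inner_on_def algebra_simps sum.distrib)

lemma inner_on_diff_right: "inner_on I x (\<lambda>i. y i - z i) = inner_on I x y - inner_on I x z"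
  by (simp add: inner_on_def algebra_simps sum_subtractf)

lemma inner_on_scale_right: "inner_on I x (\<lambda>i. c * y i) = c * inner_on I x y"
  by (simp add: inner_on_def algebra_simps sum_distrib_left)

lemma inner_on_sum_right:
  "inner_on I x (\<lambda>i. \<Sum>k\<in>K. f k i) = (\<Sum>k\<in>K. inner_on I x (f k))"
  by (simp add: inner_on_def sum_distrib_left sum.swap[of _ I K])

lemma inner_on_self_nonneg: "inner_on I x x \<ge> 0"
  by (simp add: inner_on_def sum_nonneg)

lemma inner_on_self_eq_0: "finite I \<Longrightarrow> inner_on I x x = 0 \<longleftrightarrow> (\<forall>i\<in>I. x i = 0)"
  by (simp add: inner_on_def sum_nonneg_eq_0_iff)

lemma inner_on_cong:
  "(\<And>i. i \<in> I \<Longrightarrow> x i = x' i) \<Longrightarrow> (\<And>i. i \<in> I \<Longrightarrow> y i = y' i) \<Longrightarrow> inner_on I x y = inner_on I x' y'"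
  by (simp add: inner_on_def)

lemma inner_on_Cauchy_Schwarz: "(inner_on I x y)\<^sup>2 \<le> inner_on I x x * inner_on I y y"
  unfolding inner_on_def using Cauchy_Schwarz_ineq_sum[of x y I] by (simp add: power2_eq_square)

lemma apply_on_add: "apply_on I X (\<lambda>i. x i + y i) i = apply_on I X x i + apply_on I X y i"
  by (simp add: apply_on_def algebra_simps sum.distrib)

lemma apply_on_scale: "apply_on I X (\<lambda>i. c * x i) i = c * apply_on I X x i"
  by (simp add: apply_on_def algebra_simps sum_distrib_left)

lemma apply_on_symmetric:
  assumes "\<And>i j. i \<in> I \<Longrightarrow> j \<in> I \<Longrightarrow> X i j = X j i"
  shows "inner_on I x (apply_on I X y) = inner_on I (apply_on I X x) y"
proof -
  have "inner_on I x (apply_on I X y) = (\<Sum>i\<in>I. \<Sum>j\<in>I. x i * X i j * y j)"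
    by (simp add: inner_on_def apply_on_def sum_distrib_left mult.assoc)
  also have "\<dots> = (\<Sum>j\<in>I. \<Sum>i\<in>I. x i * X i j * y j)" by (rule sum.swap)
  also have "\<dots> = inner_on I (apply_on I X x) y"
    by (auto simp: inner_on_def apply_on_def sum_distrib_right assms intro!: sum.cong)
  finally show ?thesis .
qed

lemma inner_apply_rank_one_sum:
  assumes "\<And>i j. i \<in> I \<Longrightarrow> j \<in> I \<Longrightarrow> X i j = (\<Sum>k\<in>K. z k * u k i * u k j)"
  shows "inner_on I x (apply_on I X y) = (\<Sum>k\<in>K. z k * inner_on I (u k) x * inner_on I (u k) y)"
proof -
  have "inner_on I x (apply_on I X y) = (\<Sum>i\<in>I. \<Sum>j\<in>I. \<Sum>k\<in>K. z k * (u k i * x i) * (u k j * y j))"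
    unfolding inner_on_def apply_on_def
    by (auto simp: assms sum_distrib_left sum_distrib_right algebra_simps intro!: sum.cong)
  also have "\<dots> = (\<Sum>i\<in>I. \<Sum>k\<in>K. \<Sum>j\<in>I. z k * (u k i * x i) * (u k j * y j))"
    by (intro sum.cong refl sum.swap)
  also have "\<dots> = (\<Sum>k\<in>K. \<Sum>i\<in>I. \<Sum>j\<in>I. z k * (u k i * x i) * (u k j * y j))" by (rule sum.swap)
  also have "\<dots> = (\<Sum>k\<in>K. z k * inner_on I (u k) x * inner_on I (u k) y)"
    unfolding inner_on_def
    by (simp only: mult.assoc sum_product) (simp add: sum_distrib_left mult.assoc)
  finally show ?thesis .
qed

context
  fixes I :: "'a set" and X K z and u :: "'b \<Rightarrow> 'a \<Rightarrow> real"
  assumes spec: "spectral I X K z u"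
begin

lemma spectral_finite: "finite I" "finite K"
  using spec by (auto simp: spectral_def)

lemma spectral_orthonormal:
  "k \<in> K \<Longrightarrow> l \<in> K \<Longrightarrow> inner_on I (u k) (u l) = (if k = l then 1 else 0)"
  using spec by (auto simp: spectral_def)

lemma spectral_inner: "inner_on I x (apply_on I X y) =
    (\<Sum>k\<in>K. z k * inner_on I (u k) x * inner_on I (u k) y)"
  by (rule inner_apply_rank_one_sum) (use spec in \<open>auto simp: spectral_def\<close>)

lemma spectral_Parseval: "inner_on I x y = (\<Sum>k\<in>K. inner_on I (u k) x * inner_on I (u k) y)"
proof -
  have "inner_on I x (apply_on I (\<lambda>i j. if i = j then 1 else 0) y) =
      (\<Sum>k\<in>K. 1 * inner_on I (u k) x * inner_on I (u k) y)"
    by (rule inner_apply_rank_one_sum) (use spec in \<open>auto simp: spectral_def\<close>)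
  moreover have "inner_on I x (apply_on I (\<lambda>i j. if i = j then 1 else 0) y) = inner_on I x y"
    using spectral_finite by (auto simp: inner_on_def apply_on_def if_distrib[of "\<lambda>c. c * _"]
        intro!: sum.cong cong: if_cong)
  ultimately show ?thesis by simp
qed

lemma spectral_inner_eigenvector:
  assumes "k \<in> K"
  shows "inner_on I (u k) (apply_on I X y) = z k * inner_on I (u k) y"
proof -
  have "inner_on I (u k) (apply_on I X y) =
      (\<Sum>l\<in>K. (if l = k then z k * inner_on I (u k) y else 0))"
    unfolding spectral_inner by (intro sum.cong refl) (use assms spectral_orthonormal in auto)
  then show ?thesis using assms spectral_finite by simp
qed

lemma spectral_eigenvalue: "k \<in> K \<Longrightarrow> z k = inner_on I (u k) (apply_on I X (u k))"
  by (simp add: spectral_inner_eigenvector spectral_orthonormal)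

end

lemma spectral_shift:
  assumes "spectral I X K z u"
  shows "spectral I (\<lambda>i j. a * X i j + (if i = j then c else 0)) K (\<lambda>k. a * z k + c) u"
proof -
  have "a * X i j + (if i = j then c else 0) = (\<Sum>k\<in>K. (a * z k + c) * u k i * u k j)"
    if "i \<in> I" "j \<in> I" for i j
  proof -
    have "(\<Sum>k\<in>K. (a * z k + c) * u k i * u k j) =
        a * (\<Sum>k\<in>K. z k * u k i * u k j) + c * (\<Sum>k\<in>K. u k i * u k j)"
      by (simp add: algebra_simps sum.distrib sum_distrib_left)
    also have "\<dots> = a * X i j + c * (if i = j then 1 else 0)"
      using assms that by (simp add: spectral_def)
    finally show ?thesis by simp
  qed
  then show ?thesis using assms by (simp add: spectral_def)
qed

text \<open>Gaussian elimination, one equation per induction step: the pivot \<open>p\<close>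
  removes one unknown, \<open>g\<close> is the reduced system, and \<open>t\<close> is the value
  that equation \<open>c\<close> then forces on the pivot. All dimension counts below, from
  eigenvectors to test subspaces, go through this lemma.\<close>

lemma homogeneous_nontrivial_solution:
  fixes f :: "'c \<Rightarrow> 'k \<Rightarrow> real"
  assumes "finite C" "finite K" "card C < card K"
  shows "\<exists>y. (\<exists>k\<in>K. y k \<noteq> 0) \<and> (\<forall>c\<in>C. (\<Sum>k\<in>K. f c k * y k) = 0)"
  using assms
proof (induction C arbitrary: K f rule: finite_induct)
  case empty
  then obtain k where "k \<in> K" by fastforce
  then show ?case by (intro exI[of _ "\<lambda>_. 1"]) auto
next
  case (insert c C)
  show ?case
  proof (cases "\<forall>k\<in>K. f c k = 0")
    case True
    have "\<exists>y. (\<exists>k\<in>K. y k \<noteq> 0) \<and> (\<forall>c\<in>C. (\<Sum>k\<in>K. f c k * y k) = 0)"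
      by (rule insert.IH) (use insert in auto)
    then obtain y where "\<exists>k\<in>K. y k \<noteq> 0" "\<forall>c\<in>C. (\<Sum>k\<in>K. f c k * y k) = 0" by blast
    with True show ?thesis by (intro exI[of _ y]) auto
  next
    case False
    then obtain p where p: "p \<in> K" "f c p \<noteq> 0" by auto
    define g where "g d k = f d k - f d p * f c k / f c p" for d k
    have "\<exists>y. (\<exists>k\<in>K - {p}. y k \<noteq> 0) \<and> (\<forall>d\<in>C. (\<Sum>k\<in>K-{p}. g d k * y k) = 0)"
      by (rule insert.IH) (use insert.prems insert.hyps p in auto)
    then obtain y where y: "\<exists>k\<in>K - {p}. y k \<noteq> 0" "\<forall>d\<in>C. (\<Sum>k\<in>K-{p}. g d k * y k) = 0"
      by blast
    define t where "t = - (\<Sum>k\<in>K-{p}. f c k * y k) / f c p"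
    define y' where "y' k = (if k = p then t else y k)" for k
    have eq: "(\<Sum>k\<in>K. f d k * y' k) = f d p * t + (\<Sum>k\<in>K-{p}. f d k * y k)" for d
    proof -
      have "(\<Sum>k\<in>K. f d k * y' k) = f d p * y' p + (\<Sum>k\<in>K-{p}. f d k * y' k)"
        using p insert.prems by (simp add: sum.remove)
      also have "(\<Sum>k\<in>K-{p}. f d k * y' k) = (\<Sum>k\<in>K-{p}. f d k * y k)"
        by (intro sum.cong) (auto simp: y'_def)
      finally show ?thesis by (simp add: y'_def)
    qed
    have "(\<Sum>k\<in>K. f d k * y' k) = 0" if "d \<in> C" for d
    proof -
      have "(\<Sum>k\<in>K-{p}. g d k * y k) =
          (\<Sum>k\<in>K-{p}. f d k * y k) - f d p / f c p * (\<Sum>k\<in>K-{p}. f c k * y k)"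
        by (simp add: g_def algebra_simps sum_subtractf sum_distrib_left)
      then show ?thesis using y(2) that eq[of d] p by (simp add: t_def)
    qed
    moreover have "(\<Sum>k\<in>K. f c k * y' k) = 0" using eq[of c] p by (simp add: t_def)
    moreover have "\<exists>k\<in>K. y' k \<noteq> 0" using y(1) by (auto simp: y'_def)
    ultimately show ?thesis by (intro exI[of _ y']) auto
  qed
qed

lemma nonneg_quadratic_no_linear_term:
  fixes b c :: real
  assumes "\<And>t. 2 * t * b + t\<^sup>2 * c \<ge> 0" "c \<ge> 0"
  shows "b = 0"
proof (rule ccontr)
  assume "b \<noteq> 0"
  \<comment> \<open>The minimum would be at t = -b/c; dividing by c + 1 instead also covers c =
    0.\<close>
  define d where "d = c + 1"
  have d: "d > 0" "c = d - 1" using assms(2) by (auto simp: d_def)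
  have "2 * (- b / d) * b + (- b / d)\<^sup>2 * c = - (b\<^sup>2 * (d + 1)) / d\<^sup>2"
    unfolding d(2) using d(1) by (simp add: field_simps power2_eq_square)
  also have "\<dots> < 0" using \<open>b \<noteq> 0\<close> d(1) by (intro divide_neg_pos) auto
  finally show False using assms(1)[of "- b / d"] by simp
qed

text \<open>A maximiser of the form over unit vectors orthogonal to the known eigenvectors is an
  eigenvector: its residual is orthogonal to that complement by criticality and lies in it because
  the complement is invariant under \<open>X\<close>, so it vanishes.\<close>

lemma symmetric_next_eigenvector:
  fixes X :: "'a \<Rightarrow> 'a \<Rightarrow> real" and u :: "'b \<Rightarrow> 'a \<Rightarrow> real"
  assumes I: "finite I" and K: "finite K" "card K < card I"
    and sym: "\<And>i j. i \<in> I \<Longrightarrow> j \<in> I \<Longrightarrow> X i j = X j i"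
    and eig: "\<And>k i. k \<in> K \<Longrightarrow> i \<in> I \<Longrightarrow> apply_on I X (u k) i = z k * u k i"
  shows "\<exists>v \<mu>. inner_on I v v = 1 \<and> (\<forall>k\<in>K. inner_on I (u k) v = 0) \<and>
    (\<forall>i\<in>I. apply_on I X v i = \<mu> * v i)"
proof -
  define W where "W = {x. \<forall>k\<in>K. inner_on I (u k) x = 0}"
  \<comment> \<open>The full function space may be infinite-dimensional; fixing all coordinates
    outside \<open>I\<close> to 0 leaves a product of compact factors.\<close>
  define B :: "('a \<Rightarrow> real) set" where "B = Pi\<^sub>E UNIV (\<lambda>i. if i \<in> I then {-1..1} else {0})"
  have "compactin (product_topology (\<lambda>i. euclidean) UNIV) B"
    unfolding B_def by (subst compactin_PiE) (auto simp: compactin_euclidean_iff)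
  then have compB: "compact B" by (simp add: euclidean_product_topology compactin_euclidean_iff)
  define C where "C = B \<inter> ({x. inner_on I x x = 1} \<inter> (\<Inter>k\<in>K. {x. inner_on I (u k) x = 0}))"
  have coord: "continuous_on UNIV (\<lambda>x::'a \<Rightarrow> real. x i)" for i
    by (rule continuous_on_product_coordinates)
  have "compact C" unfolding C_def inner_on_def
    by (intro compact_Int_closed compB closed_Int closed_INT ballI closed_Collect_eq
        continuous_intros coord)
  have CI: "x \<in> C" if "x \<in> W" "inner_on I x x = 1" "\<And>i. i \<notin> I \<Longrightarrow> x i = 0" for x
  proof -
    have "\<bar>x i\<bar> \<le> 1" if "i \<in> I" for i
    proof -
      have "(x i)\<^sup>2 \<le> (\<Sum>j\<in>I. (x j)\<^sup>2)" using I that by (intro member_le_sum) auto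
      then have "(x i)\<^sup>2 \<le> 1" using \<open>inner_on I x x = 1\<close> by (simp add: inner_on_def power2_eq_square)
      then show ?thesis by (simp add: abs_square_le_1)
    qed
    then show ?thesis using that by (auto simp: C_def B_def W_def abs_le_iff minus_le_iff)
  qed
  have normalize: "\<exists>x'\<in>C. \<exists>c\<ge>0. \<forall>i\<in>I. x i = c * x' i"
    if "x \<in> W" "inner_on I x x \<noteq> 0" for x
  proof -
    define r where "r = sqrt (inner_on I x x)"
    have r: "r > 0" "r\<^sup>2 = inner_on I x x"
      using inner_on_self_nonneg[of I x] that by (auto simp: r_def)
    define x' where "x' i = (if i \<in> I then (1 / r) * x i else 0)" for i
    have *: "inner_on I y x' = (1 / r) * inner_on I y x" for y
      by (subst inner_on_scale_right[symmetric], rule inner_on_cong) (auto simp: x'_def)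
    have "inner_on I x' x' = (1 / r) * ((1 / r) * inner_on I x x)"
      by (metis * inner_on_commute)
    then have "inner_on I x' x' = 1" using r that by (simp add: r(2)[symmetric] power2_eq_square)
    moreover have "x' \<in> W" using that by (auto simp: W_def *)
    ultimately have "x' \<in> C" by (intro CI) (auto simp: x'_def)
    moreover have "\<forall>i\<in>I. x i = r * x' i" using r by (auto simp: x'_def)
    ultimately show ?thesis using r by (intro bexI[of _ x'] exI[of _ r]) auto
  qed
  obtain y where y: "\<exists>i\<in>I. y i \<noteq> 0" "\<forall>k\<in>K. (\<Sum>i\<in>I. u k i * y i) = 0"
    using homogeneous_nontrivial_solution[OF K(1) I K(2), of u] by blast
  then have "y \<in> W" "inner_on I y y \<noteq> 0"
    by (auto simp: W_def inner_on_self_eq_0[OF I]) (auto simp: inner_on_def)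
  with normalize have "C \<noteq> {}" by blast
  have cont: "continuous_on C (\<lambda>x. inner_on I x (apply_on I X x))"
    unfolding inner_on_def apply_on_def
    by (intro continuous_intros continuous_on_subset[OF coord]) auto
  obtain v where v: "v \<in> C" "\<And>x. x \<in> C \<Longrightarrow> inner_on I x (apply_on I X x) \<le> inner_on I v (apply_on I X v)"
    using continuous_attains_sup[OF \<open>compact C\<close> \<open>C \<noteq> {}\<close> cont] by blast
  have vW: "v \<in> W" "inner_on I v v = 1" using v(1) by (auto simp: C_def W_def)
  define \<mu> where "\<mu> = inner_on I v (apply_on I X v)"
  \<comment> \<open>\<open>q\<close> is nonnegative on \<open>W\<close> by homogeneity and vanishes
    at \<open>v\<close>, so its first-order term at \<open>v\<close> is zero in every direction of
    \<open>W\<close>.\<close>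
  define q where "q x = \<mu> * inner_on I x x - inner_on I x (apply_on I X x)" for x
  have q_nonneg: "q x \<ge> 0" if "x \<in> W" for x
  proof (cases "inner_on I x x = 0")
    case True
    then have "\<forall>i\<in>I. x i = 0" by (simp add: inner_on_self_eq_0[OF I])
    then show ?thesis by (simp add: q_def inner_on_def)
  next
    case False
    obtain x' c where x': "x' \<in> C" "\<forall>i\<in>I. x i = c * x' i" using normalize[OF \<open>x \<in> W\<close> False] by blast
    have "apply_on I X x = (\<lambda>i. c * apply_on I X x' i)"
      by (subst apply_on_scale[symmetric]) (intro ext, use x' in \<open>simp add: apply_on_def\<close>)
    moreover have "inner_on I x y = c * inner_on I x' y" for y
      using x' by (simp add: inner_on_def sum_distrib_left algebra_simps)
    ultimately have "q x = c * c * (\<mu> * inner_on I x' x' - inner_on I x' (apply_on I X x'))"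
      by (simp add: q_def inner_on_scale_right algebra_simps inner_on_commute[of I x' x])
    also have "inner_on I x' x' = 1" using x' by (auto simp: C_def)
    finally show ?thesis using v(2)[OF x'(1)] by (simp add: \<mu>_def)
  qed
  have critical: "inner_on I y (apply_on I X v) = \<mu> * inner_on I y v" if "y \<in> W" for y
  proof -
    define b where "b = \<mu> * inner_on I y v - inner_on I y (apply_on I X v)"
    have "2 * t * b + t\<^sup>2 * q y \<ge> 0" for t
    proof -
      define x where "x i = v i + t * y i" for i
      have x_eq: "x = (\<lambda>i. v i + t * y i)" by (simp add: x_def fun_eq_iff)
      have "x \<in> W" using that vW
        by (auto simp: W_def x_eq inner_on_add_right inner_on_scale_right)
      have a: "apply_on I X x = (\<lambda>i. apply_on I X v i + t * apply_on I X y i)"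
        by (auto simp: x_eq apply_on_add apply_on_scale)
      have i: "inner_on I x w = inner_on I v w + t * inner_on I y w" for w
        by (simp add: x_eq inner_on_commute[of I _ w] inner_on_add_right inner_on_scale_right)
      have s: "inner_on I v (apply_on I X y) = inner_on I y (apply_on I X v)"
        by (rule trans[OF apply_on_symmetric[OF sym] inner_on_commute])
      have "inner_on I v x = inner_on I v v + t * inner_on I y v"
        by (subst inner_on_commute) (rule i)
      moreover have "inner_on I y x = inner_on I y v + t * inner_on I y y"
        by (subst inner_on_commute) (simp only: i inner_on_commute[of I v y])
      ultimately have xx: "inner_on I x x = inner_on I v v + 2 * t * inner_on I y v + t\<^sup>2 * inner_on I y y"
        by (simp only: i[of x]) (simp add: algebra_simps power2_eq_square)
      have xXx: "inner_on I x (apply_on I X x) = inner_on I v (apply_on I X v) +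
          2 * t * inner_on I y (apply_on I X v) + t\<^sup>2 * inner_on I y (apply_on I X y)"
        unfolding i a inner_on_add_right inner_on_scale_right s
        by (simp add: algebra_simps power2_eq_square)
      have "q x = q v + 2 * t * b + t\<^sup>2 * q y"
        unfolding q_def b_def xx xXx by (simp add: algebra_simps power2_eq_square)
      moreover have "q v = 0" by (simp add: q_def vW \<mu>_def)
      ultimately show ?thesis using q_nonneg[OF \<open>x \<in> W\<close>] by simp
    qed
    then show ?thesis using nonneg_quadratic_no_linear_term[of b "q y"] q_nonneg[OF that]
      by (simp add: b_def)
  qed
  define r where "r i = apply_on I X v i - \<mu> * v i" for i
  have r_eq: "r = (\<lambda>i. apply_on I X v i - \<mu> * v i)" by (simp add: r_def fun_eq_iff)
  have "r \<in> W"
  proof -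
    have "inner_on I (u k) (apply_on I X v) = z k * inner_on I (u k) v" if "k \<in> K" for k
    proof -
      have "inner_on I (u k) (apply_on I X v) = inner_on I (apply_on I X (u k)) v"
        by (rule apply_on_symmetric[OF sym])
      also have "\<dots> = inner_on I v (\<lambda>i. z k * u k i)"
        by (subst inner_on_commute) (rule inner_on_cong, auto simp: eig that)
      finally show ?thesis by (simp add: inner_on_scale_right inner_on_commute)
    qed
    then show ?thesis using vW by (auto simp: W_def r_eq inner_on_diff_right inner_on_scale_right)
  qed
  then have "inner_on I r r = 0"
    using critical[OF \<open>r \<in> W\<close>]
    by (subst (2) r_eq) (simp add: inner_on_diff_right inner_on_scale_right)
  then have "\<forall>i\<in>I. apply_on I X v i = \<mu> * v i" by (simp add: inner_on_self_eq_0[OF I] r_def)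
  with vW show ?thesis by (auto simp: W_def)
qed

text \<open>The residual \<open>r\<close> of the i-th unit vector and the \<open>u k\<close> are one
  vector more than the dimension, hence dependent. Pairing the relation with each \<open>u l\<close>
  kills their coefficients, and pairing it with \<open>r\<close> leaves |r|^2 = 0.
  \<open>None\<close> labels the residual in the extended family.\<close>

lemma orthonormal_complete:
  fixes u :: "'a \<Rightarrow> 'a \<Rightarrow> real"
  assumes I: "finite I"
    and orth: "\<And>k l. k \<in> I \<Longrightarrow> l \<in> I \<Longrightarrow> inner_on I (u k) (u l) = (if k = l then 1 else 0)"
    and ij: "i \<in> I" "j \<in> I"
  shows "(\<Sum>k\<in>I. u k i * u k j) = (if i = j then 1 else 0)"
proof -
  define r where "r i' = (if i' = i then 1 else 0) - (\<Sum>k\<in>I. u k i * u k i')" for i'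
  have r_orth: "inner_on I (u l) r = 0" if "l \<in> I" for l
  proof -
    have "inner_on I (u l) r = inner_on I (u l) (\<lambda>i'. if i' = i then 1 else 0)
        - inner_on I (u l) (\<lambda>i'. \<Sum>k\<in>I. u k i * u k i')"
      unfolding r_def by (rule inner_on_diff_right)
    also have "inner_on I (u l) (\<lambda>i'. \<Sum>k\<in>I. u k i * u k i') = (\<Sum>k\<in>I. u k i * inner_on I (u l) (u k))"
      by (simp add: inner_on_sum_right inner_on_scale_right)
    also have "\<dots> = (\<Sum>k\<in>I. if l = k then u k i else 0)" using orth that by (intro sum.cong) auto
    also have "\<dots> = u l i" using that I by simp
    also have "inner_on I (u l) (\<lambda>i'. if i' = i then 1 else 0) = u l i"
      using I ij by (simp add: inner_on_def if_distrib cong: if_cong)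
    finally show ?thesis by simp
  qed
  define w where "w k = (case k of Some l \<Rightarrow> u l | None \<Rightarrow> r)" for k
  define T where "T = insert None (Some ` I)"
  have "card I < card T" "finite T"
    using I by (auto simp: T_def card_image)
  obtain c where c: "\<exists>k\<in>T. c k \<noteq> 0" "\<forall>i'\<in>I. (\<Sum>k\<in>T. w k i' * c k) = 0"
    using homogeneous_nontrivial_solution[OF I \<open>finite T\<close> \<open>card I < card T\<close>, of "\<lambda>i k. w k i"] by blast
  have zero: "c None * r i' + (\<Sum>k\<in>I. c (Some k) * u k i') = 0" if "i' \<in> I" for i'
    using c(2) that I by (auto simp: T_def w_def sum.reindex mult.commute)
  have inner0: "c None * inner_on I y r + (\<Sum>k\<in>I. c (Some k) * inner_on I y (u k)) = 0" for y
  proof -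
    have "inner_on I y (\<lambda>i'. c None * r i' + (\<Sum>k\<in>I. c (Some k) * u k i')) = inner_on I y (\<lambda>_. 0)"
      by (rule inner_on_cong) (auto simp: zero)
    also have "\<dots> = 0" by (simp add: inner_on_def)
    finally show ?thesis by (simp add: inner_on_add_right inner_on_sum_right inner_on_scale_right)
  qed
  have "c (Some l) = 0" if "l \<in> I" for l
  proof -
    have "(\<Sum>k\<in>I. c (Some k) * inner_on I (u l) (u k)) = (\<Sum>k\<in>I. if l = k then c (Some k) else 0)"
      using orth that by (intro sum.cong) auto
    then show ?thesis using inner0[of "u l"] r_orth[OF that] that I by simp
  qed
  then have "c None \<noteq> 0" using c(1) by (auto simp: T_def)
  moreover have "(\<Sum>k\<in>I. c (Some k) * inner_on I r (u k)) = 0"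
    using r_orth by (intro sum.neutral) (auto simp: inner_on_commute[of I r])
  ultimately have "inner_on I r r = 0" using inner0[of r] by simp
  then have "r j = 0" using ij by (simp add: inner_on_self_eq_0[OF I])
  then show ?thesis by (auto simp: r_def split: if_splits)
qed

text \<open>Eigenvectors are built one label at a time over subsets of \<open>I\<close>, so
  eigenvalues end up labelled by row indices and repeated with multiplicity; later counts are plain
  cardinalities of label sets.\<close>

theorem spectral_exists:
  fixes X :: "'a \<Rightarrow> 'a \<Rightarrow> real"
  assumes I: "finite I" and sym: "\<And>i j. i \<in> I \<Longrightarrow> j \<in> I \<Longrightarrow> X i j = X j i"
  shows "\<exists>z u. spectral I X I z u"
proof -
  have "\<exists>z u. (\<forall>k\<in>K. \<forall>l\<in>K. inner_on I (u k) (u l) = (if k = l then 1 else 0)) \<and>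
      (\<forall>k\<in>K. \<forall>i\<in>I. apply_on I X (u k) i = z k * u k i)"
    if "finite K" "K \<subseteq> I" for K
    using that
  proof (induction K rule: finite_induct)
    case (insert m K)
    from insert.IH insert.prems obtain z and u :: "'a \<Rightarrow> 'a \<Rightarrow> real" where
      "\<forall>k\<in>K. \<forall>l\<in>K. inner_on I (u k) (u l) = (if k = l then 1 else 0)"
      "\<forall>k\<in>K. \<forall>i\<in>I. apply_on I X (u k) i = z k * u k i" by blast
    then have u: "\<And>k l. k \<in> K \<Longrightarrow> l \<in> K \<Longrightarrow> inner_on I (u k) (u l) = (if k = l then 1 else 0)"
      "\<And>k i. k \<in> K \<Longrightarrow> i \<in> I \<Longrightarrow> apply_on I X (u k) i = z k * u k i" by blast+
    have "card K < card I" using insert I by (intro psubset_card_mono) auto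
    have "\<exists>v \<mu>. inner_on I v v = 1 \<and> (\<forall>k\<in>K. inner_on I (u k) v = 0) \<and>
        (\<forall>i\<in>I. apply_on I X v i = \<mu> * v i)"
      by (rule symmetric_next_eigenvector[OF I insert.hyps(1) \<open>card K < card I\<close>, of X u z])
        (use sym u(2) in auto)
    then obtain v \<mu> where v: "inner_on I v v = 1" "\<And>k. k \<in> K \<Longrightarrow> inner_on I (u k) v = 0"
        "\<And>i. i \<in> I \<Longrightarrow> apply_on I X v i = \<mu> * v i" by blast
    have v': "inner_on I v (u k) = 0" if "k \<in> K" for k
      using v(2)[OF that] by (simp add: inner_on_commute)
    show ?case
      by (rule exI[of _ "z(m := \<mu>)"], rule exI[of _ "u(m := v)"])
        (use insert.hyps u v v' in auto)
  qed auto
  from this[OF I subset_refl] obtain z and u :: "'a \<Rightarrow> 'a \<Rightarrow> real" where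
    "\<forall>k\<in>I. \<forall>l\<in>I. inner_on I (u k) (u l) = (if k = l then 1 else 0)"
    "\<forall>k\<in>I. \<forall>i\<in>I. apply_on I X (u k) i = z k * u k i" by blast
  then have u: "\<And>k l. k \<in> I \<Longrightarrow> l \<in> I \<Longrightarrow> inner_on I (u k) (u l) = (if k = l then 1 else 0)"
    "\<And>k i. k \<in> I \<Longrightarrow> i \<in> I \<Longrightarrow> apply_on I X (u k) i = z k * u k i" by blast+
  note complete = orthonormal_complete[OF I u(1)]
  have "X i j = (\<Sum>k\<in>I. z k * u k i * u k j)" if "i \<in> I" "j \<in> I" for i j
  proof -
    have "(\<Sum>k\<in>I. z k * u k i * u k j) = (\<Sum>k\<in>I. apply_on I X (u k) i * u k j)"
      using u(2) that by simp
    also have "\<dots> = (\<Sum>k\<in>I. \<Sum>l\<in>I. X i l * (u k l * u k j))"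
      by (simp add: apply_on_def sum_distrib_right mult.assoc)
    also have "\<dots> = (\<Sum>l\<in>I. X i l * (\<Sum>k\<in>I. u k l * u k j))"
      by (subst sum.swap) (simp add: sum_distrib_left)
    also have "\<dots> = (\<Sum>l\<in>I. if l = j then X i l else 0)"
      using complete that by (intro sum.cong) auto
    finally show ?thesis using that I by simp
  qed
  then have "spectral I X I z u" using I u complete by (auto simp: spectral_def)
  then show ?thesis by blast
qed

section \<open>Averages over random subsets\<close>

text \<open>The mean under independent inclusion with probability \<open>p\<close>, kept as a finite
  sum so that no measurability or integrability arises. \<open>prob_random_index_set\<close> ties it
  to the distribution of the theorem.\<close>

definition expect :: "'i set \<Rightarrow> real \<Rightarrow> ('i set \<Rightarrow> real) \<Rightarrow> real" where
  "expect N p f = (\<Sum>S\<in>Pow N. p ^ card S * (1 - p) ^ card (N - S) * f S)"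

lemma expect_empty [simp]: "expect {} p f = f {}"
  by (simp add: expect_def)

lemma expect_insert:
  assumes "finite N" "i \<notin> N"
  shows "expect (insert i N) p f = p * expect N p (\<lambda>S. f (insert i S)) + (1 - p) * expect N p f"
proof -
  have "expect (insert i N) p f = (\<Sum>S\<in>Pow N. p ^ card S * (1 - p) ^ card (insert i N - S) * f S) +
      (\<Sum>S\<in>insert i ` Pow N. p ^ card S * (1 - p) ^ card (insert i N - S) * f S)"
    unfolding expect_def Pow_insert using assms by (intro sum.union_disjoint) auto
  also have "(\<Sum>S\<in>insert i ` Pow N. p ^ card S * (1 - p) ^ card (insert i N - S) * f S) =
      (\<Sum>S\<in>Pow N. p ^ card (insert i S) * (1 - p) ^ card (insert i N - insert i S) * f (insert i S))"
    using assms by (subst sum.reindex) (auto simp: inj_on_def o_def)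
  also have "\<dots> = p * expect N p (\<lambda>S. f (insert i S))"
    unfolding expect_def sum_distrib_left
  proof (intro sum.cong refl)
    fix S assume S: "S \<in> Pow N"
    then have "i \<notin> S" "finite S" using assms finite_subset by auto
    moreover have "insert i N - insert i S = N - S" using assms by auto
    ultimately show "p ^ card (insert i S) * (1 - p) ^ card (insert i N - insert i S) * f (insert i S) =
        p * (p ^ card S * (1 - p) ^ card (N - S) * f (insert i S))" by simp
  qed
  also have "(\<Sum>S\<in>Pow N. p ^ card S * (1 - p) ^ card (insert i N - S) * f S) = (1 - p) * expect N p f"
    unfolding expect_def sum_distrib_left
  proof (intro sum.cong refl)
    fix S assume S: "S \<in> Pow N"
    then have "insert i N - S = insert i (N - S)" "i \<notin> N - S" using assms by auto
    then show "p ^ card S * (1 - p) ^ card (insert i N - S) * f S =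
        (1 - p) * (p ^ card S * (1 - p) ^ card (N - S) * f S)" using assms by simp
  qed
  finally show ?thesis by simp
qed

lemma expect_add: "expect N p (\<lambda>S. f S + g S) = expect N p f + expect N p g"
  by (simp add: expect_def algebra_simps sum.distrib)

lemma expect_cmult: "expect N p (\<lambda>S. c * f S) = c * expect N p f"
  by (simp add: expect_def algebra_simps sum_distrib_left)

lemma expect_diff: "expect N p (\<lambda>S. f S - g S) = expect N p f - expect N p g"
  by (simp add: expect_def algebra_simps sum_subtractf)

lemma expect_sum: "expect N p (\<lambda>S. \<Sum>k\<in>K. f k S) = (\<Sum>k\<in>K. expect N p (f k))"
  by (simp add: expect_def sum_distrib_left sum.swap[of _ "Pow N" K])

lemma expect_cong: "(\<And>S. S \<subseteq> N \<Longrightarrow> f S = g S) \<Longrightarrow> expect N p f = expect N p g"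
  by (simp add: expect_def)

lemma expect_mono:
  assumes "0 \<le> p" "p \<le> 1" "\<And>S. S \<subseteq> N \<Longrightarrow> f S \<le> g S"
  shows "expect N p f \<le> expect N p g"
  unfolding expect_def by (intro sum_mono mult_left_mono) (use assms in auto)

lemma expect_const: "finite N \<Longrightarrow> expect N p (\<lambda>_. c) = c"
  by (induction N rule: finite_induct) (simp_all add: expect_insert algebra_simps)

lemma expect_swap: "expect N p (\<lambda>S. expect M q (f S)) = expect M q (\<lambda>T. expect N p (\<lambda>S. f S T))"
  by (simp add: expect_def sum_distrib_left sum.swap[of _ "Pow N" "Pow M"] algebra_simps)

text \<open>Conditioning on the membership of i: the right side forces i in, so its own coin
  integrates out and the average may still run over all of \<open>N\<close>. One power can thus be
  expanded without shrinking the ground set.\<close>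

lemma expect_member:
  assumes "finite N" "i \<in> N"
  shows "expect N p (\<lambda>S. if i \<in> S then f S else 0) = p * expect N p (\<lambda>S. f (insert i S))"
proof -
  define M where "M = N - {i}"
  have M: "finite M" "i \<notin> M" "N = insert i M" using assms by (auto simp: M_def)
  have "expect M p (\<lambda>S. if i \<in> S then f S else 0) = expect M p (\<lambda>_. 0)"
    using M by (intro expect_cong) auto
  then show ?thesis using M by (simp add: expect_insert expect_const algebra_simps)
qed

lemma expect_Un:
  assumes "finite M" "finite N" "M \<inter> N = {}"
  shows "expect (M \<union> N) p f = expect M p (\<lambda>A. expect N p (\<lambda>B. f (A \<union> B)))"
  using assms
proof (induction M arbitrary: f rule: finite_induct)
  case (insert i M)
  have "expect (insert i (M \<union> N)) p f = p * expect (M \<union> N) p (\<lambda>S. f (insert i S)) + (1 - p) * expect (M \<union> N) p f"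
    using insert by (intro expect_insert) auto
  then show ?case using insert by (simp add: expect_insert)
qed simp

section \<open>Trace moments of sampled Gram matrices\<close>

text \<open>Chebyshev's sum inequality with weights: the sum of
  \<open>c k * c l * ((f k - f l) * (g k - g l))\<close> over all pairs is nonnegative and is twice
  the difference of the two sides.\<close>

lemma sum_similarly_ordered_le:
  fixes c f g :: "'k \<Rightarrow> real"
  assumes "\<And>k. k \<in> K \<Longrightarrow> c k \<ge> 0"
    and "\<And>k l. k \<in> K \<Longrightarrow> l \<in> K \<Longrightarrow> (f k - f l) * (g k - g l) \<ge> 0"
  shows "(\<Sum>k\<in>K. c k * f k) * (\<Sum>k\<in>K. c k * g k) \<le> (\<Sum>k\<in>K. c k) * (\<Sum>k\<in>K. c k * (f k * g k))"
proof -
  have "0 \<le> (\<Sum>k\<in>K. \<Sum>l\<in>K. c k * c l * ((f k - f l) * (g k - g l)))"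
    by (intro sum_nonneg mult_nonneg_nonneg assms)
  also have "\<dots> = (\<Sum>k\<in>K. \<Sum>l\<in>K. (c k * (f k * g k)) * c l) - (\<Sum>k\<in>K. \<Sum>l\<in>K. (c k * f k) * (c l * g l))
      - (\<Sum>k\<in>K. \<Sum>l\<in>K. (c k * g k) * (c l * f l)) + (\<Sum>k\<in>K. \<Sum>l\<in>K. c k * (c l * (f l * g l)))"
    unfolding sum_subtractf[symmetric] sum.distrib[symmetric]
    by (intro sum.cong refl) (simp add: algebra_simps)
  also have "\<dots> = 2 * ((\<Sum>k\<in>K. c k) * (\<Sum>k\<in>K. c k * (f k * g k)) -
      (\<Sum>k\<in>K. c k * f k) * (\<Sum>k\<in>K. c k * g k))"
    unfolding sum_product[symmetric] by (simp add: algebra_simps)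
  finally show ?thesis by simp
qed

context
  fixes I :: "'a set" and X Y :: "'a \<Rightarrow> 'a \<Rightarrow> real"
    and K :: "'b set" and x :: "'b \<Rightarrow> real" and u :: "'b \<Rightarrow> 'a \<Rightarrow> real"
    and L :: "'c set" and y :: "'c \<Rightarrow> real" and v :: "'c \<Rightarrow> 'a \<Rightarrow> real"
    and w :: "'a \<Rightarrow> real" and R :: real
  assumes X: "spectral I X K x u" and Y: "spectral I Y L y v"
    and update: "\<And>i j. i \<in> I \<Longrightarrow> j \<in> I \<Longrightarrow> Y i j = X i j + w i * w j"
    and x0: "\<And>k. k \<in> K \<Longrightarrow> x k \<ge> 0" and y0: "\<And>k. k \<in> L \<Longrightarrow> y k \<ge> 0"
    and R: "inner_on I w w \<le> R"
begin

text \<open>Writing \<open>Y = X + w w\<^sup>T\<close>, the induction peels one factor \<open>Y\<close> off \<open>w\<^sup>T Y\<^sup>m X\<^sup>l w\<close>; the rank-one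
  part splits this into a product of two moments of the spectral measure of \<open>X\<close> at \<open>w\<close>, which
  Chebyshev's sum inequality recombines at the cost of a factor \<open>\<le> R\<close>.\<close>

lemma rank_one_moments:
  defines "xw \<equiv> (\<lambda>l i. \<Sum>k\<in>K. (x k ^ l * inner_on I (u k) w) * u k i)"
  shows "(\<Sum>k\<in>K. x k ^ (m + l) * (inner_on I (u k) w)\<^sup>2) \<le>
      (\<Sum>j\<in>L. y j ^ m * inner_on I (v j) w * inner_on I (v j) (xw l))"
    and "(\<Sum>j\<in>L. y j ^ m * inner_on I (v j) w * inner_on I (v j) (xw l)) \<le>
      (\<Sum>k\<in>K. (x k + R) ^ m * x k ^ l * (inner_on I (u k) w)\<^sup>2)"
proof -
  \<comment> \<open>In matrix terms \<open>xw l\<close> is X^l w, \<open>a l\<close> is w^T X^l w,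
    \<open>b m l\<close> is w^T Y^m X^l w and \<open>t m l\<close> is w^T (X + R)^m X^l w.\<close>
  define a where "a l = (\<Sum>k\<in>K. x k ^ l * (inner_on I (u k) w)\<^sup>2)" for l
  define t where "t m l = (\<Sum>k\<in>K. (x k + R) ^ m * x k ^ l * (inner_on I (u k) w)\<^sup>2)" for m l
  define b where "b m l = (\<Sum>j\<in>L. y j ^ m * inner_on I (v j) w * inner_on I (v j) (xw l))" for m l
  have R0: "R \<ge> 0" using R inner_on_self_nonneg[of I w] by simp
  have u_xw: "inner_on I (u k) (xw l) = x k ^ l * inner_on I (u k) w" if "k \<in> K" for k l
  proof -
    have "inner_on I (u k) (xw l) = (\<Sum>k'\<in>K. (x k' ^ l * inner_on I (u k') w) * inner_on I (u k) (u k'))"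
      unfolding xw_def by (simp add: inner_on_sum_right inner_on_scale_right)
    also have "\<dots> = (\<Sum>k'\<in>K. if k' = k then x k ^ l * inner_on I (u k) w else 0)"
      using that spectral_orthonormal[OF X] by (intro sum.cong) auto
    finally show ?thesis using that spectral_finite[OF X] by simp
  qed
  have w_xw: "inner_on I w (xw l) = a l" for l
    unfolding spectral_Parseval[OF X, of w] a_def
    by (intro sum.cong refl) (simp add: u_xw power2_eq_square)
  have v_xw0: "inner_on I z (xw 0) = inner_on I z w" for z
    unfolding spectral_Parseval[OF X, of z] by (intro sum.cong refl) (simp add: u_xw)
  have apply_Y: "inner_on I z (apply_on I Y (xw l)) =
      inner_on I z (xw (Suc l)) + inner_on I z w * a l" for z l
  proof -
    have "inner_on I z (apply_on I Y (xw l)) = inner_on I z (\<lambda>i. apply_on I X (xw l) i + a l * w i)"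
      by (intro inner_on_cong refl)
        (simp add: apply_on_def update distrib_right sum.distrib w_xw[symmetric] inner_on_def
          sum_distrib_right, simp add: mult_ac)
    also have "\<dots> = inner_on I z (apply_on I X (xw l)) + a l * inner_on I z w"
      by (simp add: inner_on_add_right inner_on_scale_right)
    also have "inner_on I z (apply_on I X (xw l)) = inner_on I z (xw (Suc l))"
      unfolding spectral_inner[OF X] spectral_Parseval[OF X, of z "xw (Suc l)"]
      by (intro sum.cong refl) (simp add: u_xw)
    finally show ?thesis by simp
  qed
  have b0: "b 0 l = a l" for l
    using spectral_Parseval[OF Y, of w "xw l"] by (simp add: b_def w_xw)
  have b_Suc: "b (Suc m) l = b m (Suc l) + b m 0 * a l" for m l
  proof -
    have "b (Suc m) l = (\<Sum>j\<in>L. y j ^ m * inner_on I (v j) w * inner_on I (v j) (apply_on I Y (xw l)))"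
      unfolding b_def by (intro sum.cong refl) (simp add: spectral_inner_eigenvector[OF Y])
    also have "\<dots> = b m (Suc l) + b m 0 * a l"
      unfolding b_def apply_Y v_xw0 by (simp add: algebra_simps sum.distrib sum_distrib_left)
    finally show ?thesis .
  qed
  have a_nonneg: "a l \<ge> 0" for l unfolding a_def by (intro sum_nonneg mult_nonneg_nonneg) (use x0 in auto)
  have b_nonneg: "b m 0 \<ge> 0" for m
    unfolding b_def v_xw0 mult.assoc
    by (rule sum_nonneg, rule mult_nonneg_nonneg) (use y0 in auto)
  have lower: "a (m + l) \<le> b m l" for m l
  proof (induction m arbitrary: l)
    case (Suc m)
    show ?case using Suc[of "Suc l"] mult_nonneg_nonneg[OF b_nonneg[of m] a_nonneg[of l]] by (simp add: b_Suc)
  qed (simp add: b0)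
  have upper: "b m l \<le> t m l" for m l
  proof (induction m arbitrary: l)
    case 0
    then show ?case by (simp add: b0 a_def t_def)
  next
    case (Suc m)
    have "t m 0 * a l \<le> (\<Sum>k\<in>K. (inner_on I (u k) w)\<^sup>2) *
        (\<Sum>k\<in>K. (inner_on I (u k) w)\<^sup>2 * ((x k + R) ^ m * x k ^ l))"
    proof -
      have "((x k + R) ^ m - (x k' + R) ^ m) * (x k ^ l - x k' ^ l) \<ge> 0" if "k \<in> K" "k' \<in> K" for k k'
      proof (cases "x k \<le> x k'")
        case True
        then show ?thesis using that x0 R0 by (intro mult_nonpos_nonpos) (auto intro!: power_mono)
      next
        case False
        then show ?thesis using that x0 R0 by (intro mult_nonneg_nonneg) (auto intro!: power_mono)
      qed
      then show ?thesis using sum_similarly_ordered_le[of K "\<lambda>k. (inner_on I (u k) w)\<^sup>2"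
            "\<lambda>k. (x k + R) ^ m" "\<lambda>k. x k ^ l"] by (simp add: t_def a_def mult.commute)
    qed
    also have "(\<Sum>k\<in>K. (inner_on I (u k) w)\<^sup>2 * ((x k + R) ^ m * x k ^ l)) = t m l"
      by (simp add: t_def mult_ac)
    also have "(\<Sum>k\<in>K. (inner_on I (u k) w)\<^sup>2) = inner_on I w w"
      by (simp add: spectral_Parseval[OF X, of w w] power2_eq_square)
    also have "inner_on I w w * t m l \<le> R * t m l"
      unfolding t_def by (intro mult_right_mono R sum_nonneg mult_nonneg_nonneg) (use x0 R0 in auto)
    finally have "t m 0 * a l \<le> R * t m l" .
    moreover have "b m 0 * a l \<le> t m 0 * a l" by (intro mult_right_mono Suc a_nonneg)
    ultimately have "b (Suc m) l \<le> t m (Suc l) + R * t m l" using Suc[of "Suc l"] by (simp add: b_Suc)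
    also have "\<dots> = t (Suc m) l" by (simp add: t_def algebra_simps sum.distrib sum_distrib_left)
    finally show ?case .
  qed
  show "(\<Sum>k\<in>K. x k ^ (m + l) * (inner_on I (u k) w)\<^sup>2) \<le>
      (\<Sum>j\<in>L. y j ^ m * inner_on I (v j) w * inner_on I (v j) (xw l))"
    using lower[of m l] by (simp add: a_def b_def)
  show "(\<Sum>j\<in>L. y j ^ m * inner_on I (v j) w * inner_on I (v j) (xw l)) \<le>
      (\<Sum>k\<in>K. (x k + R) ^ m * x k ^ l * (inner_on I (u k) w)\<^sup>2)"
    using upper[of m l] by (simp add: t_def b_def)
qed

lemma inner_xw0: "inner_on I z (\<lambda>i. \<Sum>k\<in>K. (x k ^ 0 * inner_on I (u k) w) * u k i) = inner_on I z w"
  unfolding spectral_Parseval[OF X, of z w]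
  by (simp add: inner_on_sum_right inner_on_scale_right inner_on_commute[of I z "u _"])
    (simp add: mult.commute)

lemma rank_one_moment_upper:
  "(\<Sum>j\<in>L. y j ^ m * (inner_on I (v j) w)\<^sup>2) \<le> (\<Sum>k\<in>K. (x k + R) ^ m * (inner_on I (u k) w)\<^sup>2)"
  using rank_one_moments(2)[of m 0] unfolding inner_xw0 by (simp add: power2_eq_square mult.assoc)

text \<open>The order X \<le> X + w w^T need not pass to powers, but it does when the powers are
  tested on the update vector itself.\<close>

lemma rank_one_moment_lower:
  "(\<Sum>k\<in>K. x k ^ m * (inner_on I (u k) w)\<^sup>2) \<le> (\<Sum>j\<in>L. y j ^ m * (inner_on I (v j) w)\<^sup>2)"
  using rank_one_moments(1)[of m 0] unfolding inner_xw0 by (simp add: power2_eq_square mult.assoc)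

end

text \<open>\<open>D\<close> is a deterministic positive semidefinite pad that can turn the mean of
  the sampled sum into a multiple of the identity. Spectral data are fixed for every
  \<open>S\<close> at once, so that the trace of a power is an ordinary sum of
  \<open>z S k ^ q\<close> inside an expectation.\<close>

locale random_gram =
  fixes N :: "'i set" and p :: real and I :: "'a set" and w :: "'i \<Rightarrow> 'a \<Rightarrow> real"
    and D :: "'a \<Rightarrow> 'a \<Rightarrow> real" and z :: "'i set \<Rightarrow> 'b \<Rightarrow> real" and u :: "'i set \<Rightarrow> 'b \<Rightarrow> 'a \<Rightarrow> real"
    and K :: "'b set" and R :: real
  assumes N: "finite N" and p: "0 \<le> p" "p \<le> 1"
    and D_psd: "\<And>x. inner_on I x (apply_on I D x) \<ge> 0"
    and spec: "\<And>S. S \<subseteq> N \<Longrightarrow> spectral I (\<lambda>i j. (\<Sum>s\<in>S. w s i * w s j) + D i j) K (z S) (u S)"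
    and R: "\<And>s. s \<in> N \<Longrightarrow> inner_on I (w s) (w s) \<le> R" "R \<ge> 0"
begin

lemma gram_inner:
  assumes "S \<subseteq> N"
  shows "inner_on I x (apply_on I (\<lambda>i j. (\<Sum>s\<in>S. w s i * w s j) + D i j) x) =
    (\<Sum>s\<in>S. (inner_on I (w s) x)\<^sup>2) + inner_on I x (apply_on I D x)"
proof -
  have "inner_on I x (apply_on I (\<lambda>i j. (\<Sum>s\<in>S. w s i * w s j) + D i j) x) =
      inner_on I x (\<lambda>i. apply_on I (\<lambda>i j. \<Sum>s\<in>S. 1 * w s i * w s j) x i + apply_on I D x i)"
    by (intro inner_on_cong refl) (simp add: apply_on_def distrib_right sum.distrib)
  also have "\<dots> = inner_on I x (apply_on I (\<lambda>i j. \<Sum>s\<in>S. 1 * w s i * w s j) x) +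
      inner_on I x (apply_on I D x)" by (rule inner_on_add_right)
  also have "inner_on I x (apply_on I (\<lambda>i j. \<Sum>s\<in>S. 1 * w s i * w s j) x) =
      (\<Sum>s\<in>S. 1 * inner_on I (w s) x * inner_on I (w s) x)"
    by (rule inner_apply_rank_one_sum) simp
  finally show ?thesis by (simp add: power2_eq_square)
qed

lemma gram_eigenvalue:
  assumes "S \<subseteq> N" "k \<in> K"
  shows "z S k = (\<Sum>s\<in>S. (inner_on I (w s) (u S k))\<^sup>2) + inner_on I (u S k) (apply_on I D (u S k))"
  unfolding spectral_eigenvalue[OF spec[OF assms(1)] assms(2)] gram_inner[OF assms(1)] ..

lemma gram_eigenvalue_nonneg: "S \<subseteq> N \<Longrightarrow> k \<in> K \<Longrightarrow> z S k \<ge> 0"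
  by (simp add: gram_eigenvalue D_psd sum_nonneg)

lemma eigenvector_unit: "S \<subseteq> N \<Longrightarrow> k \<in> K \<Longrightarrow> inner_on I (u S k) (u S k) = 1"
  by (simp add: spectral_orthonormal[OF spec])

lemma expect_sum_members:
  "expect N p (\<lambda>S. \<Sum>s\<in>S. h s S) = (\<Sum>s\<in>N. p * expect N p (\<lambda>S. h s (insert s S)))"
proof -
  have "expect N p (\<lambda>S. \<Sum>s\<in>S. h s S) = expect N p (\<lambda>S. \<Sum>s\<in>N. if s \<in> S then h s S else 0)"
    by (intro expect_cong) (use N in \<open>auto simp: sum.If_cases Int_absorb1 Int_absorb2\<close>)
  then show ?thesis using N by (simp add: expect_sum expect_member)
qed

text \<open>Moment method: extracting one factor of the power and inserting the sampled vector costs, by the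
  rank-one moment bound, only a shift of the matrix by \<open>R\<close>.\<close>

lemma upper_moment_bound:
  assumes mean: "\<And>x. p * (\<Sum>s\<in>N. (inner_on I (w s) x)\<^sup>2) + inner_on I x (apply_on I D x) \<le> \<mu> * inner_on I x x"
    and "\<mu> \<ge> 0" "c \<ge> 0"
  shows "expect N p (\<lambda>S. \<Sum>k\<in>K. (z S k + c) ^ q) \<le> card K * (\<mu> + c + q * R) ^ q"
  using \<open>c \<ge> 0\<close>
proof (induction q arbitrary: c)
  case 0
  then show ?case using N by (simp add: expect_const)
next
  case (Suc q)
  \<comment> \<open>This is w_s^T (G_S + c)^q w_s for the padded Gram matrix G_S.\<close>
  define h where "h c s S = (\<Sum>k\<in>K. (z S k + c) ^ q * (inner_on I (u S k) (w s))\<^sup>2)" for c s S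
  have step: "h c s (insert s S) \<le> h (c + R) s S" if "s \<in> N" "S \<subseteq> N" for s S
  proof -
    have gen: "h c s (insert s T) \<le> h (c + R) s T" "h (c + R) s T \<le> h (c + R) s (insert s T)"
      if "T \<subseteq> N" "s \<notin> T" for T
    proof -
      have sT: "insert s T \<subseteq> N" using that \<open>s \<in> N\<close> by auto
      have "finite T" using that N finite_subset by auto
      have shift: "spectral I (\<lambda>i j. 1 * ((\<Sum>s\<in>S. w s i * w s j) + D i j) + (if i = j then d else 0)) K
          (\<lambda>k. 1 * z S k + d) (u S)" if "S \<subseteq> N" for S d
        by (rule spectral_shift) (rule spec[OF that])
      have "(\<Sum>k\<in>K. (1 * z (insert s T) k + c) ^ q * (inner_on I (u (insert s T) k) (w s))\<^sup>2) \<le>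
          (\<Sum>k\<in>K. ((1 * z T k + c) + R) ^ q * (inner_on I (u T k) (w s))\<^sup>2)"
        by (rule rank_one_moment_upper[OF shift[OF \<open>T \<subseteq> N\<close>] shift[OF sT]])
          (use that \<open>finite T\<close> \<open>s \<in> N\<close> sT gram_eigenvalue_nonneg R Suc.prems in auto)
      then show "h c s (insert s T) \<le> h (c + R) s T" by (simp add: h_def add.assoc)
      have "(\<Sum>k\<in>K. (1 * z T k + (c + R)) ^ q * (inner_on I (u T k) (w s))\<^sup>2) \<le>
          (\<Sum>k\<in>K. (1 * z (insert s T) k + (c + R)) ^ q * (inner_on I (u (insert s T) k) (w s))\<^sup>2)"
        by (rule rank_one_moment_lower[OF shift[OF \<open>T \<subseteq> N\<close>] shift[OF sT], where R = R])
          (use that \<open>finite T\<close> \<open>s \<in> N\<close> sT gram_eigenvalue_nonneg R Suc.prems in auto)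
      then show "h (c + R) s T \<le> h (c + R) s (insert s T)" by (simp add: h_def)
    qed
    show ?thesis
    proof (cases "s \<in> S")
      \<comment> \<open>Inserting s changes nothing here, so c is compared with c + R at the same
        \<open>S\<close>: down to \<open>S - {s}\<close> by the upper inequality, and back up by the
        lower one.\<close>
      case True
      have "S - {s} \<subseteq> N" "s \<notin> S - {s}" "insert s (S - {s}) = S" "insert s S = S" using True that by auto
      with gen[of "S - {s}"] show ?thesis by simp
    next
      case False
      then show ?thesis using gen that by simp
    qed
  qed
  define P where "P S k = (z S k + (c + R)) ^ q" for S k
  define d where "d S k = inner_on I (u S k) (apply_on I D (u S k)) + c" for S k
  have P_nonneg: "P S k \<ge> 0" if "S \<subseteq> N" "k \<in> K" for S k
    using gram_eigenvalue_nonneg[OF that] R Suc.prems by (simp add: P_def)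
  have "expect N p (\<lambda>S. \<Sum>k\<in>K. (z S k + c) ^ Suc q) =
      expect N p (\<lambda>S. (\<Sum>s\<in>S. h c s S) + (\<Sum>k\<in>K. (z S k + c) ^ q * d S k))"
  proof (intro expect_cong)
    fix S assume S: "S \<subseteq> N"
    have "(\<Sum>k\<in>K. (z S k + c) ^ Suc q) =
        (\<Sum>k\<in>K. (\<Sum>s\<in>S. (z S k + c) ^ q * (inner_on I (u S k) (w s))\<^sup>2) + (z S k + c) ^ q * d S k)"
    proof (intro sum.cong refl)
      fix k assume "k \<in> K"
      have "(z S k + c) ^ Suc q = (z S k + c) ^ q * (z S k + c)" by simp
      also have "\<dots> = (z S k + c) ^ q * ((\<Sum>s\<in>S. (inner_on I (u S k) (w s))\<^sup>2) + d S k)"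
        using gram_eigenvalue[OF S \<open>k \<in> K\<close>] by (simp add: d_def inner_on_commute[of I "w _"])
      also have "\<dots> = (\<Sum>s\<in>S. (z S k + c) ^ q * (inner_on I (u S k) (w s))\<^sup>2) + (z S k + c) ^ q * d S k"
        by (simp add: distrib_left sum_distrib_left)
      finally show "(z S k + c) ^ Suc q = \<dots>" .
    qed
    also have "\<dots> = (\<Sum>s\<in>S. h c s S) + (\<Sum>k\<in>K. (z S k + c) ^ q * d S k)"
      by (simp add: sum.distrib h_def sum.swap[of _ K S])
    finally show "(\<Sum>k\<in>K. (z S k + c) ^ Suc q) = \<dots>" .
  qed
  also have "\<dots> = (\<Sum>s\<in>N. p * expect N p (\<lambda>S. h c s (insert s S))) + expect N p (\<lambda>S. \<Sum>k\<in>K. (z S k + c) ^ q * d S k)"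
    by (simp add: expect_add expect_sum_members)
  \<comment> \<open>The part from \<open>D\<close> and c is enlarged to the power of z + c + R as
    well, so that both parts carry the factor \<open>P\<close> and the mean hypothesis applies to
    each eigenvector.\<close>
  also have "\<dots> \<le> (\<Sum>s\<in>N. p * expect N p (h (c + R) s)) + expect N p (\<lambda>S. \<Sum>k\<in>K. P S k * d S k)"
    by (intro add_mono sum_mono mult_left_mono expect_mono p step mult_right_mono)
      (use gram_eigenvalue_nonneg R Suc.prems D_psd in \<open>auto simp: P_def d_def intro!: power_mono\<close>)
  also have "\<dots> = expect N p (\<lambda>S. \<Sum>k\<in>K. P S k * (p * (\<Sum>s\<in>N. (inner_on I (u S k) (w s))\<^sup>2) + d S k))"
  proof -
    have "(\<Sum>s\<in>N. p * expect N p (h (c + R) s)) = expect N p (\<lambda>S. \<Sum>s\<in>N. p * h (c + R) s S)"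
      by (simp add: expect_sum expect_cmult)
    also have "\<dots> = expect N p (\<lambda>S. \<Sum>k\<in>K. P S k * (p * (\<Sum>s\<in>N. (inner_on I (u S k) (w s))\<^sup>2)))"
      unfolding h_def P_def sum_distrib_left by (subst sum.swap) (simp add: mult_ac)
    finally show ?thesis by (simp add: expect_add[symmetric] sum.distrib[symmetric] distrib_left)
  qed
  also have "\<dots> \<le> expect N p (\<lambda>S. \<Sum>k\<in>K. P S k * (\<mu> + c))"
  proof (intro expect_mono p sum_mono mult_left_mono P_nonneg)
    fix S k assume "S \<subseteq> N" "k \<in> K"
    then show "p * (\<Sum>s\<in>N. (inner_on I (u S k) (w s))\<^sup>2) + d S k \<le> \<mu> + c"
      using mean[of "u S k"] by (simp add: d_def eigenvector_unit inner_on_commute[of I "w _"])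
  qed
  also have "\<dots> = (\<mu> + c) * expect N p (\<lambda>S. \<Sum>k\<in>K. (z S k + (c + R)) ^ q)"
    by (simp add: P_def expect_cmult[symmetric] sum_distrib_left mult.commute)
  also have "\<dots> \<le> (\<mu> + c) * (card K * (\<mu> + (c + R) + q * R) ^ q)"
    using Suc.prems R assms(2) by (intro mult_left_mono Suc.IH) auto
  also have "\<dots> \<le> (\<mu> + c + Suc q * R) * (card K * (\<mu> + (c + R) + q * R) ^ q)"
    using Suc.prems R assms(2) by (intro mult_right_mono) auto
  also have "\<dots> = card K * (\<mu> + c + Suc q * R) ^ Suc q" by (simp add: algebra_simps)
  finally show ?case .
qed

text \<open>The moment method is run on L - G_S, which loses w_s w_s^T when s is inserted, so the
  shift by \<open>R\<close> lands on the matrix after insertion. Eigenvalues of L - G_S stay at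
  least \<open>l\<close>, which turns the additive shift into a factor of at most (1 + R/l)^n;
  \<open>\<kappa>\<close> pays for it. A large \<open>l\<close> brings that factor close to 1 at the
  price of a larger \<open>L\<close>.\<close>

lemma lower_moment_bound:
  fixes L l \<mu> \<kappa> :: real
  assumes total: "\<And>x. (\<Sum>s\<in>N. (inner_on I (w s) x)\<^sup>2) + inner_on I x (apply_on I D x) \<le> (L - l) * inner_on I x x"
    and mean: "\<And>x. p * (\<Sum>s\<in>N. (inner_on I (w s) x)\<^sup>2) + inner_on I x (apply_on I D x) \<ge> \<mu> * inner_on I x x"
    and "0 \<le> \<mu>" "\<mu> \<le> L" "l > 0" and \<kappa>: "0 \<le> \<kappa>" "\<kappa> \<le> 1" "\<kappa> * (1 + R / l) ^ n \<le> 1"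
    and "q \<le> n"
  shows "expect N p (\<lambda>S. \<Sum>k\<in>K. (L - z S k) ^ q) \<le> card K * (L - \<kappa> * \<mu>) ^ q"
  using \<open>q \<le> n\<close>
proof (induction q)
  case 0
  then show ?case using N by (simp add: expect_const)
next
  case (Suc q)
  have gap: "L - z S k \<ge> l" if "S \<subseteq> N" "k \<in> K" for S k
  proof -
    have "(\<Sum>s\<in>S. (inner_on I (w s) (u S k))\<^sup>2) \<le> (\<Sum>s\<in>N. (inner_on I (w s) (u S k))\<^sup>2)"
      using N that by (intro sum_mono2) auto
    then show ?thesis using total[of "u S k"] gram_eigenvalue[OF that] eigenvector_unit[OF that] by simp
  qed
  define h where "h s S = (\<Sum>k\<in>K. (L - z S k) ^ q * (inner_on I (u S k) (w s))\<^sup>2)" for s S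
  have P_nonneg: "(L - z S k) ^ q \<ge> 0" if "S \<subseteq> N" "k \<in> K" for S k
    using gap[OF that] \<open>l > 0\<close> by simp
  have h_nonneg: "h s S \<ge> 0" if "S \<subseteq> N" for s S
    unfolding h_def by (intro sum_nonneg mult_nonneg_nonneg P_nonneg that) auto
  have step: "\<kappa> * h s S \<le> h s (insert s S)" if "s \<in> N" "S \<subseteq> N" for s S
  proof (cases "s \<in> S")
    case True
    then show ?thesis using \<kappa> h_nonneg[OF that(2)] by (simp add: insert_absorb mult_left_le_one_le)
  next
    case False
    have sS: "insert s S \<subseteq> N" and "finite S" using that N finite_subset by auto
    have shift: "spectral I (\<lambda>i j. (-1) * ((\<Sum>s\<in>S. w s i * w s j) + D i j) + (if i = j then L else 0)) K
        (\<lambda>k. (-1) * z S k + L) (u S)" if "S \<subseteq> N" for S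
      by (rule spectral_shift) (rule spec[OF that])
    have "(\<Sum>k\<in>K. ((-1) * z S k + L) ^ q * (inner_on I (u S k) (w s))\<^sup>2) \<le>
        (\<Sum>k\<in>K. (((-1) * z (insert s S) k + L) + R) ^ q * (inner_on I (u (insert s S) k) (w s))\<^sup>2)"
    proof (rule rank_one_moment_upper[OF shift[OF sS] shift[OF \<open>S \<subseteq> N\<close>]])
      show "inner_on I (w s) (w s) \<le> R" using R that by auto
      show "0 \<le> (-1) * z (insert s S) k + L" if "k \<in> K" for k using gap[OF sS that] \<open>l > 0\<close> by simp
      show "0 \<le> (-1) * z S k + L" if "k \<in> K" for k using gap[OF \<open>S \<subseteq> N\<close> that] \<open>l > 0\<close> by simp
    qed (use False \<open>finite S\<close> in auto)
    also have "\<dots> \<le> (\<Sum>k\<in>K. ((1 + R / l) ^ n * (L - z (insert s S) k) ^ q) * (inner_on I (u (insert s S) k) (w s))\<^sup>2)"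
    proof (intro sum_mono mult_right_mono)
      fix k assume "k \<in> K"
      define a where "a = L - z (insert s S) k"
      have a: "a \<ge> l" using gap[OF sS \<open>k \<in> K\<close>] by (simp add: a_def)
      have "R = R / l * l" using \<open>l > 0\<close> by simp
      also have "\<dots> \<le> R / l * a" using a R \<open>l > 0\<close> by (intro mult_left_mono) auto
      finally have "a + R \<le> (1 + R / l) * a" by (simp add: distrib_right)
      then have "(a + R) ^ q \<le> (1 + R / l) ^ q * a ^ q"
        using a \<open>l > 0\<close> R by (subst power_mult_distrib[symmetric]) (intro power_mono, auto)
      also have "\<dots> \<le> (1 + R / l) ^ n * a ^ q"
        using a \<open>l > 0\<close> R Suc.prems by (intro mult_right_mono power_increasing) auto
      finally show "((-1) * z (insert s S) k + L + R) ^ q \<le> (1 + R / l) ^ n * (L - z (insert s S) k) ^ q"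
        by (simp add: a_def algebra_simps)
    qed simp
    finally have "h s S \<le> (1 + R / l) ^ n * h s (insert s S)"
      by (simp add: h_def sum_distrib_left mult.assoc add.commute)
    then have "\<kappa> * h s S \<le> (\<kappa> * (1 + R / l) ^ n) * h s (insert s S)"
      using \<kappa> by (simp add: mult_left_mono mult.assoc)
    also have "\<dots> \<le> h s (insert s S)" using \<kappa> h_nonneg[OF sS] R \<open>l > 0\<close>
      by (intro mult_left_le_one_le) auto
    finally show ?thesis .
  qed
  define d where "d S k = inner_on I (u S k) (apply_on I D (u S k))" for S k
  have "expect N p (\<lambda>S. \<Sum>k\<in>K. (L - z S k) ^ Suc q) =
      expect N p (\<lambda>S. (\<Sum>k\<in>K. (L - z S k) ^ q * (L - d S k)) - (\<Sum>s\<in>S. h s S))"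
  proof (intro expect_cong)
    fix S assume S: "S \<subseteq> N"
    have "(\<Sum>k\<in>K. (L - z S k) ^ Suc q) =
        (\<Sum>k\<in>K. (L - z S k) ^ q * (L - d S k) - (\<Sum>s\<in>S. (L - z S k) ^ q * (inner_on I (u S k) (w s))\<^sup>2))"
    proof (intro sum.cong refl)
      fix k assume "k \<in> K"
      have "(L - z S k) ^ Suc q = (L - z S k) ^ q * (L - z S k)" by simp
      also have "\<dots> = (L - z S k) ^ q * ((L - d S k) - (\<Sum>s\<in>S. (inner_on I (u S k) (w s))\<^sup>2))"
        using gram_eigenvalue[OF S \<open>k \<in> K\<close>] by (simp add: d_def inner_on_commute[of I "w _"])
      also have "\<dots> = (L - z S k) ^ q * (L - d S k) - (\<Sum>s\<in>S. (L - z S k) ^ q * (inner_on I (u S k) (w s))\<^sup>2)"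
        by (simp only: right_diff_distrib sum_distrib_left)
      finally show "(L - z S k) ^ Suc q = \<dots>" .
    qed
    also have "\<dots> = (\<Sum>k\<in>K. (L - z S k) ^ q * (L - d S k)) - (\<Sum>s\<in>S. h s S)"
      by (simp add: sum_subtractf h_def sum.swap[of _ K S])
    finally show "(\<Sum>k\<in>K. (L - z S k) ^ Suc q) = \<dots>" .
  qed
  also have "\<dots> = expect N p (\<lambda>S. \<Sum>k\<in>K. (L - z S k) ^ q * (L - d S k)) - (\<Sum>s\<in>N. p * expect N p (\<lambda>S. h s (insert s S)))"
    by (simp add: expect_diff expect_sum_members)
  also have "\<dots> \<le> expect N p (\<lambda>S. \<Sum>k\<in>K. (L - z S k) ^ q * (L - d S k)) - (\<Sum>s\<in>N. p * expect N p (\<lambda>S. \<kappa> * h s S))"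
    by (intro diff_left_mono sum_mono mult_left_mono expect_mono p step) auto
  also have "\<dots> = expect N p (\<lambda>S. \<Sum>k\<in>K. (L - z S k) ^ q * (L - d S k - \<kappa> * (p * (\<Sum>s\<in>N. (inner_on I (u S k) (w s))\<^sup>2))))"
  proof -
    have "(\<Sum>s\<in>N. p * expect N p (\<lambda>S. \<kappa> * h s S)) = expect N p (\<lambda>S. \<Sum>s\<in>N. p * (\<kappa> * h s S))"
      by (simp add: expect_sum expect_cmult)
    also have "\<dots> = expect N p (\<lambda>S. \<Sum>k\<in>K. (L - z S k) ^ q * (\<kappa> * (p * (\<Sum>s\<in>N. (inner_on I (u S k) (w s))\<^sup>2))))"
      unfolding h_def sum_distrib_left by (subst sum.swap) (simp add: mult_ac)
    finally show ?thesis by (simp add: expect_diff[symmetric] sum_subtractf[symmetric] right_diff_distrib)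
  qed
  also have "\<dots> \<le> expect N p (\<lambda>S. \<Sum>k\<in>K. (L - z S k) ^ q * (L - \<kappa> * \<mu>))"
  proof (intro expect_mono p sum_mono mult_left_mono P_nonneg)
    fix S k assume Sk: "S \<subseteq> N" "k \<in> K"
    define g where "g = p * (\<Sum>s\<in>N. (inner_on I (u S k) (w s))\<^sup>2)"
    have "\<mu> \<le> g + d S k"
      using mean[of "u S k"] Sk by (simp add: d_def g_def eigenvector_unit inner_on_commute[of I "w _"])
    then have "\<kappa> * \<mu> \<le> \<kappa> * g + \<kappa> * d S k" using \<kappa>(1) by (metis distrib_left mult_left_mono)
    \<comment> \<open>Only the sampled part carries the factor \<open>\<kappa>\<close>. The mean
      bound puts it on the part from \<open>D\<close> as well, where positive semidefiniteness lets
      it be dropped.\<close>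
    also have "\<kappa> * d S k \<le> d S k" using \<kappa> D_psd by (simp add: d_def mult_left_le_one_le)
    finally show "L - d S k - \<kappa> * (p * (\<Sum>s\<in>N. (inner_on I (u S k) (w s))\<^sup>2)) \<le> L - \<kappa> * \<mu>"
      by (simp add: g_def)
  qed
  also have "\<dots> = (L - \<kappa> * \<mu>) * expect N p (\<lambda>S. \<Sum>k\<in>K. (L - z S k) ^ q)"
    by (simp add: expect_cmult[symmetric] sum_distrib_left mult.commute)
  also have "\<dots> \<le> (L - \<kappa> * \<mu>) * (card K * (L - \<kappa> * \<mu>) ^ q)"
  proof (intro mult_left_mono Suc.IH)
    have "\<kappa> * \<mu> \<le> \<mu>" using \<kappa> assms by (simp add: mult_left_le_one_le)
    then show "0 \<le> L - \<kappa> * \<mu>" using assms by simp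
  qed (use Suc.prems in auto)
  finally show ?case by (simp add: algebra_simps)
qed

end

section \<open>Ordered eigenvalues and counting functions\<close>

lemma proots_prod_linear: "proots (\<Prod>a\<leftarrow>xs. [:- a, 1:]) = mset (xs :: real list)"
proof (induction xs)
  case (Cons a xs)
  have "(\<Prod>a\<leftarrow>xs. [:- a, 1:]) \<noteq> 0" by (auto simp: prod_list_zero_iff)
  then have "proots ([:- a, 1:] * (\<Prod>a\<leftarrow>xs. [:- a, 1:])) = proots [:- a, 1:] + mset xs"
    using Cons by (subst proots_mult) auto
  then show ?case by (simp only: list.map prod_list.Cons) simp
qed simp

text \<open>The two relations in \<open>spectral\<close> make the matrix of eigenvectors and its
  transpose mutually inverse, so A is similar to a diagonal matrix and shares its characteristic
  polynomial.\<close>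

lemma char_poly_roots_spectral:
  assumes A: "A \<in> carrier_mat n n"
    and spec: "spectral {..<n} (\<lambda>i j. A $$ (i, j)) {..<n} z u"
  shows "proots (char_poly A) = mset (map z [0..<n])"
proof -
  define P where "P = mat n n (\<lambda>(i, k). u k i)"
  define Q where "Q = mat n n (\<lambda>(k, i). u k i)"
  define D where "D = mat n n (\<lambda>(i, j). if i = j then z i else 0)"
  have PQ: "P * Q = 1\<^sub>m n"
    by (rule eq_matI) (use spec in \<open>auto simp: P_def Q_def scalar_prod_def spectral_def lessThan_atLeast0\<close>)
  have QP: "Q * P = 1\<^sub>m n"
    by (rule eq_matI)
      (use spec in \<open>auto simp: P_def Q_def scalar_prod_def spectral_def lessThan_atLeast0 inner_on_def\<close>)
  have PD: "P * D = mat n n (\<lambda>(i, k). z k * u k i)"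
    by (rule eq_matI) (auto simp: P_def D_def scalar_prod_def if_distrib[of "\<lambda>c. _ * c"] cong: if_cong)
  have "A = P * D * Q"
    unfolding PD by (rule eq_matI)
      (use A spec in \<open>auto simp: Q_def scalar_prod_def spectral_def lessThan_atLeast0\<close>)
  then have "similar_mat_wit A D P Q"
    by (intro similar_mat_witI[of _ _ n] PQ QP A) (auto simp: P_def Q_def D_def)
  then have "char_poly A = char_poly D" by (intro char_poly_similar) (auto simp: similar_mat_def)
  also have "\<dots> = (\<Prod>a\<leftarrow>diag_mat D. [:- a, 1:])"
    by (rule char_poly_upper_triangular[of _ n]) (auto simp: D_def)
  also have "diag_mat D = map z [0..<n]"
    by (auto simp: diag_mat_def D_def)
  finally show ?thesis by (simp only: proots_prod_linear)
qed

text \<open>In a decreasing list the entries satisfying an upward closed predicate form an initial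
  segment.\<close>

lemma nth_antimono_iff_length_filter:
  fixes es :: "real list"
  assumes "sorted_wrt (\<ge>) es" "\<And>x y. P x \<Longrightarrow> x \<le> y \<Longrightarrow> P y" "i < length es"
  shows "P (es ! i) \<longleftrightarrow> i < length (filter P es)"
proof -
  have mono: "es ! l \<ge> es ! m" if "l \<le> m" "m < length es" for l m
    using assms(1) that by (cases "l = m") (auto simp: sorted_wrt_iff_nth_less)
  define T where "T = {m. m < length es \<and> P (es ! m)}"
  have len: "length (filter P es) = card T" by (simp add: length_filter_conv_card T_def)
  have "finite T" by (simp add: T_def)
  show ?thesis
  proof
    assume "P (es ! i)"
    then have "{..i} \<subseteq> T" using mono assms by (auto simp: T_def)
    then have "card {..i} \<le> card T" using \<open>finite T\<close> by (rule card_mono[rotated])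
    then show "i < length (filter P es)" by (simp add: len)
  next
    assume i: "i < length (filter P es)"
    show "P (es ! i)"
    proof (rule ccontr)
      assume "\<not> P (es ! i)"
      then have "T \<subseteq> {..<i}" using mono assms(2,3) unfolding T_def
        by (smt (verit) lessThan_iff mem_Collect_eq not_less subsetI)
      then have "card T \<le> card {..<i}" by (intro card_mono) auto
      then show False using i by (simp add: len)
    qed
  qed
qed

text \<open>Ordered eigenvalues are accessed through this equivalence and its submatrix form:
  comparing the i-th one with a threshold becomes a count, blind to ties and to the order of labels.
  A general upward closed \<open>P\<close> covers strict and weak thresholds together.\<close>

lemma eigval_iff_card:
  assumes A: "A \<in> carrier_mat n n"
    and spec: "spectral {..<n} (\<lambda>i j. A $$ (i, j)) {..<n} z u"
    and P: "\<And>x y. P x \<Longrightarrow> x \<le> y \<Longrightarrow> P y" and i: "i \<in> {1..n}"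
  shows "P (eigval A i) \<longleftrightarrow> i \<le> card {l \<in> {..<n}. P (z l)}"
proof -
  define es where "es = eigenvalues_desc A"
  have es: "es = rev (sort (map z [0..<n]))"
    by (simp add: es_def eigenvalues_desc_def char_poly_roots_spectral[OF A spec] del: mset_map)
  have mset_es: "mset es = mset (map z [0..<n])" by (simp add: es del: mset_map)
  have "sorted_wrt (\<ge>) es" by (simp add: es sorted_wrt_rev)
  moreover have "length es = n" by (simp add: es)
  ultimately have "P (es ! (i - 1)) \<longleftrightarrow> i - 1 < length (filter P es)"
    using nth_antimono_iff_length_filter[of es P "i - 1"] P i by auto
  also have "length (filter P es) = size (filter_mset P (mset (map z [0..<n])))"
    unfolding mset_es[symmetric] by (metis mset_filter size_mset)
  also have "\<dots> = length (filter P (map z [0..<n]))"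
    by (metis mset_filter size_mset)
  also have "\<dots> = card {l \<in> {..<n}. P (z l)}"
    by (auto simp: length_filter_conv_card intro!: arg_cong[of _ _ card])
  finally show ?thesis using i by (auto simp: eigval_def es_def)
qed

section \<open>Principal submatrices indexed by their row set\<close>

lemma bij_betw_pick: "finite S \<Longrightarrow> bij_betw (pick S) {..<card S} S"
proof -
  assume S: "finite S"
  have inj: "inj_on (pick S) {..<card S}"
    by (rule linorder_inj_onI) (use pick_mono_le in \<open>fastforce+\<close>)
  moreover have "pick S ` {..<card S} \<subseteq> S" using pick_in_set_le by auto
  ultimately have "pick S ` {..<card S} = S"
    using S by (intro card_subset_eq) (auto simp: card_image)
  with inj show ?thesis by (simp add: bij_betw_def)
qed

lemma spectral_reindex:
  assumes spec: "spectral S X S z u" and f: "bij_betw f T S"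
  shows "spectral T (\<lambda>i j. X (f i) (f j)) T (\<lambda>k. z (f k)) (\<lambda>k i. u (f k) (f i))"
proof -
  have re: "(\<Sum>i\<in>T. g (f i)) = (\<Sum>i\<in>S. g i)" for g :: "'a \<Rightarrow> real"
    by (rule sum.reindex_bij_betw[OF f])
  have eq: "f i = f j \<longleftrightarrow> i = j" if "i \<in> T" "j \<in> T" for i j
    using f that by (auto simp: bij_betw_def inj_on_def)
  have mem: "f i \<in> S" if "i \<in> T" for i using f that by (auto simp: bij_betw_def)
  have "finite T" using spec bij_betw_finite[OF f] by (simp add: spectral_def)
  then show ?thesis using spec
    by (auto simp: spectral_def inner_on_def eq mem re[of "\<lambda>i. u _ i * u _ i"]
        re[of "\<lambda>i. u (f _) i * u (f _) i"] re[of "\<lambda>k. u k (f _) * u k (f _)"]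
        re[of "\<lambda>k. z k * u k (f _) * u k (f _)"])
qed

lemma principal_submatrix_carrier:
  assumes "A \<in> carrier_mat n n" "S \<subseteq> {..<n}"
  shows "principal_submatrix A S \<in> carrier_mat (card S) (card S)"
proof -
  have "{i. i < n \<and> i \<in> S} = S" using assms by auto
  then show ?thesis using assms by (auto simp: principal_submatrix_def dim_submatrix)
qed

lemma eigval_principal_submatrix_iff_card:
  assumes A: "A \<in> carrier_mat n n" and S: "S \<subseteq> {..<n}"
    and spec: "spectral S (\<lambda>i j. A $$ (i, j)) S z u"
    and P: "\<And>x y. P x \<Longrightarrow> x \<le> y \<Longrightarrow> P y" and i: "i \<in> {1..card S}"
  shows "P (eigval (principal_submatrix A S) i) \<longleftrightarrow> i \<le> card {l \<in> S. P (z l)}"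
proof -
  let ?k = "card S" and ?B = "principal_submatrix A S"
  have "finite S" using S finite_subset by auto
  note bij = bij_betw_pick[OF this]
  have S': "{i. i < n \<and> i \<in> S} = S" using S by auto
  have B: "?B $$ (i, j) = A $$ (pick S i, pick S j)" if "i < ?k" "j < ?k" for i j
    using A that by (simp add: principal_submatrix_def submatrix_index S')
  have "spectral {..<?k} (\<lambda>i j. A $$ (pick S i, pick S j)) {..<?k} (\<lambda>k. z (pick S k))
      (\<lambda>k i. u (pick S k) (pick S i))"
    by (rule spectral_reindex[OF spec bij])
  then have "spectral {..<?k} (\<lambda>i j. ?B $$ (i, j)) {..<?k} (\<lambda>k. z (pick S k))
      (\<lambda>k i. u (pick S k) (pick S i))"
    by (simp add: spectral_def B)
  from eigval_iff_card[OF principal_submatrix_carrier[OF A S] this P i]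
  have "P (eigval ?B i) \<longleftrightarrow> i \<le> card {l \<in> {..<?k}. P (z (pick S l))}" by simp
  also have "card {l \<in> {..<?k}. P (z (pick S l))} = card {l \<in> S. P (z l)}"
  proof (rule bij_betw_same_card[of "pick S"])
    show "bij_betw (pick S) {l \<in> {..<?k}. P (z (pick S l))} {l \<in> S. P (z l)}"
      using bij unfolding bij_betw_def by (auto simp: inj_on_def image_iff)
  qed
  finally show ?thesis .
qed

section \<open>Comparison of the spectra of a matrix and a sampled submatrix\<close>

text \<open>The product V y with the \<open>v j\<close> as columns; its squared norm over
  \<open>S\<close> is the Gram form y^T V_S^T V_S y.\<close>

definition combine_on :: "'k set \<Rightarrow> ('k \<Rightarrow> 'a \<Rightarrow> real) \<Rightarrow> ('k \<Rightarrow> real) \<Rightarrow> 'a \<Rightarrow> real" where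
  "combine_on J v y i = (\<Sum>j\<in>J. y j * v j i)"

lemma inner_combine_on: "inner_on S x (combine_on J v y) = (\<Sum>j\<in>J. y j * inner_on S x (v j))"
proof -
  have "combine_on J v y = (\<lambda>i. \<Sum>j\<in>J. y j * v j i)" by (simp add: combine_on_def fun_eq_iff)
  then show ?thesis by (simp add: inner_on_sum_right inner_on_scale_right)
qed

text \<open>The deterministic half: a fixed \<open>S\<close> on which both good events hold.
  \<open>\<rho> j\<close> is the relative distortion of outlier j in the Gram matrix, and
  \<open>\<bar>lam j\<bar> * \<rho> j \<le> e\<close> says that it moves this eigenvalue by at most
  e. Together with the error e of the small part this yields the 2e in the counts below.\<close>

locale sampled_spectrum =
  fixes N S J :: "nat set" and a :: "nat \<Rightarrow> nat \<Rightarrow> real"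
    and lam \<theta> :: "nat \<Rightarrow> real" and v u :: "nat \<Rightarrow> nat \<Rightarrow> real"
    and p e \<tau> :: real and \<rho> :: "nat \<Rightarrow> real"
  assumes specN: "spectral N a N lam v" and specS: "spectral S a S \<theta> u"
    and sub: "S \<subseteq> N" "J \<subseteq> N" and p: "p > 0" and e: "e > 0"
    and large: "\<And>j. j \<in> N \<Longrightarrow> \<bar>lam j\<bar> \<ge> \<tau> \<Longrightarrow> j \<in> J"
    and rho: "\<And>j. j \<in> J \<Longrightarrow> 0 \<le> \<rho> j" "\<And>j. j \<in> J \<Longrightarrow> \<rho> j \<le> 1 / 2" "\<And>j. j \<in> J \<Longrightarrow> \<bar>lam j\<bar> * \<rho> j \<le> e"
    and gram_lower: "\<And>y. p * (\<Sum>j\<in>J. (1 - \<rho> j) * (y j)\<^sup>2) \<le> inner_on S (combine_on J v y) (combine_on J v y)"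
    and gram_upper: "\<And>y. inner_on S (combine_on J v y) (combine_on J v y) \<le> p * (\<Sum>j\<in>J. (1 + \<rho> j) * (y j)\<^sup>2)"
    and small_part: "\<And>x. \<bar>\<Sum>k\<in>N - J. lam k * (inner_on S (v k) x)\<^sup>2\<bar> \<le> p * e * inner_on S x x"
begin

lemma finite_sets: "finite N" "finite S" "finite J"
  using spectral_finite[OF specN] sub finite_subset by auto

lemma form_eq: "inner_on S x (apply_on S a x) = (\<Sum>k\<in>N. lam k * (inner_on S (v k) x)\<^sup>2)"
proof -
  have "inner_on S x (apply_on S a x) = (\<Sum>k\<in>N. lam k * inner_on S (v k) x * inner_on S (v k) x)"
  proof (rule inner_apply_rank_one_sum)
    fix i j assume "i \<in> S" "j \<in> S"
    then have "i \<in> N" "j \<in> N" using sub by auto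
    then show "a i j = (\<Sum>k\<in>N. lam k * v k i * v k j)" using specN by (simp add: spectral_def)
  qed
  then show ?thesis by (simp add: power2_eq_square mult.assoc)
qed

lemma form_split: "inner_on S x (apply_on S a x) =
    (\<Sum>k\<in>J. lam k * (inner_on S (v k) x)\<^sup>2) + (\<Sum>k\<in>N - J. lam k * (inner_on S (v k) x)\<^sup>2)"
  unfolding form_eq using sum.subset_diff[OF sub(2) finite_sets(1)] by (simp add: add.commute)

lemma form_eigen: "inner_on S x (apply_on S a x) = (\<Sum>l\<in>S. \<theta> l * (inner_on S (u l) x)\<^sup>2)"
  by (simp add: spectral_inner[OF specS] power2_eq_square mult.assoc)

lemma norm_eigen: "inner_on S x x = (\<Sum>l\<in>S. (inner_on S (u l) x)\<^sup>2)"
  by (simp add: spectral_Parseval[OF specS, of x x] power2_eq_square)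

text \<open>The sampling hypotheses see \<open>lam\<close> only up to a global sign, so bounds at
  the lower end of the spectrum are the upper-end bounds for the negated matrix.\<close>

lemma negated: "sampled_spectrum N S J (\<lambda>i j. - a i j) (\<lambda>k. - lam k) (\<lambda>k. - \<theta> k) v u p e \<tau> \<rho>"
proof -
  have neg: "spectral M (\<lambda>i j. - a i j) M (\<lambda>k. - z k) w" if "spectral M a M z w" for M z w
    using spectral_shift[OF that, of "-1" 0] by simp
  show ?thesis
    using neg[OF specN] neg[OF specS] sub p e large rho gram_lower gram_upper small_part
    by unfold_locales (simp_all add: sum_negf)
qed

text \<open>With too many large \<open>\<theta> l\<close>, the span of their eigenvectors contains a
  nonzero x orthogonal to the sampled \<open>v j\<close> with \<open>lam j > b\<close>. On it the
  form exceeds t |x|^2, while the remaining outliers contribute at most p (b + e) |x|^2 and the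
  small part at most p e |x|^2.\<close>

lemma card_eigenvalues_upper:
  assumes "b \<ge> 0"
  shows "card {l \<in> S. \<theta> l > p * (b + 2 * e)} \<le> card {j \<in> N. lam j > b}"
proof (rule ccontr)
  define t where "t = p * (b + 2 * e)"
  define M where "M = {l \<in> S. \<theta> l > t}"
  define C where "C = {j \<in> N. lam j > b}"
  assume "\<not> ?thesis"
  then have "card C < card M" by (simp add: C_def M_def t_def)
  moreover have fin: "finite C" "finite M" using finite_sets by (auto simp: C_def M_def)
  ultimately obtain c where c: "\<exists>l\<in>M. c l \<noteq> 0" "\<forall>j\<in>C. (\<Sum>l\<in>M. inner_on S (v j) (u l) * c l) = 0"
    using homogeneous_nontrivial_solution[of C M "\<lambda>j l. inner_on S (v j) (u l)"] by blast
  define x where "x = combine_on M u c"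
  have vx: "inner_on S (v j) x = 0" if "j \<in> C" for j
    using c(2) that by (simp add: x_def inner_combine_on mult.commute)
  have ux: "inner_on S (u l) x = (if l \<in> M then c l else 0)" if "l \<in> S" for l
  proof -
    have "inner_on S (u l) x = (\<Sum>m\<in>M. if m = l then c m else 0)"
      unfolding x_def inner_combine_on
      by (intro sum.cong refl) (use that spectral_orthonormal[OF specS] in \<open>auto simp: M_def\<close>)
    then show ?thesis using fin by simp
  qed
  have sum_M: "(\<Sum>l\<in>S. g l * (inner_on S (u l) x)\<^sup>2) = (\<Sum>l\<in>M. g l * (c l)\<^sup>2)" for g
    by (rule sum.mono_neutral_cong_right) (use finite_sets in \<open>auto simp: M_def ux\<close>)
  have xx: "inner_on S x x = (\<Sum>l\<in>M. (c l)\<^sup>2)" using sum_M[of "\<lambda>_. 1"] by (simp add: norm_eigen)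
  have "t * inner_on S x x < inner_on S x (apply_on S a x)"
    unfolding form_eigen sum_M xx sum_distrib_left
  proof (rule sum_strict_mono_ex1)
    show "\<exists>l\<in>M. t * (c l)\<^sup>2 < \<theta> l * (c l)\<^sup>2" using c(1) by (auto simp: M_def)
    show "\<forall>l\<in>M. t * (c l)\<^sup>2 \<le> \<theta> l * (c l)\<^sup>2" by (auto simp: M_def intro: mult_right_mono)
  qed (use fin in auto)
  moreover have "inner_on S x (apply_on S a x) \<le> t * inner_on S x x"
  proof -
    define J' where "J' = {j \<in> J. 0 < lam j \<and> lam j \<le> b}"
    define z where "z j = inner_on S (v j) x" for j
    define n0 where "n0 = (\<Sum>j\<in>J'. lam j * (z j)\<^sup>2)"
    \<comment> \<open>These coefficients give <x, V y> = \<open>n0\<close>; Cauchy-Schwarz with the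
      Gram bound then reproduces \<open>n0\<close> on the right, and one factor cancels.\<close>
    define y where "y j = (if j \<in> J' then lam j * z j else 0)" for j
    have "(\<Sum>j\<in>J. lam j * (z j)\<^sup>2) \<le> (\<Sum>j\<in>J. if j \<in> J' then lam j * (z j)\<^sup>2 else 0)"
    proof (intro sum_mono)
      fix j assume "j \<in> J"
      show "lam j * (z j)\<^sup>2 \<le> (if j \<in> J' then lam j * (z j)\<^sup>2 else 0)"
      proof (cases "lam j > b")
        case True
        then show ?thesis using \<open>j \<in> J\<close> sub vx[of j] by (auto simp: z_def C_def)
      next
        case False
        then show ?thesis using \<open>j \<in> J\<close> by (auto simp: J'_def mult_nonpos_nonneg)
      qed
    qed
    also have "\<dots> = n0"
      unfolding n0_def by (rule sum.mono_neutral_cong_right) (use finite_sets in \<open>auto simp: J'_def\<close>)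
    finally have J_le: "(\<Sum>j\<in>J. lam j * (z j)\<^sup>2) \<le> n0" .
    have n0_nonneg: "n0 \<ge> 0" unfolding n0_def by (intro sum_nonneg) (auto simp: J'_def)
    have sumJ: "(\<Sum>j\<in>J. g j * (if j \<in> J' then h j else 0)) = (\<Sum>j\<in>J'. g j * h j)" for g h :: "nat \<Rightarrow> real"
      by (rule sum.mono_neutral_cong_right) (use finite_sets in \<open>auto simp: J'_def\<close>)
    have n0_inner: "inner_on S x (combine_on J v y) = n0"
    proof -
      have "inner_on S x (combine_on J v y) = (\<Sum>j\<in>J. z j * y j)"
        by (simp add: inner_combine_on z_def inner_on_commute mult.commute)
      also have "\<dots> = n0" unfolding y_def sumJ by (simp add: n0_def power2_eq_square mult_ac)
      finally show ?thesis .
    qed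
    have gram: "inner_on S (combine_on J v y) (combine_on J v y) \<le> p * ((b + e) * n0)"
    proof -
      have "(\<Sum>j\<in>J. (1 + \<rho> j) * (y j)\<^sup>2) = (\<Sum>j\<in>J'. (1 + \<rho> j) * (lam j * z j)\<^sup>2)"
        by (subst sumJ[symmetric], intro sum.cong refl) (simp add: y_def)
      also have "\<dots> \<le> (\<Sum>j\<in>J'. (b + e) * (lam j * (z j)\<^sup>2))"
      proof (intro sum_mono)
        fix j assume j: "j \<in> J'"
        then have "(1 + \<rho> j) * lam j \<le> b + e"
          using rho(3)[of j] by (auto simp: J'_def algebra_simps)
        then have "((1 + \<rho> j) * lam j) * (lam j * (z j)\<^sup>2) \<le> (b + e) * (lam j * (z j)\<^sup>2)"
          using j by (intro mult_right_mono) (auto simp: J'_def)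
        then show "(1 + \<rho> j) * (lam j * z j)\<^sup>2 \<le> (b + e) * (lam j * (z j)\<^sup>2)"
          by (simp add: power2_eq_square mult_ac)
      qed
      also have "\<dots> = (b + e) * n0" by (simp add: n0_def sum_distrib_left)
      finally show ?thesis using gram_upper[of y] p by (meson mult_left_mono less_imp_le order_trans)
    qed
    have "n0\<^sup>2 \<le> inner_on S x x * inner_on S (combine_on J v y) (combine_on J v y)"
      using inner_on_Cauchy_Schwarz[of S x "combine_on J v y"] by (simp add: n0_inner)
    also have "\<dots> \<le> inner_on S x x * (p * ((b + e) * n0))"
      by (rule mult_left_mono[OF gram inner_on_self_nonneg])
    finally have "n0 * n0 \<le> (p * (b + e) * inner_on S x x) * n0"
      by (simp add: power2_eq_square mult_ac)
    then have "n0 \<le> p * (b + e) * inner_on S x x"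
      using n0_nonneg p e assms inner_on_self_nonneg[of S x]
      by (cases "n0 = 0") (auto simp: mult_le_cancel_right)
    then show ?thesis using J_le small_part[of x] by (simp add: form_split t_def z_def algebra_simps)
  qed
  ultimately show False by simp
qed

text \<open>The test vector x = V_S y has coefficients on all outliers, not only on the large ones:
  making it orthogonal to the other sampled outliers removes their possibly negative contribution,
  and a solution remains because card (J - P) + card M < card J. The lower Gram bound ensures that x
  is nonzero.\<close>

lemma card_eigenvalues_lower:
  assumes "b \<ge> \<tau>" "b > e"
  shows "card {j \<in> N. lam j \<ge> b} \<le> card {l \<in> S. \<theta> l \<ge> p * (b - 2 * e)}"
proof (rule ccontr)
  define t where "t = p * (b - 2 * e)"
  define M where "M = {l \<in> S. \<theta> l \<ge> t}"
  define P where "P = {j \<in> N. lam j \<ge> b}"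
  assume "\<not> ?thesis"
  then have less: "card M < card P" by (simp add: P_def M_def t_def)
  have PJ: "P \<subseteq> J" using large assms by (fastforce simp: P_def)
  have fin: "finite P" "finite M" using finite_sets by (auto simp: P_def M_def)
  \<comment> \<open>\<open>Inl\<close> stands for orthogonality to an outlier outside
    \<open>P\<close>, \<open>Inr\<close> for orthogonality to an eigenvector of the submatrix with
    eigenvalue at least t.\<close>
  define C where "C = Inl ` (J - P) \<union> Inr ` M"
  define f where "f c j = (case c of Inl i \<Rightarrow> inner_on S (v i) (v j) | Inr l \<Rightarrow> inner_on S (u l) (v j))" for c j
  have "card C = card (J - P) + card M"
    unfolding C_def using finite_sets fin by (subst card_Un_disjoint) (auto simp: card_image)
  also have "\<dots> < card J"
    using less PJ finite_sets card_mono[OF finite_sets(3) PJ] by (simp add: card_Diff_subset fin)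
  finally have "card C < card J" .
  moreover have "finite C" using finite_sets fin by (simp add: C_def)
  ultimately obtain y where y: "\<exists>j\<in>J. y j \<noteq> 0" "\<forall>c\<in>C. (\<Sum>j\<in>J. f c j * y j) = 0"
    using homogeneous_nontrivial_solution[of C J f] finite_sets by blast
  define x where "x = combine_on J v y"
  define z where "z j = inner_on S (v j) x" for j
  have z0: "z j = 0" if "j \<in> J - P" for j
    using y(2)[rule_format, of "Inl j"] that
    by (simp add: z_def x_def inner_combine_on f_def C_def mult.commute)
  have u0: "inner_on S (u l) x = 0" if "l \<in> M" for l
    using y(2)[rule_format, of "Inr l"] that
    by (simp add: x_def inner_combine_on f_def C_def mult.commute)
  have "0 < p * (\<Sum>j\<in>J. (1 - \<rho> j) * (y j)\<^sup>2)"
  proof (intro mult_pos_pos p)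
    from y(1) obtain j where j: "j \<in> J" "y j \<noteq> 0" by blast
    have "0 < (1 - \<rho> j) * (y j)\<^sup>2" using rho(2)[OF j(1)] j by (intro mult_pos_pos) auto
    moreover have "0 \<le> (1 - \<rho> i) * (y i)\<^sup>2" if "i \<in> J" for i
      using rho(2)[OF that] by (intro mult_nonneg_nonneg) auto
    ultimately show "0 < (\<Sum>j\<in>J. (1 - \<rho> j) * (y j)\<^sup>2)" using j finite_sets by (intro sum_pos2)
  qed
  also note gram_lower[of y]
  finally have xpos: "inner_on S x x > 0" by (simp add: x_def)
  have "inner_on S x (apply_on S a x) < t * inner_on S x x"
    unfolding form_eigen norm_eigen sum_distrib_left
  proof (rule sum_strict_mono_ex1)
    show "\<forall>l\<in>S. \<theta> l * (inner_on S (u l) x)\<^sup>2 \<le> t * (inner_on S (u l) x)\<^sup>2"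
      using u0 by (force simp: M_def intro: mult_right_mono)
    obtain l where l: "l \<in> S" "inner_on S (u l) x \<noteq> 0"
      using xpos unfolding norm_eigen by (metis (no_types, lifting) less_irrefl power_zero_numeral sum.neutral)
    then have "l \<notin> M" using u0 by auto
    then have "\<theta> l < t" using l by (auto simp: M_def)
    then show "\<exists>l\<in>S. \<theta> l * (inner_on S (u l) x)\<^sup>2 < t * (inner_on S (u l) x)\<^sup>2"
      using l by (intro bexI[of _ l]) auto
  qed (use finite_sets in auto)
  moreover have "t * inner_on S x x \<le> inner_on S x (apply_on S a x)"
  proof -
    define X where "X = inner_on S x x"
    have sumP: "(\<Sum>j\<in>J. g j * z j) = (\<Sum>j\<in>P. g j * z j)" for g
      by (rule sum.mono_neutral_right) (use finite_sets PJ z0 in auto)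
    have "X = (\<Sum>j\<in>J. y j * inner_on S x (v j))"
      unfolding X_def by (subst (2) x_def) (rule inner_combine_on)
    also have "\<dots> = (\<Sum>j\<in>J. y j * z j)" by (simp add: z_def inner_on_commute[of S x])
    finally have X_eq: "X = (\<Sum>j\<in>P. y j * z j)" by (simp only: sumP)
    have rho_lt: "1 - \<rho> j > 0" if "j \<in> P" for j using rho(2)[of j] that PJ by auto
    have "X\<^sup>2 = (\<Sum>j\<in>P. (sqrt (1 - \<rho> j) * y j) * (z j / sqrt (1 - \<rho> j)))\<^sup>2"
      unfolding X_eq by (intro arg_cong[of _ _ power2] sum.cong refl) (use rho_lt in force)
    also have "\<dots> \<le> (\<Sum>j\<in>P. (sqrt (1 - \<rho> j) * y j)\<^sup>2) * (\<Sum>j\<in>P. (z j / sqrt (1 - \<rho> j))\<^sup>2)"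
      by (rule Cauchy_Schwarz_ineq_sum)
    also have "(\<Sum>j\<in>P. (sqrt (1 - \<rho> j) * y j)\<^sup>2) = (\<Sum>j\<in>P. (1 - \<rho> j) * (y j)\<^sup>2)"
      by (intro sum.cong refl) (use rho_lt in \<open>force simp: power_mult_distrib\<close>)
    also have "(\<Sum>j\<in>P. (z j / sqrt (1 - \<rho> j))\<^sup>2) = (\<Sum>j\<in>P. (z j)\<^sup>2 / (1 - \<rho> j))"
      by (intro sum.cong refl) (use rho_lt in \<open>force simp: power_divide\<close>)
    \<comment> \<open>The first factor is controlled by the lower Gram bound; in the second,
      \<open>lam j * (1 - \<rho> j)\<close> is at least b - e, which absorbs the weight introduced
      for Cauchy-Schwarz.\<close>
    also have "(\<Sum>j\<in>P. (1 - \<rho> j) * (y j)\<^sup>2) * (\<Sum>j\<in>P. (z j)\<^sup>2 / (1 - \<rho> j)) \<le>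
        (X / p) * (\<Sum>j\<in>P. lam j * (z j)\<^sup>2 / (b - e))"
    proof (intro mult_mono sum_mono)
      have "(\<Sum>j\<in>P. (1 - \<rho> j) * (y j)\<^sup>2) \<le> (\<Sum>j\<in>J. (1 - \<rho> j) * (y j)\<^sup>2)"
        by (rule sum_mono2) (use finite_sets PJ rho(2) in \<open>force intro: mult_nonneg_nonneg\<close>)+
      also have "\<dots> \<le> X / p" using gram_lower[of y] p by (simp add: X_def x_def field_simps)
      finally show "(\<Sum>j\<in>P. (1 - \<rho> j) * (y j)\<^sup>2) \<le> X / p" .
      show "0 \<le> X / p" using xpos p by (simp add: X_def)
      show "0 \<le> (\<Sum>j\<in>P. (z j)\<^sup>2 / (1 - \<rho> j))"
        by (intro sum_nonneg divide_nonneg_nonneg) (use rho_lt in \<open>auto simp: less_imp_le\<close>)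
      fix j assume j: "j \<in> P"
      have "\<bar>lam j\<bar> = lam j" "lam j \<ge> b" using j assms e by (auto simp: P_def)
      then have "b - e \<le> lam j * (1 - \<rho> j)" using rho(3)[of j] j PJ by (auto simp: algebra_simps)
      then have "1 / (1 - \<rho> j) \<le> lam j / (b - e)"
        using rho_lt[OF j] assms by (simp add: field_simps)
      then have "(z j)\<^sup>2 * (1 / (1 - \<rho> j)) \<le> (z j)\<^sup>2 * (lam j / (b - e))"
        by (intro mult_left_mono) auto
      then show "(z j)\<^sup>2 / (1 - \<rho> j) \<le> lam j * (z j)\<^sup>2 / (b - e)" by (simp add: mult.commute)
    qed
    also have "\<dots> = X * ((\<Sum>j\<in>P. lam j * (z j)\<^sup>2) / (p * (b - e)))"
      by (simp add: sum_divide_distrib[symmetric])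
    finally have "X \<le> (\<Sum>j\<in>P. lam j * (z j)\<^sup>2) / (p * (b - e))"
      using xpos by (metis X_def mult_left_le_imp_le power2_eq_square)
    then have "p * (b - e) * X \<le> (\<Sum>j\<in>P. lam j * (z j)\<^sup>2)"
      using p assms by (simp add: field_simps)
    also have "\<dots> = (\<Sum>j\<in>J. lam j * (z j)\<^sup>2)"
      using sumP[of "\<lambda>j. lam j * z j"] by (simp add: power2_eq_square mult.assoc)
    finally show ?thesis using small_part[of x] by (simp add: form_split t_def z_def X_def algebra_simps)
  qed
  ultimately show False by simp
qed

end

text \<open>The i-th largest is the (n + 1 - i)-th smallest; this carries the counting rule over to
  downward closed predicates.\<close>

lemma card_complement_iff:
  assumes "finite T" "card T = n" "i \<in> {1..n}"
    and "\<not> P x \<longleftrightarrow> i \<le> card {l \<in> T. \<not> P (z l)}"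
  shows "P x \<longleftrightarrow> n + 1 - i \<le> card {l \<in> T. P (z l)}"
proof -
  have "card {l \<in> T. P (z l)} + card {l \<in> T. \<not> P (z l)} = card ({l \<in> T. P (z l)} \<union> {l \<in> T. \<not> P (z l)})"
    using assms(1) by (intro card_Un_disjoint[symmetric]) auto
  also have "{l \<in> T. P (z l)} \<union> {l \<in> T. \<not> P (z l)} = T" by auto
  finally show ?thesis using assms by auto
qed

text \<open>Counting places an eigenvalue within 2e whenever its estimate has the same sign.
  Otherwise the true eigenvalue lies within 2e of 0 on the other side, which costs another 2e. The
  condition on \<open>\<tau>\<close> lets the lower count be used from 2e onwards.\<close>

theorem approx_eigval_accuracy:
  fixes A :: "real mat"
  assumes A: "A \<in> carrier_mat n n" and s: "s > 0"
    and sampled: "sampled_spectrum {..<n} S J (\<lambda>i j. A $$ (i, j)) lam \<theta> v u (s / real n) e \<tau> \<rho>"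
    and \<tau>: "\<tau> \<le> 2 * e" and i: "i \<in> {1..n}"
  shows "\<bar>approx_eigval n s A S i - eigval A i\<bar> \<le> 4 * e"
proof -
  define p where "p = s / real n"
  interpret S: sampled_spectrum "{..<n}" S J "\<lambda>i j. A $$ (i, j)" lam \<theta> v u p e \<tau> \<rho>
    using sampled by (simp add: p_def)
  interpret neg: sampled_spectrum "{..<n}" S J "\<lambda>i j. - (A $$ (i, j))" "\<lambda>k. - lam k" "\<lambda>k. - \<theta> k" v u p e \<tau> \<rho>
    by (rule S.negated)
  define k where "k = card S"
  define B where "B = principal_submatrix A S"
  have sub: "S \<subseteq> {..<n}" and fin: "finite S" using S.sub S.finite_sets by auto
  have kn: "k \<le> n" using card_mono[OF _ sub] by (simp add: k_def)
  have card_le_k: "card {l \<in> S. P l} \<le> k" for P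
    unfolding k_def using fin by (intro card_mono) auto
  have A_up: "P (eigval A i) \<longleftrightarrow> i \<le> card {l \<in> {..<n}. P (lam l)}"
    if "\<And>x y. P x \<Longrightarrow> x \<le> y \<Longrightarrow> P y" for P
    by (rule eigval_iff_card[OF A S.specN that i])
  have A_down: "P (eigval A i) \<longleftrightarrow> n + 1 - i \<le> card {l \<in> {..<n}. P (lam l)}"
    if "\<And>x y. P y \<Longrightarrow> x \<le> y \<Longrightarrow> P x" for P
  proof (rule card_complement_iff[of "{..<n}" n i P "eigval A i" lam, OF _ _ i])
    show "\<not> P (eigval A i) \<longleftrightarrow> i \<le> card {l \<in> {..<n}. \<not> P (lam l)}"
      by (rule A_up) (use that in blast)
  qed auto
  have B_up: "P (eigval B j) \<longleftrightarrow> j \<le> card {l \<in> S. P (\<theta> l)}"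
    if "\<And>x y. P x \<Longrightarrow> x \<le> y \<Longrightarrow> P y" "j \<in> {1..k}" for P j
    unfolding B_def using eigval_principal_submatrix_iff_card[OF A sub S.specS that(1)] that(2)
    by (simp add: k_def)
  have B_down: "P (eigval B j) \<longleftrightarrow> k + 1 - j \<le> card {l \<in> S. P (\<theta> l)}"
    if "\<And>x y. P y \<Longrightarrow> x \<le> y \<Longrightarrow> P x" "j \<in> {1..k}" for P j
  proof (rule card_complement_iff[of S k j P "eigval B j" \<theta>, OF fin k_def[symmetric] that(2)])
    show "\<not> P (eigval B j) \<longleftrightarrow> j \<le> card {l \<in> S. \<not> P (\<theta> l)}"
      by (rule B_up) (use that in blast)+
  qed
  have antimono: "eigval B m \<le> eigval B j" if "1 \<le> j" "j \<le> m" "m \<le> k" for j m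
    using B_up[of "\<lambda>x. x \<ge> eigval B m" m] B_up[of "\<lambda>x. x \<ge> eigval B m" j] that by auto
  define x where "x = eigval A i"
  \<comment> \<open>The position in the submatrix when both spectra are aligned at their bottom
    ends, so that k - j = n - i.\<close>
  define j where "j = i - (n - k)"
  have big: "i \<le> k \<and> eigval B i \<ge> p * (x - 2 * e)" if "x \<ge> 2 * e"
  proof -
    have "i \<le> card {l \<in> {..<n}. lam l \<ge> x}" using A_up[of "\<lambda>y. y \<ge> x"] by (simp add: x_def)
    also have "\<dots> \<le> card {l \<in> S. \<theta> l \<ge> p * (x - 2 * e)}"
      using that S.e \<tau> by (intro S.card_eigenvalues_lower) auto
    finally have *: "i \<le> card {l \<in> S. \<theta> l \<ge> p * (x - 2 * e)}" .
    have "i \<le> k" by (rule order_trans[OF * card_le_k])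
    then show ?thesis using * i B_up[of "\<lambda>y. y \<ge> p * (x - 2 * e)" i] by auto
  qed
  have not_too_big: "eigval B i \<le> p * (max x 0 + 2 * e)" if "i \<le> k"
  proof (rule ccontr)
    assume "\<not> ?thesis"
    then have "i \<le> card {l \<in> S. \<theta> l > p * (max x 0 + 2 * e)}"
      using B_up[of "\<lambda>y. y > p * (max x 0 + 2 * e)" i] i that by auto
    also have "\<dots> \<le> card {l \<in> {..<n}. lam l > max x 0}" by (rule S.card_eigenvalues_upper) simp
    finally have "eigval A i > max x 0" using A_up[of "\<lambda>y. y > max x 0"] by simp
    then show False by (simp add: x_def)
  qed
  have small: "n - k + 1 \<le> i \<and> eigval B j \<le> p * (x + 2 * e)" if "x \<le> - 2 * e"
  proof -
    have "n + 1 - i \<le> card {l \<in> {..<n}. lam l \<le> x}" using A_down[of "\<lambda>y. y \<le> x"] by (simp add: x_def)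
    also have "\<dots> = card {l \<in> {..<n}. - lam l \<ge> - x}" by simp
    also have "\<dots> \<le> card {l \<in> S. - \<theta> l \<ge> p * (- x - 2 * e)}"
      using that S.e \<tau> by (intro neg.card_eigenvalues_lower) auto
    also have "\<dots> = card {l \<in> S. \<theta> l \<le> p * (x + 2 * e)}"
      by (intro arg_cong[of _ _ card] Collect_cong) (auto simp: algebra_simps)
    finally have *: "n + 1 - i \<le> card {l \<in> S. \<theta> l \<le> p * (x + 2 * e)}" .
    have "n + 1 - i \<le> k" by (rule order_trans[OF * card_le_k])
    then have ik: "n - k + 1 \<le> i" using kn i by auto
    then have "k + 1 - j = n + 1 - i" "j \<in> {1..k}" using kn i by (auto simp: j_def)
    then show ?thesis using * ik B_down[of "\<lambda>y. y \<le> p * (x + 2 * e)" j] by auto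
  qed
  have not_too_small: "eigval B j \<ge> p * (min x 0 - 2 * e)" if "n - k + 1 \<le> i"
  proof (rule ccontr)
    have j: "k + 1 - j = n + 1 - i" "j \<in> {1..k}" using that kn i by (auto simp: j_def)
    assume "\<not> ?thesis"
    then have "n + 1 - i \<le> card {l \<in> S. \<theta> l < p * (min x 0 - 2 * e)}"
      using B_down[of "\<lambda>y. y < p * (min x 0 - 2 * e)" j] j by auto
    also have "\<dots> = card {l \<in> S. - \<theta> l > p * (- min x 0 + 2 * e)}"
      by (intro arg_cong[of _ _ card] Collect_cong) (auto simp: algebra_simps)
    also have "\<dots> \<le> card {l \<in> {..<n}. - lam l > - min x 0}" by (rule neg.card_eigenvalues_upper) simp
    also have "\<dots> = card {l \<in> {..<n}. lam l < min x 0}" by simp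
    finally have "eigval A i < min x 0" using A_down[of "\<lambda>y. y < min x 0"] by simp
    then show False by (simp add: x_def)
  qed
  have n: "real n > 0" using i by simp
  have ip: "real n / s * y \<le> b \<longleftrightarrow> y \<le> p * b" "b \<le> real n / s * y \<longleftrightarrow> p * b \<le> y" for y b
    using s n by (auto simp: p_def field_simps)
  have e: "e > 0" and p: "p > 0" using S.e S.p by auto
  \<comment> \<open>The branches of \<open>approx_eigval\<close>. A wrong branch would need a true
    eigenvalue more than 2e away from 0 on the wrong side, which \<open>big\<close> or
    \<open>small\<close> excludes.\<close>
  consider (top) "i \<le> k" "eigval B i \<ge> 0"
    | (bottom) "\<not> (i \<le> k \<and> eigval B i \<ge> 0)" "n - k + 1 \<le> i" "eigval B j < 0"
    | (rest) "\<not> (i \<le> k \<and> eigval B i \<ge> 0)" "\<not> (n - k + 1 \<le> i \<and> eigval B j < 0)" by blast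
  then show ?thesis
  proof cases
    case top
    have approx: "approx_eigval n s A S i = real n / s * eigval B i"
      using top i by (simp add: approx_eigval_def B_def k_def Let_def)
    have "x \<ge> - 2 * e"
    proof (rule ccontr)
      assume x: "\<not> ?thesis"
      then have "n - k + 1 \<le> i" "eigval B j \<le> p * (x + 2 * e)" using small by auto
      moreover have "p * (x + 2 * e) < 0" using x p by (intro mult_pos_neg) auto
      moreover have "eigval B i \<le> eigval B j"
        using \<open>n - k + 1 \<le> i\<close> top by (intro antimono) (auto simp: j_def)
      ultimately show False using top by simp
    qed
    then have "max x 0 + 2 * e \<le> x + 4 * e" using e by auto
    then have "p * (max x 0 + 2 * e) \<le> p * (x + 4 * e)" using p by simp
    then have "eigval B i \<le> p * (x + 4 * e)" using not_too_big top by linarith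
    moreover have "p * (x - 4 * e) \<le> eigval B i"
    proof (cases "x \<ge> 2 * e")
      case True
      have "p * (x - 4 * e) \<le> p * (x - 2 * e)" using p e by simp
      then show ?thesis using big[OF True] by simp
    next
      case False
      then have "p * (x - 4 * e) \<le> 0" using p e by (intro mult_nonneg_nonpos) auto
      then show ?thesis using top by simp
    qed
    ultimately have "real n / s * eigval B i \<le> x + 4 * e" "x - 4 * e \<le> real n / s * eigval B i"
      by (simp_all only: ip)
    then show ?thesis unfolding approx x_def[symmetric] by linarith
  next
    case bottom
    have approx: "approx_eigval n s A S i = real n / s * eigval B j"
      using bottom i kn by (auto simp: approx_eigval_def B_def k_def j_def Let_def)
    have "x \<le> 2 * e"
    proof (rule ccontr)
      assume x: "\<not> ?thesis"
      then have "i \<le> k" "eigval B i \<ge> p * (x - 2 * e)" using big by auto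
      moreover have "p * (x - 2 * e) > 0" using x p by simp
      ultimately show False using bottom by simp
    qed
    then have "min x 0 - 2 * e \<ge> x - 4 * e" using e by auto
    then have "p * (min x 0 - 2 * e) \<ge> p * (x - 4 * e)" using p by simp
    then have "eigval B j \<ge> p * (x - 4 * e)" using not_too_small bottom by linarith
    moreover have "eigval B j \<le> p * (x + 4 * e)"
    proof (cases "x \<le> - 2 * e")
      case True
      have "p * (x + 2 * e) \<le> p * (x + 4 * e)" using p e by simp
      then show ?thesis using small[OF True] by simp
    next
      case False
      then have "0 \<le> p * (x + 4 * e)" using p e by (intro mult_nonneg_nonneg) auto
      then show ?thesis using bottom by simp
    qed
    ultimately have "real n / s * eigval B j \<le> x + 4 * e" "x - 4 * e \<le> real n / s * eigval B j"
      by (simp_all only: ip)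
    then show ?thesis unfolding approx x_def[symmetric] by linarith
  next
    case rest
    have approx: "approx_eigval n s A S i = 0"
      using rest i kn by (auto simp: approx_eigval_def B_def k_def j_def Let_def)
    have "x \<le> 2 * e"
    proof (rule ccontr)
      assume x: "\<not> ?thesis"
      then have "i \<le> k" "eigval B i \<ge> p * (x - 2 * e)" using big by auto
      moreover have "p * (x - 2 * e) > 0" using x p by simp
      ultimately show False using rest by simp
    qed
    moreover have "x \<ge> - 2 * e"
    proof (rule ccontr)
      assume x: "\<not> ?thesis"
      then have "n - k + 1 \<le> i" "eigval B j \<le> p * (x + 2 * e)" using small by auto
      moreover have "p * (x + 2 * e) < 0" using x p by (intro mult_pos_neg) auto
      ultimately show False using rest by simp
    qed
    ultimately show ?thesis unfolding approx x_def[symmetric] using e by simp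
  qed
qed

section \<open>Tail bounds\<close>

lemma spectral_form_le:
  assumes spec: "spectral I X K z u" and "\<And>k. k \<in> K \<Longrightarrow> z k \<le> t"
  shows "inner_on I x (apply_on I X x) \<le> t * inner_on I x x"
  unfolding spectral_inner[OF spec] spectral_Parseval[OF spec, of x x] sum_distrib_left mult.assoc
  by (intro sum_mono mult_right_mono assms) auto

lemma spectral_form_ge:
  assumes spec: "spectral I X K z u" and "\<And>k. k \<in> K \<Longrightarrow> t \<le> z k"
  shows "t * inner_on I x x \<le> inner_on I x (apply_on I X x)"
  unfolding spectral_inner[OF spec] spectral_Parseval[OF spec, of x x] sum_distrib_left mult.assoc
  by (intro sum_mono mult_right_mono assms) auto

text \<open>Lets a bound by the largest eigenvalue be followed by an average over a power sum, the
  quantity whose mean the moment bounds control; the existential form also covers an empty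
  \<open>K\<close>.\<close>

lemma power_mean_bound_exists:
  fixes z :: "'k \<Rightarrow> real"
  assumes "finite K" "\<And>k. k \<in> K \<Longrightarrow> z k \<ge> 0" "q \<ge> 1"
  shows "\<exists>m\<ge>0. (\<forall>k\<in>K. z k \<le> m) \<and> m ^ q \<le> (\<Sum>k\<in>K. z k ^ q)"
proof (cases "K = {}")
  case True
  then show ?thesis using assms by (intro exI[of _ 0]) (auto simp: power_0_left)
next
  case False
  define m where "m = Max (z ` K)"
  have "m \<in> z ` K" unfolding m_def using False assms by (intro Max_in) auto
  then obtain k where k: "k \<in> K" "m = z k" by auto
  have "z k ^ q \<le> (\<Sum>k\<in>K. z k ^ q)" by (rule member_le_sum) (use k assms in auto)
  moreover have "\<forall>k\<in>K. z k \<le> m" using assms by (auto simp: m_def)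
  ultimately show ?thesis using k assms(2) by (intro exI[of _ m]) auto
qed

lemma spectral_form_power_le:
  assumes spec: "spectral I X K z u" and z: "\<And>k. k \<in> K \<Longrightarrow> z k \<ge> 0" and q: "q \<ge> 1"
  shows "(inner_on I x (apply_on I X x)) ^ q \<le> (inner_on I x x) ^ q * (\<Sum>k\<in>K. z k ^ q)"
proof -
  have "\<exists>m\<ge>0. (\<forall>k\<in>K. z k \<le> m) \<and> m ^ q \<le> (\<Sum>k\<in>K. z k ^ q)"
    by (rule power_mean_bound_exists[OF spectral_finite(2)[OF spec] z q])
  then obtain m where m: "m \<ge> 0" "\<And>k. k \<in> K \<Longrightarrow> z k \<le> m" "m ^ q \<le> (\<Sum>k\<in>K. z k ^ q)"
    by blast
  have "0 \<le> inner_on I x (apply_on I X x)"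
    using spectral_form_ge[OF spec, of 0 x] z by simp
  then have "(inner_on I x (apply_on I X x)) ^ q \<le> (m * inner_on I x x) ^ q"
    by (intro power_mono spectral_form_le[OF spec m(2)]) auto
  also have "\<dots> = (inner_on I x x) ^ q * m ^ q" by (simp add: power_mult_distrib mult.commute)
  also have "\<dots> \<le> (inner_on I x x) ^ q * (\<Sum>k\<in>K. z k ^ q)"
    by (intro mult_left_mono m zero_le_power inner_on_self_nonneg)
  finally show ?thesis .
qed

lemma spectral_gram_choice:
  fixes w :: "'i \<Rightarrow> 'a \<Rightarrow> real"
  assumes "finite I" "\<And>i j. i \<in> I \<Longrightarrow> j \<in> I \<Longrightarrow> D i j = D j i"
  shows "\<exists>z u. \<forall>S. spectral I (\<lambda>i j. (\<Sum>s\<in>S. w s i * w s j) + D i j) I (z S) (u S)"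
proof -
  have "\<forall>S. \<exists>z u. spectral I (\<lambda>i j. (\<Sum>s\<in>S. w s i * w s j) + D i j) I z u"
    by (intro allI spectral_exists[OF assms(1)]) (simp add: assms(2) mult.commute)
  then obtain z where "\<forall>S. \<exists>u. spectral I (\<lambda>i j. (\<Sum>s\<in>S. w s i * w s j) + D i j) I (z S) u"
    by (rule choice[THEN exE])
  then have "\<exists>u. \<forall>S. spectral I (\<lambda>i j. (\<Sum>s\<in>S. w s i * w s j) + D i j) I (z S) (u S)"
    by (rule choice)
  then show ?thesis by blast
qed

lemma ratio_power_le_exp:
  fixes a b t :: real
  assumes "0 \<le> a" "0 < b" "a \<le> (1 - t) * b"
  shows "(a / b) ^ n \<le> exp (- (real n * t))"
proof -
  have "a / b \<le> 1 - t" using assms by (simp add: divide_le_eq)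
  also have "\<dots> \<le> exp (- t)" using exp_ge_add_one_self[of "- t"] by simp
  finally have "(a / b) ^ n \<le> exp (- t) ^ n" using assms by (intro power_mono) auto
  then show ?thesis by (simp add: exp_of_nat_mult[symmetric])
qed

text \<open>Moments of order about p/R for the upper side and about 1/R for the lower side are
  compared with thresholds one \<open>p\<close> away from the mean, as in Markov's inequality. The
  factor 3 is 2 from the upper side, where rounding the order down costs exp (1/4) \<le> 2, plus 1
  from the lower side.\<close>

lemma gram_deviation:
  fixes w :: "'i \<Rightarrow> 'a \<Rightarrow> real" and \<phi> :: "'a \<Rightarrow> real" and p R \<mu> :: real
  assumes N: "finite N" and J: "finite J" and p: "0 < p" "p \<le> 1" and R0: "R > 0" and \<mu>: "\<mu> \<ge> 1"
    and \<phi>: "\<And>j. j \<in> J \<Longrightarrow> 0 \<le> \<phi> j" "\<And>j. j \<in> J \<Longrightarrow> \<phi> j \<le> \<mu>"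
    and total: "\<And>x. (\<Sum>s\<in>N. (inner_on J (w s) x)\<^sup>2) = (\<Sum>j\<in>J. \<phi> j * (x j)\<^sup>2)"
    and R: "\<And>s. s \<in> N \<Longrightarrow> inner_on J (w s) (w s) \<le> R"
  shows "expect N p (\<lambda>S. of_bool (\<exists>x. (\<Sum>s\<in>S. (inner_on J (w s) x)\<^sup>2) < p * (\<Sum>j\<in>J. (\<phi> j - 1) * (x j)\<^sup>2) \<or>
      (\<Sum>s\<in>S. (inner_on J (w s) x)\<^sup>2) > p * (\<Sum>j\<in>J. (\<phi> j + 1) * (x j)\<^sup>2)))
    \<le> 3 * card J * exp (- p / (8 * \<mu> * R))"
proof -
  \<comment> \<open>Pads the mean to p \<mu> times the identity, so that the two allowed deviations
    become the scalar thresholds \<open>p * \<mu> + p\<close> and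
    \<open>p * \<mu> - p\<close>.\<close>
  define D where "D i j = (if i = j then p * (\<mu> - \<phi> i) else 0)" for i j
  have D_form: "inner_on J x (apply_on J D x) = (\<Sum>j\<in>J. p * (\<mu> - \<phi> j) * (x j)\<^sup>2)" for x
    unfolding inner_on_def apply_on_def D_def using J
    by (intro sum.cong refl) (simp add: if_distrib[of "\<lambda>c. c * _"] power2_eq_square cong: if_cong)
  have D_nonneg: "inner_on J x (apply_on J D x) \<ge> 0" for x
    unfolding D_form using p \<phi> by (intro sum_nonneg mult_nonneg_nonneg) auto
  have "\<exists>z u. \<forall>S. spectral J (\<lambda>i j. (\<Sum>s\<in>S. w s i * w s j) + D i j) J (z S) (u S)"
    by (rule spectral_gram_choice[OF J]) (simp add: D_def)
  then obtain z u where spec: "\<And>S. spectral J (\<lambda>i j. (\<Sum>s\<in>S. w s i * w s j) + D i j) J (z S) (u S)"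
    by blast
  interpret random_gram N p J w D z u J R
    using N p D_nonneg spec R R0 by unfold_locales auto
  note p = \<open>0 < p\<close> \<open>p \<le> 1\<close>
  have inner_J: "inner_on J x x = (\<Sum>j\<in>J. (x j)\<^sup>2)" for x
    by (simp add: inner_on_def power2_eq_square)
  have mean: "p * (\<Sum>s\<in>N. (inner_on J (w s) x)\<^sup>2) + inner_on J x (apply_on J D x) = p * \<mu> * inner_on J x x" for x
    unfolding total D_form inner_J sum_distrib_left sum.distrib[symmetric]
    by (intro sum.cong refl) (simp add: algebra_simps)
  \<comment> \<open>At this order the shift q R uses up at most half of the margin \<open>p\<close>,
    leaving a ratio of at most 1 - 1/(4 \<mu>).\<close>
  define q where "q = nat \<lfloor>p / (2 * R)\<rfloor>"
  have q: "real q \<le> p / (2 * R)" "p / (2 * R) - 1 \<le> real q"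
    using p R0 by (auto simp: q_def)
  define M where "M = nat \<lceil>1 / R\<rceil> + 1"
  have "1 / R \<le> real M" unfolding M_def by linarith
  then have M: "1 \<le> M * R" "M > 0" using R0 by (auto simp: field_simps M_def)
  \<comment> \<open>Chosen so that M R / l = 1/(2 \<mu>): Bernoulli gives \<kappa> \<le> (1 -
    R/l)^M, whence \<kappa> (1 + R/l)^M \<le> 1, and the loss (1 - \<kappa>) p \<mu> is exactly p/2.
    \<open>M\<close> is large enough for l \<ge> 2 \<mu>, hence for \<open>bl\<close> \<le> 2
    l.\<close>
  define l where "l = 2 * \<mu> * R * M"
  have "2 * \<mu> * 1 \<le> 2 * \<mu> * (M * R)" using \<mu> M by (intro mult_left_mono) auto
  then have l_ge: "l \<ge> 2 * \<mu>" by (simp add: l_def mult_ac)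
  have l: "l \<ge> 2 * \<mu>" "l > 0" using l_ge \<mu> by linarith+
  define L where "L = l + \<mu>"
  define \<kappa> where "\<kappa> = 1 - 1 / (2 * \<mu>)"
  define bu where "bu = p * \<mu> + p"
  define bl where "bl = L - p * \<mu> + p"
  have pm: "p * \<mu> \<le> \<mu>" using p \<mu> by (simp add: mult_left_le_one_le)
  have bu: "bu > 0" using p \<mu> by (simp add: bu_def add_pos_pos)
  have bl: "bl > 0" unfolding bl_def L_def using p \<mu> pm l by linarith
  have gap: "L - z S k \<ge> 0" if "S \<subseteq> N" "k \<in> J" for S k
  proof -
    have "(\<Sum>s\<in>S. (inner_on J (w s) (u S k))\<^sup>2) \<le> (\<Sum>s\<in>N. (inner_on J (w s) (u S k))\<^sup>2)"
      using N that by (intro sum_mono2) auto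
    also have "\<dots> + inner_on J (u S k) (apply_on J D (u S k)) \<le> \<mu> * inner_on J (u S k) (u S k)"
      unfolding total D_form inner_J sum_distrib_left sum.distrib[symmetric]
    proof (intro sum_mono)
      fix j assume j: "j \<in> J"
      have "p * (\<mu> - \<phi> j) \<le> 1 * (\<mu> - \<phi> j)" using p \<phi>[OF j] by (intro mult_right_mono) auto
      then have "(\<phi> j + p * (\<mu> - \<phi> j)) * (u S k j)\<^sup>2 \<le> \<mu> * (u S k j)\<^sup>2"
        by (intro mult_right_mono) auto
      then show "\<phi> j * (u S k j)\<^sup>2 + p * (\<mu> - \<phi> j) * (u S k j)\<^sup>2 \<le> \<mu> * (u S k j)\<^sup>2"
        by (simp add: distrib_right)
    qed
    finally show ?thesis using gram_eigenvalue[OF that] eigenvector_unit[OF that] l by (simp add: L_def)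
  qed
  define B where "B S \<longleftrightarrow> (\<exists>x. (\<Sum>s\<in>S. (inner_on J (w s) x)\<^sup>2) < p * (\<Sum>j\<in>J. (\<phi> j - 1) * (x j)\<^sup>2) \<or>
      (\<Sum>s\<in>S. (inner_on J (w s) x)\<^sup>2) > p * (\<Sum>j\<in>J. (\<phi> j + 1) * (x j)\<^sup>2))" for S
  have pointwise: "of_bool (B S) \<le> (\<Sum>k\<in>J. (z S k + 0) ^ q) / bu ^ q + (\<Sum>k\<in>J. (L - z S k) ^ M) / bl ^ M"
    if S: "S \<subseteq> N" for S
  proof -
    have nn: "0 \<le> (\<Sum>k\<in>J. (z S k + 0) ^ q) / bu ^ q" "0 \<le> (\<Sum>k\<in>J. (L - z S k) ^ M) / bl ^ M"
      using gram_eigenvalue_nonneg[OF S] gap[OF S] bu bl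
      by (auto intro!: divide_nonneg_nonneg sum_nonneg zero_le_power)
    show ?thesis
    proof (cases "B S")
      case False
      then show ?thesis using nn by simp
    next
      case True
      then obtain x where
        x: "(\<Sum>s\<in>S. (inner_on J (w s) x)\<^sup>2) < p * (\<Sum>j\<in>J. (\<phi> j - 1) * (x j)\<^sup>2) \<or>
          (\<Sum>s\<in>S. (inner_on J (w s) x)\<^sup>2) > p * (\<Sum>j\<in>J. (\<phi> j + 1) * (x j)\<^sup>2)"
        by (auto simp: B_def)
      have shift: "p * (\<Sum>j\<in>J. (\<phi> j + c) * (x j)\<^sup>2) + inner_on J x (apply_on J D x) = (p * \<mu> + p * c) * inner_on J x x" for c
        unfolding D_form inner_J sum_distrib_left sum.distrib[symmetric]
        by (intro sum.cong refl) (simp add: algebra_simps)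
      from x show ?thesis
      proof
        assume "(\<Sum>s\<in>S. (inner_on J (w s) x)\<^sup>2) < p * (\<Sum>j\<in>J. (\<phi> j - 1) * (x j)\<^sup>2)"
        then have less: "inner_on J x (apply_on J (\<lambda>i j. (\<Sum>s\<in>S. w s i * w s j) + D i j) x) < (p * \<mu> - p) * inner_on J x x"
          using shift[of "-1"] by (simp add: gram_inner[OF S])
        obtain k where k: "k \<in> J" "z S k < p * \<mu> - p"
        proof (rule ccontr)
          assume "\<not> thesis"
          with that have "\<And>k. k \<in> J \<Longrightarrow> p * \<mu> - p \<le> z S k" by (meson not_le)
          from spectral_form_ge[OF spec[OF S] this, of x] less show False by simp
        qed
        have "bl ^ M \<le> (L - z S k) ^ M" using k bl by (intro power_mono) (auto simp: bl_def)
        also have "\<dots> \<le> (\<Sum>k\<in>J. (L - z S k) ^ M)"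
          by (rule member_le_sum) (use k J gap[OF S] in \<open>auto intro: zero_le_power\<close>)
        finally have "1 \<le> (\<Sum>k\<in>J. (L - z S k) ^ M) / bl ^ M" using bl by simp
        then show ?thesis using nn by simp
      next
        assume "(\<Sum>s\<in>S. (inner_on J (w s) x)\<^sup>2) > p * (\<Sum>j\<in>J. (\<phi> j + 1) * (x j)\<^sup>2)"
        then have less: "inner_on J x (apply_on J (\<lambda>i j. (\<Sum>s\<in>S. w s i * w s j) + D i j) x) > bu * inner_on J x x"
          using shift[of 1] by (simp add: gram_inner[OF S] bu_def)
        obtain k where k: "k \<in> J" "z S k > bu"
        proof (rule ccontr)
          assume "\<not> thesis"
          with that have "\<And>k. k \<in> J \<Longrightarrow> z S k \<le> bu" by (meson not_le)
          from spectral_form_le[OF spec[OF S] this, of x] less show False by simp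
        qed
        have "bu ^ q \<le> (z S k + 0) ^ q" using k bu by (intro power_mono) auto
        also have "\<dots> \<le> (\<Sum>k\<in>J. (z S k + 0) ^ q)"
          by (rule member_le_sum) (use k J gram_eigenvalue_nonneg[OF S] in \<open>auto intro: zero_le_power\<close>)
        finally have "1 \<le> (\<Sum>k\<in>J. (z S k + 0) ^ q) / bu ^ q" using bu by simp
        then show ?thesis using nn by simp
      qed
    qed
  qed
  have upper: "expect N p (\<lambda>S. \<Sum>k\<in>J. (z S k + 0) ^ q) / bu ^ q \<le> card J * (2 * exp (- p / (8 * \<mu> * R)))"
  proof -
    have "expect N p (\<lambda>S. \<Sum>k\<in>J. (z S k + 0) ^ q) \<le> card J * (p * \<mu> + 0 + q * R) ^ q"
      by (rule upper_moment_bound) (use mean p \<mu> in auto)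
    then have "expect N p (\<lambda>S. \<Sum>k\<in>J. (z S k + 0) ^ q) / bu ^ q \<le> card J * ((p * \<mu> + q * R) / bu) ^ q"
      using bu by (simp add: power_divide divide_right_mono)
    also have "((p * \<mu> + q * R) / bu) ^ q \<le> exp (- (real q * (1 / (4 * \<mu>))))"
    proof (rule ratio_power_le_exp)
      show "0 \<le> p * \<mu> + q * R" using p \<mu> R0 by auto
      have "q * R \<le> p / 2" using q R0 by (simp add: field_simps)
      moreover have "1 / (4 * \<mu>) * bu \<le> p / 2" using p \<mu> by (simp add: bu_def field_simps)
      moreover have "bu = p * \<mu> + p" by (rule bu_def)
      ultimately show "p * \<mu> + q * R \<le> (1 - 1 / (4 * \<mu>)) * bu"
        unfolding left_diff_distrib by linarith
    qed (rule bu)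
    also have "\<dots> \<le> exp (1 / 4 + - p / (8 * \<mu> * R))"
    proof -
      have "(p / (2 * R) - 1) * (1 / (4 * \<mu>)) \<le> real q * (1 / (4 * \<mu>))"
        using q \<mu> by (intro mult_right_mono) auto
      moreover have "(p / (2 * R) - 1) * (1 / (4 * \<mu>)) = p / (8 * \<mu> * R) - 1 / (4 * \<mu>)"
        using R0 \<mu> by (simp add: field_simps)
      moreover have "1 / (4 * \<mu>) \<le> 1 / 4" using \<mu> by (simp add: field_simps)
      ultimately show ?thesis by simp
    qed
    also have "\<dots> = exp (1 / 4) * exp (- p / (8 * \<mu> * R))" by (rule exp_add)
    also have "\<dots> \<le> 2 * exp (- p / (8 * \<mu> * R))"
      using exp_bound[of "1 / 4 :: real"] by (intro mult_right_mono) (auto simp: power2_eq_square)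
    finally show ?thesis by (simp add: mult_left_mono)
  qed
  have lower: "expect N p (\<lambda>S. \<Sum>k\<in>J. (L - z S k) ^ M) / bl ^ M \<le> card J * exp (- p / (8 * \<mu> * R))"
  proof -
    define r where "r = R / l"
    have r: "0 \<le> r" "M * r = 1 / (2 * \<mu>)" "r \<le> 1"
    proof -
      show "0 \<le> r" using R0 l by (simp add: r_def)
      show Mr: "M * r = 1 / (2 * \<mu>)" using R0 M \<mu> by (simp add: r_def l_def field_simps)
      have "1 * r \<le> M * r" using M \<open>0 \<le> r\<close> by (intro mult_right_mono) auto
      also have "\<dots> = 1 / (2 * \<mu>)" by (rule Mr)
      also have "\<dots> \<le> 1" using \<mu> by (simp add: field_simps)
      finally show "r \<le> 1" by simp
    qed
    have "\<kappa> \<le> (1 - r) ^ M" using Bernoulli_inequality[of "- r" M] r by (simp add: \<kappa>_def)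
    then have "\<kappa> * (1 + r) ^ M \<le> (1 - r) ^ M * (1 + r) ^ M" using r by (intro mult_right_mono) auto
    also have "\<dots> = ((1 - r) * (1 + r)) ^ M" by (simp add: power_mult_distrib)
    also have "\<dots> \<le> 1"
    proof (rule power_le_one)
      show "0 \<le> (1 - r) * (1 + r)" using r by simp
      show "(1 - r) * (1 + r) \<le> 1" by (simp add: algebra_simps)
    qed
    finally have \<kappa>3: "\<kappa> * (1 + R / l) ^ M \<le> 1" by (simp add: r_def)
    have \<kappa>: "0 \<le> \<kappa>" "\<kappa> \<le> 1" using \<mu> by (auto simp: \<kappa>_def field_simps)
    have "expect N p (\<lambda>S. \<Sum>k\<in>J. (L - z S k) ^ M) \<le> card J * (L - \<kappa> * (p * \<mu>)) ^ M"
    proof (rule lower_moment_bound)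
      fix x
      have "(\<Sum>s\<in>N. (inner_on J (w s) x)\<^sup>2) + inner_on J x (apply_on J D x) \<le> \<mu> * inner_on J x x"
        unfolding total D_form inner_J sum_distrib_left sum.distrib[symmetric]
      proof (intro sum_mono)
        fix j assume j: "j \<in> J"
        have "p * (\<mu> - \<phi> j) \<le> 1 * (\<mu> - \<phi> j)" using p \<phi>[OF j] by (intro mult_right_mono) auto
        then have "(\<phi> j + p * (\<mu> - \<phi> j)) * (x j)\<^sup>2 \<le> \<mu> * (x j)\<^sup>2" by (intro mult_right_mono) auto
        then show "\<phi> j * (x j)\<^sup>2 + p * (\<mu> - \<phi> j) * (x j)\<^sup>2 \<le> \<mu> * (x j)\<^sup>2"
          by (simp add: distrib_right)
      qed
      then show "(\<Sum>s\<in>N. (inner_on J (w s) x)\<^sup>2) + inner_on J x (apply_on J D x) \<le> (L - l) * inner_on J x x"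
        by (simp add: L_def)
    next
      have "p * \<mu> \<le> \<mu> + l" using pm l by linarith
      then show "p * \<mu> \<le> L" by (simp add: L_def add.commute)
    qed (use mean p \<mu> l \<kappa> \<kappa>3 in auto)
    then have "expect N p (\<lambda>S. \<Sum>k\<in>J. (L - z S k) ^ M) / bl ^ M \<le> card J * ((L - \<kappa> * (p * \<mu>)) / bl) ^ M"
      using bl by (simp add: power_divide divide_right_mono)
    also have "((L - \<kappa> * (p * \<mu>)) / bl) ^ M \<le> exp (- (real M * (p / (4 * l))))"
    proof (rule ratio_power_le_exp)
      have kp: "\<kappa> * (p * \<mu>) = p * \<mu> - p / 2" using \<mu> by (simp add: \<kappa>_def field_simps)
      show "0 \<le> L - \<kappa> * (p * \<mu>)" using kp pm l p by (simp add: L_def)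
      have "0 \<le> p * \<mu>" using p \<mu> by simp
      then have "bl \<le> 2 * l" using l p \<mu> unfolding bl_def L_def by linarith
      then have "p / (4 * l) * bl \<le> p / (4 * l) * (2 * l)" using p l by (intro mult_left_mono) auto
      also have "\<dots> = p / 2" using l by simp
      finally have "p / (4 * l) * bl \<le> p / 2" .
      moreover have "bl = L - p * \<mu> + p" by (rule bl_def)
      ultimately show "L - \<kappa> * (p * \<mu>) \<le> (1 - p / (4 * l)) * bl"
        unfolding left_diff_distrib kp by linarith
    qed (rule bl)
    also have "real M * (p / (4 * l)) = p / (8 * \<mu> * R)"
      using M R0 \<mu> by (simp add: l_def field_simps)
    finally show ?thesis by (simp add: mult_left_mono)
  qed
  have "expect N p (\<lambda>S. of_bool (B S)) \<le>
      expect N p (\<lambda>S. (1 / bu ^ q) * (\<Sum>k\<in>J. (z S k + 0) ^ q) + (1 / bl ^ M) * (\<Sum>k\<in>J. (L - z S k) ^ M))"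
    by (rule expect_mono) (use p pointwise in auto)
  also have "\<dots> = expect N p (\<lambda>S. \<Sum>k\<in>J. (z S k + 0) ^ q) / bu ^ q + expect N p (\<lambda>S. \<Sum>k\<in>J. (L - z S k) ^ M) / bl ^ M"
    unfolding expect_add expect_cmult by simp
  also have "\<dots> \<le> card J * (2 * exp (- p / (8 * \<mu> * R))) + card J * exp (- p / (8 * \<mu> * R))"
    by (intro add_mono upper lower)
  finally show ?thesis by (simp add: B_def algebra_simps)
qed

text \<open>The one-dimensional case: a nonnegative sum is a Gram matrix of size 1 with vectors
  \<open>sqrt (g s)\<close>.\<close>

lemma scalar_moment_bound:
  fixes g :: "'i \<Rightarrow> real"
  assumes "finite T" "0 \<le> p" "p \<le> 1" "\<And>s. s \<in> T \<Longrightarrow> 0 \<le> g s" "\<And>s. s \<in> T \<Longrightarrow> g s \<le> G" "G \<ge> 0"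
  shows "expect T p (\<lambda>S. (\<Sum>s\<in>S. g s) ^ q) \<le> (p * (\<Sum>s\<in>T. g s) + q * G) ^ q"
proof -
  have sq: "sqrt (g s) * sqrt (g s) = g s" if "s \<in> T" for s using assms(4)[OF that] by simp
  have sums: "(\<Sum>s\<in>S. sqrt (g s) * sqrt (g s)) = (\<Sum>s\<in>S. g s)" if "S \<subseteq> T" for S
    by (intro sum.cong refl) (use sq that in auto)
  interpret random_gram T p "{()}" "\<lambda>s _. sqrt (g s)" "\<lambda>_ _. 0" "\<lambda>S _. \<Sum>s\<in>S. g s" "\<lambda>_ _ _. 1" "{()}" G
    by unfold_locales (use assms sums sq in \<open>auto simp: spectral_def inner_on_def apply_on_def\<close>)
  have "expect T p (\<lambda>S. \<Sum>k\<in>{()}. ((\<Sum>s\<in>S. g s) + 0) ^ q) \<le>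
      real (card {()}) * (p * (\<Sum>s\<in>T. g s) + 0 + q * G) ^ q"
  proof (rule upper_moment_bound)
    show "p * (\<Sum>s\<in>T. (inner_on {()} (\<lambda>_. sqrt (g s)) x)\<^sup>2) + inner_on {()} x (apply_on {()} (\<lambda>_ _. 0) x)
        \<le> p * sum g T * inner_on {()} x x" for x
      using assms by (simp add: inner_on_def apply_on_def power_mult_distrib power2_eq_square[of "x _"]
          flip: sum_distrib_right)
  qed (use assms in \<open>auto intro!: mult_nonneg_nonneg sum_nonneg\<close>)
  then show ?thesis by simp
qed

section \<open>Moments of bipartite and principal forms\<close>

lemma add_power_le:
  fixes a b :: real
  assumes "a \<ge> 0" "b \<ge> 0"
  shows "(a + b) ^ q \<le> 2 ^ q * (a ^ q + b ^ q)"
proof -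
  have "(a + b) ^ q \<le> (2 * max a b) ^ q" using assms by (intro power_mono) auto
  also have "\<dots> = 2 ^ q * (max a b) ^ q" by (rule power_mult_distrib)
  also have "(max a b) ^ q \<le> a ^ q + b ^ q" using assms by (auto simp: max_def)
  finally show ?thesis by simp
qed

text \<open>\<open>F A B\<close> is the trace of the q-th power of the Gram matrix of the block
  H(A,B), so one number bounds the form for all x. Its mean takes two sampling passes: first the
  rows in \<open>A\<close> for fixed columns \<open>B\<close>, which leaves the norm of H(N,B) and
  the row lengths within \<open>B\<close>; then \<open>B\<close> itself, by the matrix and the
  scalar moment bound respectively.\<close>

lemma bipartite_form_moment:
  fixes H :: "'a \<Rightarrow> 'a \<Rightarrow> real" and p g h \<nu> :: real
  assumes N: "finite N" and p: "0 \<le> p" "p \<le> 1" and q: "q \<ge> 1"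
    and sym: "\<And>i j. i \<in> N \<Longrightarrow> j \<in> N \<Longrightarrow> H i j = H j i"
    and op: "\<And>x. (\<Sum>i\<in>N. (inner_on N (H i) x)\<^sup>2) \<le> \<nu> * inner_on N x x"
    and row: "\<And>i. i \<in> N \<Longrightarrow> inner_on N (H i) (H i) \<le> g"
    and entry: "\<And>i j. i \<in> N \<Longrightarrow> j \<in> N \<Longrightarrow> (H i j)\<^sup>2 \<le> h"
    and nonneg: "\<nu> \<ge> 0" "g \<ge> 0" "h \<ge> 0"
  shows "\<exists>F. (\<forall>A B. A \<subseteq> N \<longrightarrow> B \<subseteq> N \<longrightarrow> 0 \<le> F A B) \<and>
    (\<forall>A B x. A \<subseteq> N \<longrightarrow> B \<subseteq> N \<longrightarrow>
      (\<Sum>i\<in>A. \<Sum>j\<in>B. H i j * x i * x j) ^ (2 * q) \<le> (inner_on N x x) ^ (2 * q) * F A B) \<and>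
    (\<forall>T U. T \<subseteq> N \<longrightarrow> U \<subseteq> N \<longrightarrow> expect T p (\<lambda>A. expect U p (F A)) \<le>
      2 * (card N)\<^sup>2 * (2 * (p\<^sup>2 * \<nu> + p * q * g + (real q)\<^sup>2 * h)) ^ q)"
proof -
  define w where "w B i k = (if k \<in> B then H i k else 0)" for B i k
  have "\<exists>z u. \<forall>B. spectral N (\<lambda>k l. (\<Sum>j\<in>B. H j k * H j l) + (0 :: real)) N (z B) (u B)"
    by (rule spectral_gram_choice[OF N]) simp
  then obtain z' u' where spec': "\<And>B. spectral N (\<lambda>k l. (\<Sum>j\<in>B. H j k * H j l) + 0) N (z' B) (u' B)"
    by blast
  have "\<exists>z u. \<forall>A. spectral N (\<lambda>k l. (\<Sum>i\<in>A. w B i k * w B i l) + (0 :: real)) N (z A) (u A)" for B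
    by (rule spectral_gram_choice[OF N]) simp
  then obtain z where "\<forall>B. \<exists>u. \<forall>A. spectral N (\<lambda>k l. (\<Sum>i\<in>A. w B i k * w B i l) + 0) N (z B A) (u A)"
    using choice[of "\<lambda>B z. \<exists>u. \<forall>A. spectral N (\<lambda>k l. (\<Sum>i\<in>A. w B i k * w B i l) + 0) N (z A) (u A)"] by blast
  then obtain u where spec_w: "\<And>A B. spectral N (\<lambda>k l. (\<Sum>i\<in>A. w B i k * w B i l) + 0) N (z B A) (u B A)"
    using choice[of "\<lambda>B u. \<forall>A. spectral N (\<lambda>k l. (\<Sum>i\<in>A. w B i k * w B i l) + 0) N (z B A) (u A)"] by blast
  have zero_form: "inner_on N x (apply_on N (\<lambda>_ _. 0) x) = 0" for x
    by (simp add: inner_on_def apply_on_def)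
  have gram_w: "random_gram T p N (w B) (\<lambda>_ _. 0) (z B) (u B) N r"
    if "T \<subseteq> N" "\<And>i. i \<in> N \<Longrightarrow> inner_on N (w B i) (w B i) \<le> r" "r \<ge> 0" for T B r
    using that p N finite_subset[OF that(1) N] by unfold_locales (auto simp: zero_form spec_w[simplified])
  have gram_H: "random_gram U p N H (\<lambda>_ _. 0) z' u' N g" if "U \<subseteq> N" for U
    using that p N finite_subset[OF that N] row nonneg
    by unfold_locales (auto simp: zero_form spec'[simplified])
  have inner_w: "inner_on N (w B i) x = (\<Sum>k\<in>B. H i k * x k)" if "B \<subseteq> N" for B i x
    unfolding inner_on_def w_def
    by (rule sum.mono_neutral_cong_right) (use that N in auto)
  have w_self: "inner_on N (w B i) (w B i) = (\<Sum>k\<in>B. (H i k)\<^sup>2)" if "B \<subseteq> N" for B i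
    using inner_w[OF that, of i "w B i"] by (simp add: w_def power2_eq_square)
  have w_le_g: "inner_on N (w B i) (w B i) \<le> g" if "i \<in> N" "B \<subseteq> N" for B i
  proof -
    have "(\<Sum>k\<in>B. (H i k)\<^sup>2) \<le> (\<Sum>k\<in>N. (H i k)\<^sup>2)" using that N by (intro sum_mono2) auto
    also have "\<dots> = inner_on N (H i) (H i)" by (simp add: inner_on_def power2_eq_square)
    finally show ?thesis using row[OF that(1)] by (simp add: w_self[OF that(2)])
  qed
  define F where "F A B = (\<Sum>k\<in>N. z B A k ^ q)" for A B
  define X where "X = p\<^sup>2 * \<nu> + p * q * g + (real q)\<^sup>2 * h"
  show ?thesis
  proof (intro exI[of _ F] conjI allI impI)
    fix A B assume AB: "A \<subseteq> N" "B \<subseteq> N"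
    interpret random_gram N p N "w B" "\<lambda>_ _. 0" "z B" "u B" N g
      by (rule gram_w) (use w_le_g AB nonneg in auto)
    show "F A B \<ge> 0" unfolding F_def
      by (intro sum_nonneg zero_le_power gram_eigenvalue_nonneg AB)
  next
    fix A B x assume AB: "A \<subseteq> N" "B \<subseteq> N"
    interpret random_gram N p N "w B" "\<lambda>_ _. 0" "z B" "u B" N g
      by (rule gram_w) (use w_le_g AB nonneg in auto)
    define G where "G k l = (\<Sum>i\<in>A. w B i k * w B i l) + 0" for k l
    have form: "inner_on N x (apply_on N G x) = (\<Sum>i\<in>A. (inner_on N (w B i) x)\<^sup>2)"
      using gram_inner[OF AB(1), of x] by (simp add: G_def[abs_def] zero_form)
    have "(\<Sum>i\<in>A. \<Sum>j\<in>B. H i j * x i * x j) = (\<Sum>i\<in>A. x i * inner_on N (w B i) x)"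
      by (intro sum.cong refl) (simp add: inner_w[OF AB(2)] sum_distrib_left mult_ac)
    then have "(\<Sum>i\<in>A. \<Sum>j\<in>B. H i j * x i * x j)\<^sup>2 \<le> (\<Sum>i\<in>A. (x i)\<^sup>2) * (\<Sum>i\<in>A. (inner_on N (w B i) x)\<^sup>2)"
      using Cauchy_Schwarz_ineq_sum[of x "\<lambda>i. inner_on N (w B i) x" A] by simp
    also have "(\<Sum>i\<in>A. (x i)\<^sup>2) \<le> inner_on N x x"
      unfolding inner_on_def power2_eq_square using AB N by (intro sum_mono2) auto
    finally have le: "(\<Sum>i\<in>A. \<Sum>j\<in>B. H i j * x i * x j)\<^sup>2 \<le> inner_on N x x * inner_on N x (apply_on N G x)"
      by (simp add: form mult_right_mono sum_nonneg)
    have "(\<Sum>i\<in>A. \<Sum>j\<in>B. H i j * x i * x j) ^ (2 * q) \<le> (inner_on N x x * inner_on N x (apply_on N G x)) ^ q"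
      unfolding power_mult using le by (intro power_mono) auto
    also have "\<dots> = (inner_on N x x) ^ q * (inner_on N x (apply_on N G x)) ^ q" by (rule power_mult_distrib)
    also have "\<dots> \<le> (inner_on N x x) ^ q * ((inner_on N x x) ^ q * F A B)"
      unfolding F_def
    proof (intro mult_left_mono spectral_form_power_le q)
      show "spectral N G N (z B A) (u B A)" using spec_w by (simp add: G_def[abs_def])
    qed (use gram_eigenvalue_nonneg[OF AB(1)] inner_on_self_nonneg in \<open>auto intro: zero_le_power\<close>)
    finally show "(\<Sum>i\<in>A. \<Sum>j\<in>B. H i j * x i * x j) ^ (2 * q) \<le> (inner_on N x x) ^ (2 * q) * F A B"
      by (simp add: mult_2 power_add mult.assoc)
  next
    fix T U assume T: "T \<subseteq> N" and U: "U \<subseteq> N"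
    have finTU: "finite T" "finite U" using T U N finite_subset by auto
    define c where "c = real (card N)"
    interpret H: random_gram U p N H "\<lambda>_ _. 0" z' u' N g by (rule gram_H[OF U])
    have inner_bound: "expect T p (\<lambda>A. F A B) \<le> c * (2 ^ q * (p ^ q * (\<Sum>k\<in>N. z' B k ^ q) + real q ^ q * (\<Sum>i\<in>N. (\<Sum>k\<in>B. (H i k)\<^sup>2) ^ q)))"
      if B: "B \<subseteq> U" for B
    proof -
      have BN: "B \<subseteq> N" using B U by auto
      obtain m where m: "m \<ge> 0" "\<And>k. k \<in> N \<Longrightarrow> z' B k \<le> m" "m ^ q \<le> (\<Sum>k\<in>N. z' B k ^ q)"
        using power_mean_bound_exists[OF N _ q, of "z' B"] H.gram_eigenvalue_nonneg[OF B] by blast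
      obtain r where r: "r \<ge> 0" "\<And>i. i \<in> N \<Longrightarrow> (\<Sum>k\<in>B. (H i k)\<^sup>2) \<le> r" "r ^ q \<le> (\<Sum>i\<in>N. (\<Sum>k\<in>B. (H i k)\<^sup>2) ^ q)"
        using power_mean_bound_exists[OF N _ q, of "\<lambda>i. \<Sum>k\<in>B. (H i k)\<^sup>2"] by (metis sum_nonneg zero_le_power2)
      interpret W: random_gram T p N "w B" "\<lambda>_ _. 0" "z B" "u B" N r
        by (rule gram_w[OF T]) (use r w_self[OF BN] in auto)
      \<comment> \<open>A matrix and its transpose have the same norm: \<open>m\<close> comes from
        the columns \<open>H k\<close> with k in \<open>B\<close>, whereas sampling rows calls for a
        bound on the vectors \<open>w B i\<close>.\<close>
      have adjoint: "(\<Sum>i\<in>N. (inner_on N (w B i) x)\<^sup>2) \<le> m * inner_on N x x" for x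
      proof -
        define y where "y i = inner_on N (w B i) x" for i
        define Y where "Y = inner_on N y y"
        have "Y = (\<Sum>i\<in>N. \<Sum>k\<in>B. x k * (H i k * y i))"
          unfolding Y_def inner_on_def by (subst (2) y_def) (simp add: inner_w[OF BN] sum_distrib_right sum_distrib_left mult_ac)
        also have "\<dots> = (\<Sum>k\<in>B. x k * (\<Sum>i\<in>N. H i k * y i))"
          by (subst sum.swap) (simp add: sum_distrib_left)
        also have "\<dots> = (\<Sum>k\<in>B. x k * inner_on N (H k) y)"
          using BN by (intro sum.cong refl) (auto simp: inner_on_def sym intro!: sum.cong)
        finally have Y: "Y = \<dots>" .
        have "Y\<^sup>2 \<le> (\<Sum>k\<in>B. (x k)\<^sup>2) * (\<Sum>k\<in>B. (inner_on N (H k) y)\<^sup>2)"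
          unfolding Y by (rule Cauchy_Schwarz_ineq_sum)
        also have "\<dots> \<le> inner_on N x x * (m * Y)"
        proof (intro mult_mono)
          show "(\<Sum>k\<in>B. (x k)\<^sup>2) \<le> inner_on N x x"
            unfolding inner_on_def power2_eq_square using BN N by (intro sum_mono2) auto
          show "(\<Sum>k\<in>B. (inner_on N (H k) y)\<^sup>2) \<le> m * Y"
            using spectral_form_le[OF spec' m(2), of y] H.gram_inner[OF B, of y] by (simp add: Y_def zero_form)
        qed (auto intro: sum_nonneg inner_on_self_nonneg)
        finally have "Y * Y \<le> (m * inner_on N x x) * Y" by (simp add: power2_eq_square mult_ac)
        then have "Y \<le> m * inner_on N x x"
          using inner_on_self_nonneg[of N y] inner_on_self_nonneg[of N x] m(1)
          by (cases "Y = 0") (auto simp: Y_def mult_le_cancel_right)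
        then show ?thesis by (simp add: Y_def y_def inner_on_def power2_eq_square)
      qed
      have "expect T p (\<lambda>A. F A B) = expect T p (\<lambda>A. \<Sum>k\<in>N. (z B A k + 0) ^ q)" by (simp add: F_def)
      also have "\<dots> \<le> real (card N) * (p * m + 0 + q * r) ^ q"
      proof (rule W.upper_moment_bound)
        fix x
        have "(\<Sum>i\<in>T. (inner_on N (w B i) x)\<^sup>2) \<le> (\<Sum>i\<in>N. (inner_on N (w B i) x)\<^sup>2)"
          using T N by (intro sum_mono2) auto
        then have "(\<Sum>i\<in>T. (inner_on N (w B i) x)\<^sup>2) \<le> m * inner_on N x x" using adjoint[of x] by linarith
        then show "p * (\<Sum>i\<in>T. (inner_on N (w B i) x)\<^sup>2) + inner_on N x (apply_on N (\<lambda>_ _. 0) x) \<le> p * m * inner_on N x x"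
          using p by (simp add: zero_form mult_left_mono mult.assoc)
      qed (use p m in auto)
      also have "(p * m + 0 + q * r) ^ q \<le> 2 ^ q * ((p * m) ^ q + (q * r) ^ q)"
        using add_power_le[of "p * m" "q * r" q] p m r by simp
      also have "\<dots> \<le> 2 ^ q * (p ^ q * (\<Sum>k\<in>N. z' B k ^ q) + real q ^ q * (\<Sum>i\<in>N. (\<Sum>k\<in>B. (H i k)\<^sup>2) ^ q))"
        unfolding power_mult_distrib using p m r by (intro mult_left_mono add_mono) auto
      finally show ?thesis by (simp add: c_def mult_left_mono)
    qed
    have bound1: "expect U p (\<lambda>B. \<Sum>k\<in>N. z' B k ^ q) \<le> c * (p * \<nu> + q * g) ^ q"
    proof -
      have "expect U p (\<lambda>B. \<Sum>k\<in>N. (z' B k + 0) ^ q) \<le> real (card N) * (p * \<nu> + 0 + q * g) ^ q"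
      proof (rule H.upper_moment_bound)
        fix x
        have "(\<Sum>i\<in>U. (inner_on N (H i) x)\<^sup>2) \<le> (\<Sum>i\<in>N. (inner_on N (H i) x)\<^sup>2)"
          using U N by (intro sum_mono2) auto
        then have "(\<Sum>i\<in>U. (inner_on N (H i) x)\<^sup>2) \<le> \<nu> * inner_on N x x" using op[of x] by linarith
        then show "p * (\<Sum>i\<in>U. (inner_on N (H i) x)\<^sup>2) + inner_on N x (apply_on N (\<lambda>_ _. 0) x) \<le> p * \<nu> * inner_on N x x"
          using p by (simp add: zero_form mult_left_mono mult.assoc)
      qed (use p nonneg in auto)
      then show ?thesis by (simp add: c_def)
    qed
    have bound2: "expect U p (\<lambda>B. (\<Sum>k\<in>B. (H i k)\<^sup>2) ^ q) \<le> (p * g + q * h) ^ q" if i: "i \<in> N" for i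
    proof -
      have "expect U p (\<lambda>B. (\<Sum>k\<in>B. (H i k)\<^sup>2) ^ q) \<le> (p * (\<Sum>k\<in>U. (H i k)\<^sup>2) + q * h) ^ q"
        by (rule scalar_moment_bound) (use finTU p entry i U nonneg in auto)
      also have "\<dots> \<le> (p * g + q * h) ^ q"
        using w_le_g[OF i U] p nonneg
        by (intro power_mono add_mono mult_left_mono add_nonneg_nonneg mult_nonneg_nonneg sum_nonneg)
          (auto simp: w_self[OF U])
      finally show ?thesis .
    qed
    have "expect T p (\<lambda>A. expect U p (F A)) = expect U p (\<lambda>B. expect T p (\<lambda>A. F A B))" by (rule expect_swap)
    also have "\<dots> \<le> expect U p (\<lambda>B. c * (2 ^ q * (p ^ q * (\<Sum>k\<in>N. z' B k ^ q) + real q ^ q * (\<Sum>i\<in>N. (\<Sum>k\<in>B. (H i k)\<^sup>2) ^ q))))"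
      by (intro expect_mono p inner_bound)
    also have "\<dots> = c * (2 ^ q * (p ^ q * expect U p (\<lambda>B. \<Sum>k\<in>N. z' B k ^ q) + real q ^ q * (\<Sum>i\<in>N. expect U p (\<lambda>B. (\<Sum>k\<in>B. (H i k)\<^sup>2) ^ q))))"
      by (simp only: expect_cmult expect_add expect_sum)
    also have "\<dots> \<le> c * (2 ^ q * (p ^ q * (c * (p * \<nu> + q * g) ^ q) + real q ^ q * (\<Sum>i\<in>N. (p * g + q * h) ^ q)))"
      using p by (intro mult_left_mono add_mono sum_mono bound1 bound2) (auto simp: c_def)
    also have "\<dots> = c * (2 ^ q * (c * (p * (p * \<nu> + q * g)) ^ q + c * (q * (p * g + q * h)) ^ q))"
      unfolding power_mult_distrib by (simp add: c_def mult_ac)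
    \<comment> \<open>\<open>X\<close> is built to dominate both p (p \<nu> + q g) and q (p g + q
      h).\<close>
    also have "\<dots> \<le> c * (2 ^ q * (c * X ^ q + c * X ^ q))"
      using p nonneg
      by (intro mult_left_mono add_mono power_mono)
        (auto simp: c_def X_def algebra_simps power2_eq_square intro!: add_nonneg_nonneg mult_nonneg_nonneg)
    also have "\<dots> = 2 * c\<^sup>2 * (2 * X) ^ q" by (simp add: power_mult_distrib power2_eq_square)
    finally show "expect T p (\<lambda>A. expect U p (F A)) \<le> 2 * (card N)\<^sup>2 * (2 * (p\<^sup>2 * \<nu> + p * q * g + (real q)\<^sup>2 * h)) ^ q"
      by (simp add: c_def X_def)
  qed
qed

text \<open>Jensen's inequality from the tangent at the mean m. After division by a power of m the
  tangent bound is Bernoulli's inequality, valid for every real argument because the exponent is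
  even; m = 0 is treated apart.\<close>

lemma expect_even_power_ge:
  assumes "finite N" "0 \<le> p" "p \<le> 1"
  shows "(expect N p f) ^ (2 * q) \<le> expect N p (\<lambda>S. f S ^ (2 * q))"
proof -
  define m where "m = expect N p f"
  have tangent: "m ^ (2 * q) + 2 * q * m ^ (2 * q - 1) * (y - m) \<le> y ^ (2 * q)" for y
  proof (cases "m = 0 \<or> q = 0")
    case True
    then show ?thesis by (cases "q = 0"; cases "q = 1"; auto simp: power_0_left)
  next
    case False
    have "1 + real (2 * q) * ((y - m) / m) \<le> (1 + (y - m) / m) ^ (2 * q)"
      by (rule Bernoulli_inequality_even) simp
    also have "1 + (y - m) / m = y / m" using False by (simp add: field_simps)
    finally have "m ^ (2 * q) * (1 + real (2 * q) * ((y - m) / m)) \<le> m ^ (2 * q) * (y / m) ^ (2 * q)"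
      by (intro mult_left_mono) auto
    moreover have "m ^ (2 * q) * (y / m) ^ (2 * q) = y ^ (2 * q)"
      using False by (simp add: power_divide)
    moreover have "m ^ (2 * q) = m * m ^ (2 * q - 1)" using False by (simp flip: power_Suc)
    moreover have "m * a * (1 + b * ((y - m) / m)) = m * a + b * a * (y - m)" for a b
      using False by (simp add: field_simps)
    ultimately show ?thesis by simp
  qed
  have "m ^ (2 * q) = expect N p (\<lambda>S. m ^ (2 * q) + 2 * q * m ^ (2 * q - 1) * (f S - m))"
    using assms(1) by (simp add: expect_add expect_cmult expect_diff expect_const flip: m_def)
  also have "\<dots> \<le> expect N p (\<lambda>S. f S ^ (2 * q))" by (intro expect_mono assms tangent)
  finally show ?thesis by (simp add: m_def)
qed

lemma expect_half_separated:
  assumes "finite N" "i \<in> N" "j \<in> N" "i \<noteq> j"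
  shows "expect N (1 / 2) (\<lambda>T. if i \<in> T then if j \<in> T then 0 else 1 else 0) = 1 / 4"
proof -
  have "expect N (1 / 2) (\<lambda>T. if i \<in> T then if j \<in> T then 0 else 1 else 0) =
      1 / 2 * expect N (1 / 2) (\<lambda>T. 1 - (if j \<in> T then 1 else 0))"
    using assms by (subst expect_member) (auto intro!: expect_cong)
  then show ?thesis using assms by (simp add: expect_diff expect_const expect_member)
qed

text \<open>Decoupling: over a uniformly random bipartition, the off-diagonal form is four times the average
  of its bipartite parts, and the two sides of a fixed bipartition are sampled independently.\<close>

lemma principal_form_tail:
  fixes H :: "'a \<Rightarrow> 'a \<Rightarrow> real" and p g h \<nu> :: real
  assumes N: "finite N" and p: "0 \<le> p" "p \<le> 1" and q: "q \<ge> 1" and t: "t > 0"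
    and sym: "\<And>i j. i \<in> N \<Longrightarrow> j \<in> N \<Longrightarrow> H i j = H j i"
    and diag: "\<And>i. i \<in> N \<Longrightarrow> H i i = 0"
    and op: "\<And>x. (\<Sum>i\<in>N. (inner_on N (H i) x)\<^sup>2) \<le> \<nu> * inner_on N x x"
    and row: "\<And>i. i \<in> N \<Longrightarrow> inner_on N (H i) (H i) \<le> g"
    and entry: "\<And>i j. i \<in> N \<Longrightarrow> j \<in> N \<Longrightarrow> (H i j)\<^sup>2 \<le> h"
    and nonneg: "\<nu> \<ge> 0" "g \<ge> 0" "h \<ge> 0"
  shows "expect N p (\<lambda>S. of_bool (\<exists>x. \<bar>\<Sum>i\<in>S. \<Sum>j\<in>S. H i j * x i * x j\<bar> > t * inner_on S x x)) \<le>
    2 * (card N)\<^sup>2 * (32 * (p\<^sup>2 * \<nu> + p * q * g + (real q)\<^sup>2 * h) / t\<^sup>2) ^ q"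
proof -
  define X where "X = p\<^sup>2 * \<nu> + p * q * g + (real q)\<^sup>2 * h"
  have "\<exists>F. (\<forall>A B. A \<subseteq> N \<longrightarrow> B \<subseteq> N \<longrightarrow> 0 \<le> F A B) \<and>
    (\<forall>A B x. A \<subseteq> N \<longrightarrow> B \<subseteq> N \<longrightarrow>
      (\<Sum>i\<in>A. \<Sum>j\<in>B. H i j * x i * x j) ^ (2 * q) \<le> (inner_on N x x) ^ (2 * q) * F A B) \<and>
    (\<forall>T U. T \<subseteq> N \<longrightarrow> U \<subseteq> N \<longrightarrow> expect T p (\<lambda>A. expect U p (F A)) \<le> 2 * (card N)\<^sup>2 * (2 * X) ^ q)"
    unfolding X_def by (rule bipartite_form_moment[OF N p q sym op row entry nonneg]) assumption+
  then obtain F where F': "\<forall>A B. A \<subseteq> N \<longrightarrow> B \<subseteq> N \<longrightarrow> 0 \<le> F A B"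
    "\<forall>A B x. A \<subseteq> N \<longrightarrow> B \<subseteq> N \<longrightarrow>
      (\<Sum>i\<in>A. \<Sum>j\<in>B. H i j * x i * x j) ^ (2 * q) \<le> (inner_on N x x) ^ (2 * q) * F A B"
    "\<forall>T U. T \<subseteq> N \<longrightarrow> U \<subseteq> N \<longrightarrow> expect T p (\<lambda>A. expect U p (F A)) \<le> 2 * (card N)\<^sup>2 * (2 * X) ^ q"
    by (elim exE conjE) (rule that)
  note F_nonneg = F'(1)[rule_format] and F = F'(2)[rule_format] and F_mean = F'(3)[rule_format]
  \<comment> \<open>Free of x: whichever x violates the bound for \<open>S\<close>, the same average
    over bipartitions controls it, so the supremum over x costs nothing.\<close>
  define E where "E S = expect N (1 / 2) (\<lambda>T. F (S \<inter> T) (S - T))" for S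
  have pointwise: "of_bool (\<exists>x. \<bar>\<Sum>i\<in>S. \<Sum>j\<in>S. H i j * x i * x j\<bar> > t * inner_on S x x) \<le> (16 / t\<^sup>2) ^ q * E S"
    if S: "S \<subseteq> N" for S
  proof -
    have finS: "finite S" using S N finite_subset by auto
    define b where "b x T = (\<Sum>i\<in>S \<inter> T. \<Sum>j\<in>S - T. H i j * x i * x j)" for x T
    have average: "expect N (1 / 2) (b x) = 1 / 4 * (\<Sum>i\<in>S. \<Sum>j\<in>S. H i j * x i * x j)" for x
    proof -
      have "b x T = (\<Sum>i\<in>S. \<Sum>j\<in>S. H i j * x i * x j * (if i \<in> T then if j \<in> T then 0 else 1 else 0))" for T
      proof -
        have "b x T = (\<Sum>i\<in>S \<inter> T. \<Sum>j\<in>S. H i j * x i * x j * (if j \<in> T then 0 else 1))"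
          unfolding b_def using finS by (intro sum.cong refl sum.mono_neutral_cong_left) auto
        also have "\<dots> = (\<Sum>i\<in>S. \<Sum>j\<in>S. H i j * x i * x j * (if i \<in> T then if j \<in> T then 0 else 1 else 0))"
          using finS by (intro sum.mono_neutral_cong_left) auto
        finally show ?thesis .
      qed
      then have "b x = (\<lambda>T. \<Sum>i\<in>S. \<Sum>j\<in>S. H i j * x i * x j * (if i \<in> T then if j \<in> T then 0 else 1 else 0))"
        by (rule ext)
      then have "expect N (1 / 2) (b x) = (\<Sum>i\<in>S. \<Sum>j\<in>S. H i j * x i * x j *
          expect N (1 / 2) (\<lambda>T. if i \<in> T then if j \<in> T then 0 else 1 else 0))"
        by (simp add: expect_sum expect_cmult)
      also have "\<dots> = (\<Sum>i\<in>S. \<Sum>j\<in>S. 1 / 4 * (H i j * x i * x j))"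
      proof (intro sum.cong refl)
        fix i j assume "i \<in> S" "j \<in> S"
        then show "H i j * x i * x j * expect N (1 / 2) (\<lambda>T. if i \<in> T then if j \<in> T then 0 else 1 else 0) =
            1 / 4 * (H i j * x i * x j)"
          using S diag[of i] expect_half_separated[OF N, of i j] by (cases "i = j") auto
      qed
      finally show ?thesis by (simp only: sum_distrib_left)
    qed
    have main: "(\<Sum>i\<in>S. \<Sum>j\<in>S. H i j * x i * x j) ^ (2 * q) \<le> 16 ^ q * ((inner_on N x x) ^ (2 * q) * E S)" for x
    proof -
      have "(1 / 4 * (\<Sum>i\<in>S. \<Sum>j\<in>S. H i j * x i * x j)) ^ (2 * q) \<le> expect N (1 / 2) (\<lambda>T. b x T ^ (2 * q))"
        unfolding average[symmetric] by (rule expect_even_power_ge) (use N in auto)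
      also have "\<dots> \<le> expect N (1 / 2) (\<lambda>T. (inner_on N x x) ^ (2 * q) * F (S \<inter> T) (S - T))"
        unfolding b_def by (intro expect_mono F) (use S in auto)
      also have "\<dots> = (inner_on N x x) ^ (2 * q) * E S" by (simp add: expect_cmult E_def)
      finally have "(\<Sum>i\<in>S. \<Sum>j\<in>S. H i j * x i * x j) ^ (2 * q) / 4 ^ (2 * q) \<le> (inner_on N x x) ^ (2 * q) * E S"
        by (simp add: power_divide)
      moreover have four: "(4 :: real) ^ (2 * q) = 16 ^ q" by (simp add: power_mult)
      ultimately show ?thesis unfolding four by (simp add: divide_le_eq mult.commute)
    qed
    have E_nonneg: "0 \<le> E S"
    proof -
      have "expect N (1 / 2) (\<lambda>_. 0) \<le> E S" unfolding E_def using S by (intro expect_mono F_nonneg) auto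
      then show ?thesis using N by (simp add: expect_const)
    qed
    show ?thesis
    proof (cases "\<exists>x. \<bar>\<Sum>i\<in>S. \<Sum>j\<in>S. H i j * x i * x j\<bar> > t * inner_on S x x")
      case False
      then show ?thesis using E_nonneg t by simp
    next
      case True
      then obtain x where x: "\<bar>\<Sum>i\<in>S. \<Sum>j\<in>S. H i j * x i * x j\<bar> > t * inner_on S x x" by blast
      \<comment> \<open>Cutting x off outside \<open>S\<close> leaves the form unchanged and makes
        its norm over \<open>N\<close> equal to its norm over \<open>S\<close>.\<close>
      define y where "y i = (if i \<in> S then x i else 0)" for i
      define Q where "Q = (\<Sum>i\<in>S. \<Sum>j\<in>S. H i j * y i * y j)"
      define Y where "Y = inner_on N y y"
      have "Y = inner_on S x x" unfolding Y_def inner_on_def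
        by (rule sum.mono_neutral_cong_right) (use S N in \<open>auto simp: y_def\<close>)
      moreover have "Q = (\<Sum>i\<in>S. \<Sum>j\<in>S. H i j * x i * x j)" by (simp add: Q_def y_def)
      ultimately have less: "t * Y < \<bar>Q\<bar>" using x by simp
      have Y0: "Y \<ge> 0" unfolding Y_def by (rule inner_on_self_nonneg)
      have "Y \<noteq> 0"
      proof
        assume "Y = 0"
        then have "\<forall>i\<in>N. y i = 0" by (simp add: Y_def inner_on_self_eq_0[OF N])
        then have "Q = 0" unfolding Q_def using S by (auto intro!: sum.neutral)
        then show False using less \<open>Y = 0\<close> by simp
      qed
      have "(t * Y) ^ (2 * q) \<le> \<bar>Q\<bar> ^ (2 * q)" using less t Y0 by (intro power_mono) auto
      also have "\<dots> = Q ^ (2 * q)" by (simp add: power_mult)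
      also have "\<dots> \<le> 16 ^ q * (Y ^ (2 * q) * E S)" using main[of y] by (simp add: Q_def Y_def)
      finally have "Y ^ (2 * q) * t ^ (2 * q) \<le> Y ^ (2 * q) * (16 ^ q * E S)"
        by (simp add: power_mult_distrib mult_ac)
      moreover have "Y ^ (2 * q) > 0" using Y0 \<open>Y \<noteq> 0\<close> by simp
      ultimately have "t ^ (2 * q) \<le> 16 ^ q * E S" by (rule mult_left_le_imp_le)
      then have "(t\<^sup>2) ^ q \<le> 16 ^ q * E S" by (simp only: power_mult)
      then have "1 \<le> (16 / t\<^sup>2) ^ q * E S" using t by (simp add: power_divide field_simps)
      then show ?thesis by simp
    qed
  qed
  have "expect N p E = expect N (1 / 2) (\<lambda>T. expect N p (\<lambda>S. F (S \<inter> T) (S - T)))"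
    unfolding E_def by (rule expect_swap)
  also have "\<dots> \<le> expect N (1 / 2) (\<lambda>_. 2 * (card N)\<^sup>2 * (2 * X) ^ q)"
  proof (intro expect_mono)
    fix T assume T: "T \<subseteq> N"
    have "expect (T \<union> (N - T)) p (\<lambda>S. F (S \<inter> T) (S - T)) =
        expect T p (\<lambda>A. expect (N - T) p (\<lambda>B. F ((A \<union> B) \<inter> T) ((A \<union> B) - T)))"
      using T N finite_subset by (intro expect_Un) auto
    also have "T \<union> (N - T) = N" using T by auto
    also have "expect T p (\<lambda>A. expect (N - T) p (\<lambda>B. F ((A \<union> B) \<inter> T) ((A \<union> B) - T))) =
        expect T p (\<lambda>A. expect (N - T) p (F A))"
    proof (intro expect_cong)
      fix A B assume "A \<subseteq> T" "B \<subseteq> N - T"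
      then have "(A \<union> B) \<inter> T = A" "(A \<union> B) - T = B" by auto
      then show "F ((A \<union> B) \<inter> T) ((A \<union> B) - T) = F A B" by simp
    qed
    also have "\<dots> \<le> 2 * (card N)\<^sup>2 * (2 * X) ^ q" using T by (intro F_mean) auto
    finally show "expect N p (\<lambda>S. F (S \<inter> T) (S - T)) \<le> 2 * (card N)\<^sup>2 * (2 * X) ^ q" .
  qed auto
  also have "\<dots> = 2 * (card N)\<^sup>2 * (2 * X) ^ q" using N by (rule expect_const)
  finally have expect_E: "expect N p E \<le> 2 * (card N)\<^sup>2 * (2 * X) ^ q" .
  have "expect N p (\<lambda>S. of_bool (\<exists>x. \<bar>\<Sum>i\<in>S. \<Sum>j\<in>S. H i j * x i * x j\<bar> > t * inner_on S x x)) \<le>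
      expect N p (\<lambda>S. (16 / t\<^sup>2) ^ q * E S)"
    by (intro expect_mono p pointwise)
  also have "\<dots> = (16 / t\<^sup>2) ^ q * expect N p E" by (rule expect_cmult)
  also have "\<dots> \<le> (16 / t\<^sup>2) ^ q * (2 * (card N)\<^sup>2 * (2 * X) ^ q)"
    using t by (intro mult_left_mono expect_E) auto
  also have "\<dots> = 2 * (card N)\<^sup>2 * ((16 / t\<^sup>2) ^ q * (2 * X) ^ q)" by (simp only: mult_ac)
  also have "(16 / t\<^sup>2) ^ q * (2 * X) ^ q = (32 * X / t\<^sup>2) ^ q"
    unfolding power_mult_distrib[symmetric] by simp
  finally show ?thesis by (simp add: X_def)
qed

section \<open>Sampling a symmetric matrix with bounded entries\<close>

lemma prob_random_index_set:
  assumes "0 \<le> p" "p \<le> 1"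
  shows "measure_pmf.prob (random_index_set n p) X = expect {..<n} p (\<lambda>S. of_bool (S \<in> X))"
proof -
  let ?N = "{..<n}" and ?M = "Pi_pmf {..<n} False (\<lambda>_. bernoulli_pmf p)"
  let ?f = "\<lambda>b. {i \<in> {..<n}. b i}"
  have pmf: "pmf (random_index_set n p) S = p ^ card S * (1 - p) ^ card (?N - S)" if S: "S \<subseteq> ?N" for S
  proof -
    \<comment> \<open>The default value of the product distribution makes every sampled function
      \<open>False\<close> outside \<open>?N\<close>, so a set has at most one preimage in the
      support.\<close>
    have supp: "b i = False" if "b \<in> set_pmf ?M" "i \<notin> ?N" for b i
      using set_Pi_pmf_subset[of ?N False "\<lambda>_. bernoulli_pmf p"] that by auto
    have eq: "?f -` {S} \<inter> set_pmf ?M = {\<lambda>i. i \<in> S} \<inter> set_pmf ?M"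
      using S supp by (auto simp: fun_eq_iff)
    have "pmf (random_index_set n p) S = measure_pmf.prob ?M (?f -` {S} \<inter> set_pmf ?M)"
      by (simp add: random_index_set_def pmf_map measure_Int_set_pmf)
    also have "\<dots> = pmf ?M (\<lambda>i. i \<in> S)"
      unfolding eq by (simp add: measure_Int_set_pmf measure_pmf_single)
    also have "\<dots> = (\<Prod>i\<in>?N. pmf (bernoulli_pmf p) (i \<in> S))"
      using S by (subst pmf_Pi) auto
    also have "\<dots> = (\<Prod>i\<in>S. p) * (\<Prod>i\<in>?N - S. 1 - p)"
      using S assms by (subst prod.subset_diff[OF S]) (auto simp: mult.commute intro!: prod.cong arg_cong2[of _ _ _ _ "(*)"])
    finally show ?thesis by simp
  qed
  have "set_pmf (random_index_set n p) \<subseteq> Pow ?N" by (auto simp: random_index_set_def)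
  then have "X \<inter> set_pmf (random_index_set n p) = (X \<inter> Pow ?N) \<inter> set_pmf (random_index_set n p)"
    by auto
  then have "measure_pmf.prob (random_index_set n p) X = measure_pmf.prob (random_index_set n p) (X \<inter> Pow ?N)"
    by (metis measure_Int_set_pmf)
  also have "\<dots> = (\<Sum>S\<in>X \<inter> Pow ?N. pmf (random_index_set n p) S)"
    by (rule measure_measure_pmf_finite) auto
  also have "\<dots> = (\<Sum>S\<in>Pow ?N. p ^ card S * (1 - p) ^ card (?N - S) * of_bool (S \<in> X))"
    by (rule sum.mono_neutral_cong_left) (auto simp: pmf)
  finally show ?thesis by (simp add: expect_def)
qed

locale bounded_spectral =
  fixes N :: "nat set" and a :: "nat \<Rightarrow> nat \<Rightarrow> real" and lam :: "nat \<Rightarrow> real"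
    and v :: "nat \<Rightarrow> nat \<Rightarrow> real" and n e \<tau> :: real and J :: "nat set"
  assumes spec: "spectral N a N lam v"
    and entries: "\<And>i j. i \<in> N \<Longrightarrow> j \<in> N \<Longrightarrow> \<bar>a i j\<bar> \<le> 1"
    and card_N: "real (card N) = n" and e: "e > 0" and \<tau>: "\<tau> > 0"
    and J_eq: "J = {j \<in> N. \<bar>lam j\<bar> \<ge> \<tau>}"
begin

lemma finite_N: "finite N" and finite_J: "finite J" and J_sub: "J \<subseteq> N"
  using spectral_finite[OF spec] by (auto simp: J_eq)

lemma n_nonneg: "n \<ge> 0"
  using card_N by (metis of_nat_0_le_iff)

lemma norm_combine:
  assumes "K \<subseteq> N"
  shows "inner_on N (combine_on K v y) (combine_on K v y) = (\<Sum>k\<in>K. (y k)\<^sup>2)"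
proof -
  have fin: "finite K" using assms finite_N finite_subset by auto
  have inner: "inner_on N (combine_on K v y) (v k) = y k" if "k \<in> K" for k
  proof -
    have "inner_on N (combine_on K v y) (v k) = (\<Sum>j\<in>K. if j = k then y j else 0)"
      by (subst inner_on_commute, subst inner_combine_on, intro sum.cong refl)
        (use that in \<open>auto simp: spectral_orthonormal[OF spec] subsetD[OF assms]\<close>)
    then show ?thesis using that fin by simp
  qed
  show ?thesis unfolding inner_combine_on[of N "combine_on K v y"]
    by (intro sum.cong refl) (simp add: inner power2_eq_square)
qed

text \<open>The numbers \<open>lam k * v k i\<close> are the coordinates of row i of A in the
  eigenbasis, and bounded entries limit its squared length to n. All incoherence comes from
  here.\<close>

lemma weighted_row_sum:
  assumes i: "i \<in> N"
  shows "(\<Sum>k\<in>N. (lam k * v k i)\<^sup>2) \<le> n"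
proof -
  have "(\<Sum>k\<in>N. (lam k * v k i)\<^sup>2) = inner_on N (combine_on N v (\<lambda>k. lam k * v k i)) (combine_on N v (\<lambda>k. lam k * v k i))"
    by (rule norm_combine[OF subset_refl, symmetric])
  also have "\<dots> = inner_on N (a i) (a i)"
    by (intro inner_on_cong) (use i spec in \<open>auto simp: combine_on_def spectral_def\<close>)
  also have "\<dots> \<le> (\<Sum>j\<in>N. 1)"
    unfolding inner_on_def
  proof (intro sum_mono)
    fix j assume "j \<in> N"
    then have "\<bar>a i j\<bar> * \<bar>a i j\<bar> \<le> 1" using entries[OF i] by (intro mult_le_one) auto
    then show "a i j * a i j \<le> 1" by (simp add: abs_mult_self_eq)
  qed
  finally show ?thesis by (simp add: card_N)
qed

lemma eigenvalue_le:
  assumes k: "k \<in> N"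
  shows "\<bar>lam k\<bar> \<le> n"
proof -
  have "(lam k)\<^sup>2 = (lam k)\<^sup>2 * inner_on N (v k) (v k)" using spectral_orthonormal[OF spec k k] by simp
  also have "\<dots> = (\<Sum>i\<in>N. (lam k * v k i)\<^sup>2)"
    by (simp add: inner_on_def sum_distrib_left power2_eq_square mult_ac)
  also have "\<dots> \<le> (\<Sum>i\<in>N. n)"
  proof (intro sum_mono)
    fix i assume "i \<in> N"
    have "(lam k * v k i)\<^sup>2 \<le> (\<Sum>k\<in>N. (lam k * v k i)\<^sup>2)"
      using k finite_N by (intro member_le_sum) auto
    then show "(lam k * v k i)\<^sup>2 \<le> n" using weighted_row_sum[OF \<open>i \<in> N\<close>] by linarith
  qed
  finally have "(lam k)\<^sup>2 \<le> n\<^sup>2" by (simp add: card_N power2_eq_square)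
  then show ?thesis using n_nonneg abs_le_square_iff[of "lam k" n] by simp
qed

text \<open>The row bound divided by the threshold, once for each summand of
  \<open>weight\<close>.\<close>

lemma incoherence:
  assumes i: "i \<in> N"
  shows "(\<Sum>j\<in>J. (v j i)\<^sup>2) \<le> n / \<tau>\<^sup>2" and "(\<Sum>j\<in>J. \<bar>lam j\<bar> * (v j i)\<^sup>2) \<le> n / \<tau>"
proof -
  have J_le: "(\<Sum>j\<in>J. (lam j * v j i)\<^sup>2) \<le> n"
    using sum_mono2[OF finite_N J_sub, of "\<lambda>j. (lam j * v j i)\<^sup>2"] weighted_row_sum[OF i] by simp
  have lam: "\<tau> \<le> \<bar>lam j\<bar>" if "j \<in> J" for j using that by (simp add: J_eq)
  have "(\<Sum>j\<in>J. \<tau>\<^sup>2 * (v j i)\<^sup>2) \<le> (\<Sum>j\<in>J. (lam j * v j i)\<^sup>2)"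
  proof (intro sum_mono)
    fix j assume "j \<in> J"
    then have "\<tau>\<^sup>2 \<le> (lam j)\<^sup>2" using lam[of j] \<tau> by (simp add: abs_le_square_iff[symmetric])
    then show "\<tau>\<^sup>2 * (v j i)\<^sup>2 \<le> (lam j * v j i)\<^sup>2" by (simp add: power_mult_distrib mult_right_mono)
  qed
  with J_le have "\<tau>\<^sup>2 * (\<Sum>j\<in>J. (v j i)\<^sup>2) \<le> n" by (simp add: sum_distrib_left)
  then show "(\<Sum>j\<in>J. (v j i)\<^sup>2) \<le> n / \<tau>\<^sup>2" using \<tau> by (simp add: field_simps)
  have "(\<Sum>j\<in>J. \<tau> * (\<bar>lam j\<bar> * (v j i)\<^sup>2)) \<le> (\<Sum>j\<in>J. (lam j * v j i)\<^sup>2)"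
  proof (intro sum_mono)
    fix j assume "j \<in> J"
    have "\<tau> * (\<bar>lam j\<bar> * (v j i)\<^sup>2) \<le> \<bar>lam j\<bar> * (\<bar>lam j\<bar> * (v j i)\<^sup>2)"
      using lam[OF \<open>j \<in> J\<close>] by (intro mult_right_mono) auto
    then show "\<tau> * (\<bar>lam j\<bar> * (v j i)\<^sup>2) \<le> (lam j * v j i)\<^sup>2"
      by (simp add: power2_eq_square mult_ac abs_mult_self_eq flip: mult.assoc[of "\<bar>lam j\<bar>" "\<bar>lam j\<bar>"])
  qed
  with J_le have "\<tau> * (\<Sum>j\<in>J. \<bar>lam j\<bar> * (v j i)\<^sup>2) \<le> n" by (simp add: sum_distrib_left)
  then show "(\<Sum>j\<in>J. \<bar>lam j\<bar> * (v j i)\<^sup>2) \<le> n / \<tau>" using \<tau> by (simp add: field_simps)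
qed

text \<open>The diagonal of \<Phi>. Its reciprocal serves as the relative error: the quotient
  \<open>\<bar>lam j\<bar> / e\<close> gives \<open>\<bar>lam j\<bar> / weight j \<le> e\<close>,
  and the summand 2 gives \<open>1 / weight j \<le> 1 / 2\<close>.\<close>

definition weight :: "nat \<Rightarrow> real" where
  "weight j = 2 + \<bar>lam j\<bar> / e"

lemma weight_ge: "weight j \<ge> 2"
  using e by (simp add: weight_def)

definition outliers_preserved :: "real \<Rightarrow> nat set \<Rightarrow> bool" where
  "outliers_preserved p S \<longleftrightarrow> (\<forall>y.
     p * (\<Sum>j\<in>J. (1 - 1 / weight j) * (y j)\<^sup>2) \<le> inner_on S (combine_on J v y) (combine_on J v y) \<and>
     inner_on S (combine_on J v y) (combine_on J v y) \<le> p * (\<Sum>j\<in>J. (1 + 1 / weight j) * (y j)\<^sup>2))"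

text \<open>Substituting \<open>y j = sqrt (weight j) * x j\<close> turns the weighted tolerance
  into the uniform one of \<open>gram_deviation\<close>. \<open>\<mu>\<close> bounds the weights
  because eigenvalues are at most n in magnitude, and \<open>R\<close> collects both incoherence
  bounds.\<close>

lemma outliers_preserved_prob:
  fixes p :: real
  assumes p: "0 < p" "p \<le> 1" and n: "n > 0"
  defines "\<mu> \<equiv> 2 + n / e" and "R \<equiv> 2 * (n / \<tau>\<^sup>2) + n / (e * \<tau>)"
  shows "expect N p (\<lambda>S. of_bool (\<not> outliers_preserved p S)) \<le> 3 * n * exp (- p / (8 * \<mu> * R))"
proof -
  define w where "w i j = sqrt (weight j) * v j i" for i j
  have w_pos: "weight j > 0" for j using weight_ge[of j] by linarith
  have inner_w: "inner_on J (w i) x = combine_on J v (\<lambda>j. sqrt (weight j) * x j) i" for i x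
    by (simp add: inner_on_def combine_on_def w_def mult_ac)
  have R0: "R > 0" using n e \<tau> by (simp add: R_def add_pos_pos)
  have bad: "of_bool (\<not> outliers_preserved p S) \<le> (of_bool (\<exists>x. (\<Sum>s\<in>S. (inner_on J (w s) x)\<^sup>2) < p * (\<Sum>j\<in>J. (weight j - 1) * (x j)\<^sup>2) \<or>
      (\<Sum>s\<in>S. (inner_on J (w s) x)\<^sup>2) > p * (\<Sum>j\<in>J. (weight j + 1) * (x j)\<^sup>2)) :: real)" for S
  proof (cases "outliers_preserved p S")
    case False
    then obtain y where y: "inner_on S (combine_on J v y) (combine_on J v y) < p * (\<Sum>j\<in>J. (1 - 1 / weight j) * (y j)\<^sup>2) \<or>
     inner_on S (combine_on J v y) (combine_on J v y) > p * (\<Sum>j\<in>J. (1 + 1 / weight j) * (y j)\<^sup>2)"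
      unfolding outliers_preserved_def by (meson not_le)
    define x where "x j = y j / sqrt (weight j)" for j
    have "sqrt (weight j) * x j = y j" for j using w_pos[of j] by (simp add: x_def)
    then have "inner_on J (w s) x = combine_on J v y s" for s by (simp add: inner_w)
    then have "(\<Sum>s\<in>S. (inner_on J (w s) x)\<^sup>2) = inner_on S (combine_on J v y) (combine_on J v y)"
      by (simp add: inner_on_def[of S] power2_eq_square)
    moreover have "(weight j + c) * (x j)\<^sup>2 = (1 + c / weight j) * (y j)\<^sup>2" for j c
      using w_pos[of j] by (simp add: x_def power_divide field_simps)
    from this[of _ 1] this[of _ "- 1"] have "(weight j - 1) * (x j)\<^sup>2 = (1 - 1 / weight j) * (y j)\<^sup>2"
      "(weight j + 1) * (x j)\<^sup>2 = (1 + 1 / weight j) * (y j)\<^sup>2" for j by simp_all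
    ultimately have "\<exists>x. (\<Sum>s\<in>S. (inner_on J (w s) x)\<^sup>2) < p * (\<Sum>j\<in>J. (weight j - 1) * (x j)\<^sup>2) \<or>
      (\<Sum>s\<in>S. (inner_on J (w s) x)\<^sup>2) > p * (\<Sum>j\<in>J. (weight j + 1) * (x j)\<^sup>2)"
      using y by (intro exI[of _ x]) simp
    then show ?thesis by simp
  qed simp
  have "expect N p (\<lambda>S. of_bool (\<not> outliers_preserved p S)) \<le> expect N p (\<lambda>S. of_bool (\<exists>x. (\<Sum>s\<in>S. (inner_on J (w s) x)\<^sup>2) < p * (\<Sum>j\<in>J. (weight j - 1) * (x j)\<^sup>2) \<or>
      (\<Sum>s\<in>S. (inner_on J (w s) x)\<^sup>2) > p * (\<Sum>j\<in>J. (weight j + 1) * (x j)\<^sup>2)))"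
    using p by (intro expect_mono bad) auto
  also have "\<dots> \<le> 3 * card J * exp (- p / (8 * \<mu> * R))"
  proof (rule gram_deviation[OF finite_N finite_J p R0])
    show "\<mu> \<ge> 1" using n e by (simp add: \<mu>_def)
    show "0 \<le> weight j" for j using w_pos[of j] by simp
    show "weight j \<le> \<mu>" if "j \<in> J" for j
      using eigenvalue_le[of j] that J_sub e by (auto simp: weight_def \<mu>_def divide_right_mono)
    show "(\<Sum>s\<in>N. (inner_on J (w s) x)\<^sup>2) = (\<Sum>j\<in>J. weight j * (x j)\<^sup>2)" for x
    proof -
      have "(\<Sum>s\<in>N. (inner_on J (w s) x)\<^sup>2) = (\<Sum>j\<in>J. (sqrt (weight j) * x j)\<^sup>2)"
        unfolding inner_w norm_combine[OF J_sub, symmetric] by (simp add: inner_on_def power2_eq_square)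
      also have "\<dots> = (\<Sum>j\<in>J. weight j * (x j)\<^sup>2)"
        using w_pos by (intro sum.cong refl) (simp add: power_mult_distrib less_imp_le)
      finally show ?thesis .
    qed
    show "inner_on J (w i) (w i) \<le> R" if i: "i \<in> N" for i
    proof -
      have "inner_on J (w i) (w i) = (\<Sum>j\<in>J. weight j * (v j i)\<^sup>2)"
        unfolding inner_on_def using w_pos
        by (intro sum.cong refl) (simp add: w_def power2_eq_square less_imp_le mult_ac flip: mult.assoc[of "sqrt _" "sqrt _"])
      also have "\<dots> = 2 * (\<Sum>j\<in>J. (v j i)\<^sup>2) + (\<Sum>j\<in>J. \<bar>lam j\<bar> * (v j i)\<^sup>2) / e"
        by (simp add: weight_def distrib_right sum.distrib sum_distrib_left sum_divide_distrib)
      also have "\<dots> \<le> 2 * (n / \<tau>\<^sup>2) + (n / \<tau>) / e"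
        using incoherence[OF i] e by (intro add_mono mult_left_mono divide_right_mono) auto
      finally show ?thesis by (simp add: R_def mult.commute)
    qed
  qed
  also have "\<dots> \<le> 3 * n * exp (- p / (8 * \<mu> * R))"
    using card_mono[OF finite_N J_sub] card_N by (intro mult_right_mono) auto
  finally show ?thesis .
qed

definition small_part_bounded :: "real \<Rightarrow> nat set \<Rightarrow> bool" where
  "small_part_bounded p S \<longleftrightarrow>
     (\<forall>x. \<bar>\<Sum>k\<in>N - J. lam k * (inner_on S (v k) x)\<^sup>2\<bar> \<le> p * e * inner_on S x x)"

text \<open>The tolerance p e is halved: diagonal entries of the small part are at most
  \<open>h\<close>, which \<open>h_le\<close> fits into one half, and the off-diagonal rest is left
  to \<open>principal_form_tail\<close>.\<close>

lemma small_part_bounded_prob: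
  fixes p :: real
  assumes p: "0 < p" "p \<le> 1" and q: "q \<ge> 1"
  defines "h \<equiv> 1 + n / \<tau>"
  assumes h_le: "h \<le> p * e / 2"
  shows "expect N p (\<lambda>S. of_bool (\<not> small_part_bounded p S)) \<le>
    2 * n\<^sup>2 * (32 * (p\<^sup>2 * (2 * \<tau>\<^sup>2 + 2 * h\<^sup>2) + p * q * n + (real q)\<^sup>2 * h\<^sup>2) / (p * e / 2)\<^sup>2) ^ q"
proof -
  define m where "m i j = (\<Sum>k\<in>N - J. lam k * v k i * v k j)" for i j
  define H where "H i j = (if i = j then 0 else m i j)" for i j
  have h0: "h > 0" using n_nonneg \<tau> by (simp add: h_def add_pos_nonneg)
  have m_sym: "m i j = m j i" for i j by (simp add: m_def mult_ac)
  \<comment> \<open>The small part need not inherit the entry bound 1. Its entries are those of A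
    minus those of the outlying part, and the latter are at most n / \<tau> by
    \<open>\<bar>lam k\<bar> \<ge> \<tau>\<close>, the arithmetic-geometric mean inequality and the
    row bound.\<close>
  have m_entry: "\<bar>m i j\<bar> \<le> h" if ij: "i \<in> N" "j \<in> N" for i j
  proof -
    have split: "a i j = m i j + (\<Sum>k\<in>J. lam k * v k i * v k j)"
      using spec ij sum.subset_diff[OF J_sub finite_N, of "\<lambda>k. lam k * v k i * v k j"]
      by (simp add: spectral_def m_def)
    have "\<tau> * \<bar>\<Sum>k\<in>J. lam k * v k i * v k j\<bar> \<le> \<tau> * (\<Sum>k\<in>J. \<bar>lam k * v k i * v k j\<bar>)"
      using \<tau> by (intro mult_left_mono) auto
    also have "\<dots> \<le> (\<Sum>k\<in>J. ((lam k * v k i)\<^sup>2 + (lam k * v k j)\<^sup>2) / 2)"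
      unfolding sum_distrib_left
    proof (intro sum_mono)
      fix k assume "k \<in> J"
      then have "\<tau> * \<bar>lam k * v k i * v k j\<bar> \<le> \<bar>lam k\<bar> * \<bar>lam k * v k i * v k j\<bar>"
        by (intro mult_right_mono) (auto simp: J_eq)
      also have "\<dots> = \<bar>lam k * v k i\<bar> * \<bar>lam k * v k j\<bar>" by (simp add: abs_mult mult_ac)
      also have "\<dots> \<le> ((lam k * v k i)\<^sup>2 + (lam k * v k j)\<^sup>2) / 2"
        using sum_squares_bound[of "\<bar>lam k * v k i\<bar>" "\<bar>lam k * v k j\<bar>"] by simp
      finally show "\<tau> * \<bar>lam k * v k i * v k j\<bar> \<le> ((lam k * v k i)\<^sup>2 + (lam k * v k j)\<^sup>2) / 2" .
    qed
    also have "\<dots> \<le> (\<Sum>k\<in>N. ((lam k * v k i)\<^sup>2 + (lam k * v k j)\<^sup>2) / 2)"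
      by (intro sum_mono2 finite_N J_sub) auto
    also have "\<dots> = ((\<Sum>k\<in>N. (lam k * v k i)\<^sup>2) + (\<Sum>k\<in>N. (lam k * v k j)\<^sup>2)) / 2"
      by (simp add: sum.distrib sum_divide_distrib add_divide_distrib)
    also have "\<dots> \<le> n" using weighted_row_sum[OF ij(1)] weighted_row_sum[OF ij(2)] by simp
    finally have "\<bar>\<Sum>k\<in>J. lam k * v k i * v k j\<bar> \<le> n / \<tau>" using \<tau> by (simp add: field_simps)
    then show ?thesis using split entries[OF ij] by (simp add: h_def)
  qed
  have m_row: "inner_on N (m i) (m i) \<le> n" if i: "i \<in> N" for i
  proof -
    have "m i = combine_on (N - J) v (\<lambda>k. lam k * v k i)"
      by (auto simp: m_def combine_on_def fun_eq_iff)
    then have "inner_on N (m i) (m i) = (\<Sum>k\<in>N - J. (lam k * v k i)\<^sup>2)" by (simp add: norm_combine)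
    also have "\<dots> \<le> (\<Sum>k\<in>N. (lam k * v k i)\<^sup>2)" using finite_N by (intro sum_mono2) auto
    finally show ?thesis using weighted_row_sum[OF i] by linarith
  qed
  have m_op: "(\<Sum>i\<in>N. (inner_on N (m i) x)\<^sup>2) \<le> \<tau>\<^sup>2 * inner_on N x x" for x
  proof -
    define c where "c k = lam k * inner_on N (v k) x" for k
    have "inner_on N (m i) x = combine_on (N - J) v c i" for i
      unfolding inner_on_def m_def combine_on_def c_def sum_distrib_right sum_distrib_left
      by (subst sum.swap) (simp add: mult_ac)
    then have "(\<Sum>i\<in>N. (inner_on N (m i) x)\<^sup>2) = inner_on N (combine_on (N - J) v c) (combine_on (N - J) v c)"
      by (simp add: inner_on_def[of N "combine_on _ _ _"] power2_eq_square)
    also have "\<dots> = (\<Sum>k\<in>N - J. (c k)\<^sup>2)" by (rule norm_combine) auto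
    also have "\<dots> \<le> (\<Sum>k\<in>N - J. \<tau>\<^sup>2 * (inner_on N (v k) x)\<^sup>2)"
    proof (intro sum_mono)
      fix k assume "k \<in> N - J"
      then have "\<bar>lam k\<bar> \<le> \<bar>\<tau>\<bar>" using \<tau> by (auto simp: J_eq)
      then have "(lam k)\<^sup>2 \<le> \<tau>\<^sup>2" by (simp add: abs_le_square_iff)
      then show "(c k)\<^sup>2 \<le> \<tau>\<^sup>2 * (inner_on N (v k) x)\<^sup>2"
        by (simp add: c_def power_mult_distrib mult_right_mono)
    qed
    also have "\<dots> \<le> (\<Sum>k\<in>N. \<tau>\<^sup>2 * (inner_on N (v k) x)\<^sup>2)" using finite_N by (intro sum_mono2) auto
    also have "\<dots> = \<tau>\<^sup>2 * inner_on N x x"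
      by (simp add: spectral_Parseval[OF spec, of x x] sum_distrib_left power2_eq_square)
    finally show ?thesis .
  qed
  have inner_H: "inner_on N (H i) x = inner_on N (m i) x - m i i * x i" if i: "i \<in> N" for i x
  proof -
    have "inner_on N (m i) x = m i i * x i + (\<Sum>j\<in>N - {i}. m i j * x j)"
      unfolding inner_on_def using i finite_N by (simp add: sum.remove)
    moreover have "inner_on N (H i) x = (\<Sum>j\<in>N - {i}. m i j * x j)"
      unfolding inner_on_def by (rule sum.mono_neutral_cong_right) (use finite_N in \<open>auto simp: H_def\<close>)
    ultimately show ?thesis by simp
  qed
  have tail: "expect N p (\<lambda>S. of_bool (\<exists>x. \<bar>\<Sum>i\<in>S. \<Sum>j\<in>S. H i j * x i * x j\<bar> > p * e / 2 * inner_on S x x)) \<le>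
    2 * (card N)\<^sup>2 * (32 * (p\<^sup>2 * (2 * \<tau>\<^sup>2 + 2 * h\<^sup>2) + p * q * n + (real q)\<^sup>2 * h\<^sup>2) / (p * e / 2)\<^sup>2) ^ q"
  proof (rule principal_form_tail[OF finite_N _ _ q])
    show "H i j = H j i" for i j using m_sym by (simp add: H_def)
    show "(\<Sum>i\<in>N. (inner_on N (H i) x)\<^sup>2) \<le> (2 * \<tau>\<^sup>2 + 2 * h\<^sup>2) * inner_on N x x" for x
    proof -
      \<comment> \<open>Deleting the diagonal changes each row product by m_ii x_i, and (a - b)^2
        \<le> 2 a^2 + 2 b^2 explains the operator bound 2 \<tau>^2 + 2 h^2.\<close>
      have "(\<Sum>i\<in>N. (inner_on N (H i) x)\<^sup>2) \<le> (\<Sum>i\<in>N. 2 * (inner_on N (m i) x)\<^sup>2 + 2 * (h\<^sup>2 * (x i * x i)))"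
      proof (intro sum_mono)
        fix i assume i: "i \<in> N"
        have "(inner_on N (H i) x)\<^sup>2 \<le> 2 * (inner_on N (m i) x)\<^sup>2 + 2 * (m i i * x i)\<^sup>2"
          using sum_squares_bound[of "inner_on N (m i) x" "- (m i i * x i)"]
          by (simp add: inner_H[OF i] power2_diff)
        also have "(m i i * x i)\<^sup>2 \<le> h\<^sup>2 * (x i * x i)"
        proof -
          have "(m i i)\<^sup>2 \<le> h\<^sup>2" using m_entry[OF i i] h0 by (simp add: abs_le_square_iff[symmetric])
          then show ?thesis by (simp add: power_mult_distrib mult_right_mono flip: power2_eq_square)
        qed
        finally show "(inner_on N (H i) x)\<^sup>2 \<le> 2 * (inner_on N (m i) x)\<^sup>2 + 2 * (h\<^sup>2 * (x i * x i))" by simp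
      qed
      also have "\<dots> = 2 * (\<Sum>i\<in>N. (inner_on N (m i) x)\<^sup>2) + 2 * (h\<^sup>2 * inner_on N x x)"
        by (simp add: sum.distrib sum_distrib_left inner_on_def[of N x x])
      also have "\<dots> \<le> 2 * (\<tau>\<^sup>2 * inner_on N x x) + 2 * (h\<^sup>2 * inner_on N x x)" using m_op[of x] by simp
      finally show ?thesis by (simp add: algebra_simps)
    qed
    show "inner_on N (H i) (H i) \<le> n" if "i \<in> N" for i
    proof -
      have "inner_on N (H i) (H i) \<le> inner_on N (m i) (m i)"
        unfolding inner_on_def by (intro sum_mono) (auto simp: H_def)
      then show ?thesis using m_row[OF that] by linarith
    qed
    show "(H i j)\<^sup>2 \<le> h\<^sup>2" if "i \<in> N" "j \<in> N" for i j
      using m_entry[OF that] h0 by (auto simp: H_def abs_le_square_iff[symmetric])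
  qed (use p e n_nonneg in \<open>auto simp: H_def\<close>)
  have "expect N p (\<lambda>S. of_bool (\<not> small_part_bounded p S)) \<le>
      expect N p (\<lambda>S. of_bool (\<exists>x. \<bar>\<Sum>i\<in>S. \<Sum>j\<in>S. H i j * x i * x j\<bar> > p * e / 2 * inner_on S x x))"
  proof (intro expect_mono)
    fix S assume S: "S \<subseteq> N"
    have finS: "finite S" using S finite_N finite_subset by auto
    have "small_part_bounded p S" if le: "\<And>x. \<bar>\<Sum>i\<in>S. \<Sum>j\<in>S. H i j * x i * x j\<bar> \<le> p * e / 2 * inner_on S x x"
      unfolding small_part_bounded_def
    proof
      fix x
      have "(\<Sum>k\<in>N - J. lam k * (inner_on S (v k) x)\<^sup>2) = inner_on S x (apply_on S m x)"
        by (subst inner_apply_rank_one_sum[where K = "N - J" and z = lam and u = v])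
          (simp_all add: m_def power2_eq_square mult_ac)
      also have "\<dots> = (\<Sum>i\<in>S. \<Sum>j\<in>S. H i j * x i * x j + (if i = j then m i i * x i * x i else 0))"
        unfolding inner_on_def apply_on_def sum_distrib_left
        by (intro sum.cong refl) (auto simp: H_def)
      also have "\<dots> = (\<Sum>i\<in>S. \<Sum>j\<in>S. H i j * x i * x j) + (\<Sum>i\<in>S. m i i * x i * x i)"
        using finS by (simp add: sum.distrib)
      finally have eq: "(\<Sum>k\<in>N - J. lam k * (inner_on S (v k) x)\<^sup>2) = \<dots>" .
      have "\<bar>\<Sum>i\<in>S. m i i * x i * x i\<bar> \<le> (\<Sum>i\<in>S. \<bar>m i i * x i * x i\<bar>)" by (rule sum_abs)
      also have "\<dots> \<le> (\<Sum>i\<in>S. p * e / 2 * (x i * x i))"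
      proof (intro sum_mono)
        fix i assume "i \<in> S"
        then have "\<bar>m i i\<bar> \<le> p * e / 2" using m_entry[of i i] S h_le by auto
        then have "\<bar>m i i\<bar> * (x i * x i) \<le> p * e / 2 * (x i * x i)" by (intro mult_right_mono) auto
        then show "\<bar>m i i * x i * x i\<bar> \<le> p * e / 2 * (x i * x i)" by (simp add: abs_mult mult.assoc abs_mult_self_eq)
      qed
      also have "\<dots> = p * e / 2 * inner_on S x x" by (simp add: inner_on_def sum_distrib_left)
      finally show "\<bar>\<Sum>k\<in>N - J. lam k * (inner_on S (v k) x)\<^sup>2\<bar> \<le> p * e * inner_on S x x"
        using le[of x] unfolding eq by simp
    qed
    then have "\<not> small_part_bounded p S \<Longrightarrow>
        \<exists>x. \<bar>\<Sum>i\<in>S. \<Sum>j\<in>S. H i j * x i * x j\<bar> > p * e / 2 * inner_on S x x"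
      by (meson not_le)
    then show "of_bool (\<not> small_part_bounded p S) \<le>
      (of_bool (\<exists>x. \<bar>\<Sum>i\<in>S. \<Sum>j\<in>S. H i j * x i * x j\<bar> > p * e / 2 * inner_on S x x) :: real)"
      by (cases "small_part_bounded p S") simp_all
  qed (use p in auto)
  also note tail
  finally show ?thesis by (simp add: card_N)
qed

end

section \<open>Choice of constants\<close>

text \<open>Both factors are at least 1 by the truncation in \<open>log_ge1\<close>, so the product
  dominates each logarithm that the failure probability calls for; \<epsilon> < 1 passes from
  1/\<delta> to 1/(\<epsilon> \<delta>).\<close>

lemma log_product_ge:
  fixes \<epsilon> \<delta> :: real
  assumes "0 < \<epsilon>" "\<epsilon> < 1" "0 < \<delta>" "\<delta> < 1" "n \<ge> 1"
  defines "\<Lambda> \<equiv> log_ge1 (1 / (\<epsilon> * \<delta>)) * (log_ge1 n) ^ 3"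
  shows "\<Lambda> \<ge> 1" "\<Lambda> \<ge> ln n" "\<Lambda> \<ge> ln (1 / \<delta>)"
proof -
  define x y where "x = log_ge1 (1 / (\<epsilon> * \<delta>))" and "y = log_ge1 n"
  have x: "x \<ge> 1" "x \<ge> ln (1 / (\<epsilon> * \<delta>))" and y: "y \<ge> 1" "y \<ge> ln n"
    by (simp_all add: x_def y_def log_ge1_def)
  have y3: "y \<le> y ^ 3" using y power_increasing[of 1 3 y] by simp
  have \<Lambda>: "\<Lambda> = x * y ^ 3" by (simp add: \<Lambda>_def x_def y_def)
  have "1 * y ^ 3 \<le> \<Lambda>" unfolding \<Lambda> using x y by (intro mult_right_mono) auto
  then show "\<Lambda> \<ge> 1" "\<Lambda> \<ge> ln n" using y y3 by auto
  have "1 / \<delta> \<le> 1 / (\<epsilon> * \<delta>)" using assms by (simp add: field_simps)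
  then have "ln (1 / \<delta>) \<le> ln (1 / (\<epsilon> * \<delta>))" using assms by (subst ln_le_cancel_iff) auto
  also have "\<dots> \<le> x * 1" using x by simp
  also have "\<dots> \<le> \<Lambda>" unfolding \<Lambda> using x y y3 by (intro mult_left_mono) auto
  finally show "\<Lambda> \<ge> ln (1 / \<delta>)" .
qed

text \<open>With E = exp (- \<Lambda>), the six powers are spent as follows: up to two cancel the
  power of n, one yields \<delta>, and the rest, by E \<le> 1/2, beat the numerical
  constants.\<close>

lemma failure_bounds:
  fixes n \<delta> \<Lambda> :: real
  assumes "n \<ge> 1" "0 < \<delta>" and \<Lambda>: "\<Lambda> \<ge> 1" "\<Lambda> \<ge> ln n" "\<Lambda> \<ge> ln (1 / \<delta>)"
  shows "3 * n * exp (- (6 * \<Lambda>)) + 2 * n\<^sup>2 * exp (- (6 * \<Lambda>)) \<le> \<delta>"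
proof -
  define E where "E = exp (- \<Lambda>)"
  have E0: "E > 0" by (simp add: E_def)
  have En: "n * E \<le> 1"
  proof -
    have "E \<le> exp (- ln n)" using \<Lambda> by (simp add: E_def)
    also have "\<dots> = 1 / n" using assms by (simp add: exp_minus field_simps)
    finally show ?thesis using assms by (simp add: field_simps)
  qed
  have E\<delta>: "E \<le> \<delta>"
  proof -
    have "E \<le> exp (- ln (1 / \<delta>))" using \<Lambda> by (simp add: E_def)
    also have "\<dots> = \<delta>" using assms by (simp add: ln_div)
    finally show ?thesis .
  qed
  have E2: "E \<le> 1 / 2"
  proof -
    have "E \<le> exp (- 1)" using \<Lambda> by (simp add: E_def)
    also have "\<dots> \<le> 1 / 2" using exp_ge_add_one_self[of 1] by (simp add: exp_minus field_simps)
    finally show ?thesis .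
  qed
  have E6: "exp (- (6 * \<Lambda>)) = E ^ 6" by (simp add: E_def exp_of_nat_mult[symmetric])
  have "E ^ 3 \<le> (1 / 2) ^ 3" "E ^ 4 \<le> (1 / 2) ^ 4" using E0 E2 by (intro power_mono; simp)+
  then have E34: "E ^ 3 \<le> 1 / 8" "E ^ 4 \<le> 1 / 16" by (simp_all add: power_divide)
  have nE: "n * E \<ge> 0" using assms E0 by simp
  have split: "E ^ 6 = E * (E * E ^ 4)" "E ^ 6 = E * (E * (E * E ^ 3))" by (simp_all flip: power_Suc)
  have "3 * n * E ^ 6 = 3 * ((n * E) * (E * E ^ 4))" unfolding split(1) by (simp only: mult_ac)
  also have "\<dots> \<le> 3 * (1 * (\<delta> * (1 / 16)))"
    using En E\<delta> E34 E0 nE assms by (intro mult_left_mono mult_mono) auto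
  finally have 1: "3 * n * E ^ 6 \<le> 3 * \<delta> / 16" by simp
  have "2 * n\<^sup>2 * E ^ 6 = 2 * (((n * E) * (n * E)) * (E * E ^ 3))"
    unfolding split(2) by (simp only: power2_eq_square mult_ac)
  also have "\<dots> \<le> 2 * ((1 * 1) * (\<delta> * (1 / 8)))"
    using En E\<delta> E34 E0 nE assms by (intro mult_left_mono mult_mono) auto
  finally have 2: "2 * n\<^sup>2 * E ^ 6 \<le> \<delta> / 4" by simp
  show ?thesis unfolding E6 using 1 2 assms by linarith
qed

text \<open>This fixes the absolute constant: the denominator is at most 8 * (6/\<epsilon>) *
  (101248/(\<epsilon>^2 n)) = 4859904/(\<epsilon>^3 n), where 101248 = 2 * 224^2 + 56 * 16, and six
  times 4859904 is just below 30000000.\<close>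

lemma outlier_exponent:
  fixes n s \<epsilon> \<Lambda> :: real
  assumes "n > 0" "0 < \<epsilon>" "\<epsilon> < 1" "\<Lambda> \<ge> 1" and s: "s \<ge> 30000000 * \<Lambda> / \<epsilon> ^ 3"
  defines "e \<equiv> \<epsilon> * n / 4"
  defines "\<tau> \<equiv> e / 56"
  shows "6 * \<Lambda> \<le> (s / n) / (8 * (2 + n / e) * (2 * (n / \<tau>\<^sup>2) + n / (e * \<tau>)))"
proof -
  have ne: "n / e = 4 / \<epsilon>" using assms by (simp add: e_def)
  have "n / \<tau>\<^sup>2 = 50176 / (\<epsilon>\<^sup>2 * n)" "n / (e * \<tau>) = 896 / (\<epsilon>\<^sup>2 * n)"
    using assms by (simp_all add: \<tau>_def e_def power2_eq_square field_simps)
  then have R: "2 * (n / \<tau>\<^sup>2) + n / (e * \<tau>) = 101248 / (\<epsilon>\<^sup>2 * n)" by (simp add: add_divide_distrib[symmetric])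
  have "2 \<le> 2 / \<epsilon>" using assms by (simp add: field_simps)
  then have \<mu>: "2 + n / e \<le> 6 / \<epsilon>" unfolding ne by (simp add: add_divide_distrib[symmetric])
  have pos: "0 < 8 * (2 + n / e) * (2 * (n / \<tau>\<^sup>2) + n / (e * \<tau>))"
    unfolding R ne using assms by (intro mult_pos_pos add_pos_pos divide_pos_pos) auto
  have "8 * (2 + n / e) * (2 * (n / \<tau>\<^sup>2) + n / (e * \<tau>)) \<le> 8 * (6 / \<epsilon>) * (101248 / (\<epsilon>\<^sup>2 * n))"
    unfolding R using \<mu> assms by (intro mult_right_mono mult_left_mono) auto
  also have "\<dots> = 4859904 / (\<epsilon> ^ 3 * n)" by (simp add: power3_eq_cube power2_eq_square)
  finally have le: "8 * (2 + n / e) * (2 * (n / \<tau>\<^sup>2) + n / (e * \<tau>)) \<le> 4859904 / (\<epsilon> ^ 3 * n)" .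
  have "6 * \<Lambda> * (8 * (2 + n / e) * (2 * (n / \<tau>\<^sup>2) + n / (e * \<tau>))) \<le> 6 * \<Lambda> * (4859904 / (\<epsilon> ^ 3 * n))"
    using assms by (intro mult_left_mono le) auto
  also have "\<dots> = (29159424 * \<Lambda> / \<epsilon> ^ 3) / n" by simp
  also have "\<dots> \<le> (30000000 * \<Lambda> / \<epsilon> ^ 3) / n" using assms by (intro divide_right_mono) auto
  also have "\<dots> \<le> s / n" using s assms by (intro divide_right_mono) auto
  finally show ?thesis using pos by (simp only: pos_le_divide_eq)
qed

text \<open>Everything is measured against B = \<epsilon> s, for which the tolerance p e / 2 is B/8
  and p \<tau> is B/224. The terms add up to at most a third of the squared tolerance, and 1/3 \<le>
  exp (-1) turns the q-th power into exp (-q).\<close>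

lemma middle_constants:
  fixes n s \<epsilon> \<Lambda> e \<tau> p h :: real and q :: nat
  assumes n: "n > 0" and \<epsilon>: "0 < \<epsilon>" "\<epsilon> < 1" and \<Lambda>: "\<Lambda> \<ge> 1"
    and s: "s \<ge> 30000000 * \<Lambda> / \<epsilon> ^ 3" "s \<le> n" and q: "6 * \<Lambda> \<le> q" "q \<le> 7 * \<Lambda>"
  defines "e \<equiv> \<epsilon> * n / 4"
  defines "\<tau> \<equiv> e / 56" and "p \<equiv> s / n"
  defines "h \<equiv> 1 + n / \<tau>"
  shows "h \<le> p * e / 2"
    and "(32 * (p\<^sup>2 * (2 * \<tau>\<^sup>2 + 2 * h\<^sup>2) + p * q * n + (real q)\<^sup>2 * h\<^sup>2) / (p * e / 2)\<^sup>2) ^ q \<le> exp (- (6 * \<Lambda>))"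
proof -
  define B where "B = \<epsilon> * s"
  have s0: "s > 0" using s(1) \<Lambda> \<epsilon> by (smt (verit) divide_pos_pos mult_pos_pos zero_less_power)
  have B0: "B > 0" using \<epsilon> s0 by (simp add: B_def)
  have pe: "p * e / 2 = B / 8" using n by (simp add: p_def e_def B_def)
  have p: "0 \<le> p" "p \<le> 1" using s s0 n by (auto simp: p_def)
  have "30000000 * \<Lambda> \<le> \<epsilon> ^ 3 * s" using s(1) \<epsilon> by (simp add: field_simps)
  also have "\<dots> = \<epsilon> * (\<epsilon> * B)" by (simp add: B_def power3_eq_cube)
  also have "\<dots> \<le> 1 * (\<epsilon> * B)" using \<epsilon> B0 by (intro mult_right_mono) auto
  finally have eB: "30000000 * \<Lambda> \<le> \<epsilon> * B" by simp
  have "h = 1 + 224 / \<epsilon>" using n \<epsilon> by (simp add: h_def \<tau>_def e_def)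
  also have "\<dots> \<le> 225 / \<epsilon>" using \<epsilon> by (simp add: field_simps)
  finally have "h * \<epsilon> \<le> 225" using \<epsilon> by (simp add: field_simps)
  have h0: "h \<ge> 0" using n \<epsilon> by (simp add: h_def \<tau>_def e_def)
  have "h * (30000000 * \<Lambda>) \<le> h * (\<epsilon> * B)" by (intro mult_left_mono eB h0)
  also have "\<dots> = (h * \<epsilon>) * B" by simp
  also have "\<dots> \<le> 225 * B" using B0 \<open>h * \<epsilon> \<le> 225\<close> by (intro mult_right_mono) auto
  finally have "h * (30000000 * \<Lambda>) \<le> 225 * B" .
  moreover have "h * (30000000 * \<Lambda>) = 30000000 * (h * \<Lambda>)" by simp
  ultimately have h\<Lambda>: "h * \<Lambda> \<le> B / 100000" using B0 by linarith
  have hB: "h \<le> B / 100000" using h\<Lambda> mult_left_mono[OF \<Lambda> h0] by simp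
  then show "h \<le> p * e / 2" unfolding pe using B0 by simp
  have qh: "q * h \<le> B / 10000"
  proof -
    have "q * h \<le> 7 * \<Lambda> * h" using q h0 by (intro mult_right_mono) auto
    also have "\<dots> = 7 * (h * \<Lambda>)" by simp
    also have "\<dots> \<le> 7 * (B / 100000)" using h\<Lambda> by (intro mult_left_mono) auto
    finally show ?thesis using B0 by simp
  qed
  have p\<tau>: "p\<^sup>2 * \<tau>\<^sup>2 = B\<^sup>2 / 50176"
  proof -
    have "p * \<tau> = B / 224" using n by (simp add: p_def \<tau>_def e_def B_def)
    then have "(p * \<tau>)\<^sup>2 = (B / 224)\<^sup>2" by (rule arg_cong)
    also have "\<dots> = B\<^sup>2 / 50176" by (simp add: power_divide)
    finally show ?thesis by (simp add: power_mult_distrib)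
  qed
  have ph: "p\<^sup>2 * h\<^sup>2 \<le> B\<^sup>2 / 1000000"
  proof -
    have "p * h \<le> 1 * (B / 1000)" using hB p h0 B0 by (intro mult_mono) auto
    then have "(p * h)\<^sup>2 \<le> (B / 1000)\<^sup>2" using p h0 by (intro power_mono) auto
    then show ?thesis by (simp add: power_mult_distrib power_divide)
  qed
  have pqn: "p * q * n \<le> B\<^sup>2 / 1000000"
  proof -
    have "p * q * n = q * s" using n by (simp add: p_def)
    also have "\<dots> \<le> 7 * \<Lambda> * s" using q s0 by (intro mult_right_mono) auto
    also have "\<dots> \<le> (\<epsilon> * B / 1000000) * s" using eB \<Lambda> s0 by (intro mult_right_mono) auto
    also have "\<dots> = B\<^sup>2 / 1000000" by (simp add: B_def power2_eq_square)
    finally show ?thesis .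
  qed
  have qh2: "(real q)\<^sup>2 * h\<^sup>2 \<le> B\<^sup>2 / 1000000"
  proof -
    have "(q * h)\<^sup>2 \<le> (B / 1000)\<^sup>2" using qh h0 B0 by (intro power_mono) auto
    then show ?thesis by (simp add: power_mult_distrib power_divide)
  qed
  define Y where "Y = 32 * (p\<^sup>2 * (2 * \<tau>\<^sup>2 + 2 * h\<^sup>2) + p * q * n + (real q)\<^sup>2 * h\<^sup>2)"
  have Y0: "Y \<ge> 0" unfolding Y_def using p n by (intro mult_nonneg_nonneg add_nonneg_nonneg) auto
  have "Y = 32 * (2 * (p\<^sup>2 * \<tau>\<^sup>2) + 2 * (p\<^sup>2 * h\<^sup>2) + p * q * n + (real q)\<^sup>2 * h\<^sup>2)"
    by (simp add: Y_def algebra_simps)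
  also have "\<dots> \<le> 32 * (2 * (B\<^sup>2 / 50176) + 2 * (B\<^sup>2 / 1000000) + B\<^sup>2 / 1000000 + B\<^sup>2 / 1000000)"
    unfolding p\<tau> by (intro mult_left_mono add_mono order_refl ph pqn qh2) auto
  also have "\<dots> \<le> (1 / 3) * (B / 8)\<^sup>2"
    using zero_le_power2[of B] by (simp add: power_divide)
  finally have "Y / (p * e / 2)\<^sup>2 \<le> 1 / 3"
    unfolding pe using B0 by (simp add: divide_le_eq)
  also have "\<dots> \<le> exp (- 1)" using exp_le by (simp add: exp_minus field_simps)
  finally have "(Y / (p * e / 2)\<^sup>2) ^ q \<le> exp (- 1) ^ q" using Y0 by (intro power_mono) auto
  also have "\<dots> = exp (- real q)" by (simp add: exp_of_nat_mult[symmetric])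
  also have "\<dots> \<le> exp (- (6 * \<Lambda>))" using q by simp
  finally show "(32 * (p\<^sup>2 * (2 * \<tau>\<^sup>2 + 2 * h\<^sup>2) + p * q * n + (real q)\<^sup>2 * h\<^sup>2) / (p * e / 2)\<^sup>2) ^ q \<le> exp (- (6 * \<Lambda>))"
    by (simp add: Y_def)
qed

lemma abs_entry_le_max_entry_norm:
  assumes "A \<in> carrier_mat n n" "i < n" "j < n"
  shows "\<bar>A $$ (i, j)\<bar> \<le> max_entry_norm A"
proof -
  have eq: "elements_mat A = (\<lambda>(i, j). A $$ (i, j)) ` ({..<n} \<times> {..<n})"
    using assms(1) by (force simp: elements_mat_def)
  show ?thesis unfolding max_entry_norm_def
    by (rule Max_ge) (use assms in \<open>auto simp: eq\<close>)
qed

theorem theorem1: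
  shows "\<exists>c::real. c > 0 \<and>
    (\<forall>(n::nat) (A::real mat) (\<epsilon>::real) (\<delta>::real) (s::real).
       A \<in> carrier_mat n n \<longrightarrow> transpose_mat A = A \<longrightarrow> max_entry_norm A \<le> 1 \<longrightarrow>
       0 < \<epsilon> \<longrightarrow> \<epsilon> < 1 \<longrightarrow> 0 < \<delta> \<longrightarrow> \<delta> < 1 \<longrightarrow>
       0 < s \<longrightarrow> s \<le> real n \<longrightarrow>
       s \<ge> c * log_ge1 (1 / (\<epsilon> * \<delta>)) * (log_ge1 (real n)) ^ 3 / (\<epsilon> ^ 3 * \<delta>) \<longrightarrow>
       measure_pmf.prob (random_index_set n (s / real n))
         {S. \<forall>i\<in>{1..n}. eigval A i - \<epsilon> * real n \<le> approx_eigval n s A S i \<and>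
                         approx_eigval n s A S i \<le> eigval A i + \<epsilon> * real n}
         \<ge> 1 - \<delta>)"
\<comment> \<open>The constant is the one demanded by \<open>outlier_exponent\<close>.\<close>
proof (intro exI[of _ 30000000] conjI allI impI)
  fix n A \<epsilon> \<delta> s
  assume A: "A \<in> carrier_mat n n" and sym: "transpose_mat A = A" and max: "max_entry_norm A \<le> 1"
    and \<epsilon>: "0 < \<epsilon>" "\<epsilon> < 1" and \<delta>: "0 < \<delta>" "\<delta> < 1" and s: "0 < s" "s \<le> real n"
    and s_ge: "30000000 * log_ge1 (1 / (\<epsilon> * \<delta>)) * (log_ge1 (real n)) ^ 3 / (\<epsilon> ^ 3 * \<delta>) \<le> s"
  define \<Lambda> where "\<Lambda> = log_ge1 (1 / (\<epsilon> * \<delta>)) * (log_ge1 (real n)) ^ 3"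
  define e where "e = \<epsilon> * n / 4"
  define \<tau> where "\<tau> = e / 56"
  define p where "p = s / n"
  \<comment> \<open>Since \<Lambda> \<ge> 1, rounding up stays within 7 \<Lambda>.\<close>
  define q where "q = nat \<lceil>6 * \<Lambda>\<rceil>"
  \<comment> \<open>The empty matrix is excluded by 0 < s \<le> n.\<close>
  have n: "real n > 0" "real n \<ge> 1" "n \<ge> 1" using s by auto
  have \<Lambda>: "\<Lambda> \<ge> 1" "\<Lambda> \<ge> ln n" "\<Lambda> \<ge> ln (1 / \<delta>)"
    using log_product_ge[OF \<epsilon> \<delta> n(2)] by (simp_all add: \<Lambda>_def)
  have s_large: "30000000 * \<Lambda> / \<epsilon> ^ 3 \<le> s"
  proof -
    have "30000000 * \<Lambda> / \<epsilon> ^ 3 \<le> (30000000 * \<Lambda> / \<epsilon> ^ 3) / \<delta>"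
      using \<delta> \<Lambda> \<epsilon> by (simp add: le_divide_eq mult_left_le)
    also have "\<dots> \<le> s" using s_ge by (simp add: \<Lambda>_def mult.assoc)
    finally show ?thesis .
  qed
  have p: "0 < p" "p \<le> 1" using s n by (auto simp: p_def)
  have e: "e > 0" and \<tau>_bounds: "\<tau> > 0" "\<tau> \<le> 2 * e" using \<epsilon> n by (auto simp: e_def \<tau>_def)
  have q: "6 * \<Lambda> \<le> q" "q \<le> 7 * \<Lambda>" "q \<ge> 1"
    using \<Lambda>(1) unfolding q_def by linarith+
  let ?N = "{..<n}" and ?a = "\<lambda>i j. A $$ (i, j)"
  have a_sym: "?a i j = ?a j i" if "i < n" "j < n" for i j
  proof -
    have "A $$ (i, j) = transpose_mat A $$ (i, j)" by (simp add: sym)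
    also have "\<dots> = A $$ (j, i)" using that A by (intro index_transpose_mat) auto
    finally show ?thesis .
  qed
  have "\<exists>lam v. spectral ?N ?a ?N lam v" by (rule spectral_exists) (use a_sym in auto)
  then obtain lam v where spec: "spectral ?N ?a ?N lam v" by blast
  define J where "J = {j \<in> ?N. \<bar>lam j\<bar> \<ge> \<tau>}"
  interpret bounded_spectral ?N ?a lam v "real n" e \<tau> J
    by unfold_locales
      (use spec e \<tau>_bounds J_def abs_entry_le_max_entry_norm[OF A] max in \<open>auto intro: order_trans\<close>)
  define good where "good S \<longleftrightarrow> (\<forall>i\<in>{1..n}. eigval A i - \<epsilon> * real n \<le> approx_eigval n s A S i \<and>
                         approx_eigval n s A S i \<le> eigval A i + \<epsilon> * real n)" for S
  have good: "good S" if S: "S \<subseteq> ?N" and E: "outliers_preserved p S" "small_part_bounded p S" for S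
  proof -
    have "\<exists>\<theta> u. spectral S ?a S \<theta> u"
    proof (rule spectral_exists)
      show "finite S" using S finite_subset by blast
      show "?a i j = ?a j i" if "i \<in> S" "j \<in> S" for i j using a_sym S that by auto
    qed
    then obtain \<theta> u where specS: "spectral S ?a S \<theta> u" by blast
    have sampled: "sampled_spectrum ?N S J ?a lam \<theta> v u p e \<tau> (\<lambda>j. 1 / weight j)"
    proof
      show "1 / weight j \<le> 1 / 2" for j using weight_ge[of j] by (simp add: field_simps)
      show "0 \<le> 1 / weight j" for j using weight_ge[of j] by simp
      show "\<bar>lam j\<bar> * (1 / weight j) \<le> e" for j
        using weight_ge[of j] e by (simp add: divide_le_eq weight_def field_simps)
      show "\<bar>lam j\<bar> \<ge> \<tau> \<Longrightarrow> j \<in> J" if "j \<in> ?N" for j using that by (simp add: J_def)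
    qed (use spec specS S J_sub p e E in \<open>auto simp: outliers_preserved_def small_part_bounded_def\<close>)
    have "\<bar>approx_eigval n s A S i - eigval A i\<bar> \<le> \<epsilon> * real n" if "i \<in> {1..n}" for i
      using approx_eigval_accuracy[OF A s(1) sampled[unfolded p_def] \<tau>_bounds(2) that] by (simp add: e_def)
    then show ?thesis unfolding good_def by (force simp: abs_le_iff)
  qed
  have outliers: "expect ?N p (\<lambda>S. of_bool (\<not> outliers_preserved p S)) \<le> 3 * real n * exp (- (6 * \<Lambda>))"
  proof -
    have "expect ?N p (\<lambda>S. of_bool (\<not> outliers_preserved p S)) \<le>
        3 * real n * exp (- p / (8 * (2 + n / e) * (2 * (n / \<tau>\<^sup>2) + n / (e * \<tau>))))"
      by (rule outliers_preserved_prob[OF p n(1)])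
    also have "\<dots> \<le> 3 * real n * exp (- (6 * \<Lambda>))"
    proof (rule mult_left_mono)
      note outlier_exponent[OF n(1) \<epsilon> \<Lambda>(1) s_large, folded e_def, folded \<tau>_def p_def]
      then show "exp (- p / (8 * (2 + n / e) * (2 * (n / \<tau>\<^sup>2) + n / (e * \<tau>)))) \<le> exp (- (6 * \<Lambda>))"
        by (simp only: divide_minus_left exp_le_cancel_iff neg_le_iff_le)
    qed simp
    finally show ?thesis .
  qed
  have small: "expect ?N p (\<lambda>S. of_bool (\<not> small_part_bounded p S)) \<le> 2 * (real n)\<^sup>2 * exp (- (6 * \<Lambda>))"
  proof -
    note c = middle_constants[OF n(1) \<epsilon> \<Lambda>(1) s_large s(2) q(1,2), folded e_def, folded \<tau>_def p_def]
    have "expect ?N p (\<lambda>S. of_bool (\<not> small_part_bounded p S)) \<le> 2 * (real n)\<^sup>2 *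
        (32 * (p\<^sup>2 * (2 * \<tau>\<^sup>2 + 2 * (1 + n / \<tau>)\<^sup>2) + p * q * n + (real q)\<^sup>2 * (1 + n / \<tau>)\<^sup>2) / (p * e / 2)\<^sup>2) ^ q"
      by (rule small_part_bounded_prob[OF p q(3) c(1)])
    also have "\<dots> \<le> 2 * (real n)\<^sup>2 * exp (- (6 * \<Lambda>))" using c(2) by (intro mult_left_mono) auto
    finally show ?thesis .
  qed
  \<comment> \<open>The union bound as a pointwise inequality: the indicator of \<open>good\<close>
    is at least 1 minus the two failure indicators.\<close>
  have "1 - \<delta> \<le> 1 - (3 * real n * exp (- (6 * \<Lambda>)) + 2 * (real n)\<^sup>2 * exp (- (6 * \<Lambda>)))"
    using failure_bounds[OF n(2) \<delta>(1) \<Lambda>] by simp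
  also have "\<dots> \<le> expect ?N p (\<lambda>_. 1) - (expect ?N p (\<lambda>S. of_bool (\<not> outliers_preserved p S)) +
      expect ?N p (\<lambda>S. of_bool (\<not> small_part_bounded p S)))"
    using outliers small by (simp add: expect_const)
  also have "\<dots> = expect ?N p (\<lambda>S. 1 - (of_bool (\<not> outliers_preserved p S) + of_bool (\<not> small_part_bounded p S)))"
    by (simp add: expect_diff expect_add)
  also have "\<dots> \<le> expect ?N p (\<lambda>S. of_bool (S \<in> {S. good S}))"
    using good p by (intro expect_mono) auto
  also have "\<dots> = measure_pmf.prob (random_index_set n p) {S. good S}"
    using p by (intro prob_random_index_set[symmetric]) auto
  finally show "measure_pmf.prob (random_index_set n (s / real n))
         {S. \<forall>i\<in>{1..n}. eigval A i - \<epsilon> * real n \<le> approx_eigval n s A S i \<and>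
                         approx_eigval n s A S i \<le> eigval A i + \<epsilon> * real n} \<ge> 1 - \<delta>"
    by (simp add: good_def p_def)
qed simp

end
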